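(* Let $\nu$ and $\mu$ be two complex numbers with $\operatorname{Re}\nu<1$ and $\operatorname{Re}\mu<\min[1-\operatorname{Re}\nu,\,2+\operatorname{Re}\nu]$. Then, for $\operatorname{Re}p>0$, $|\arg x|<\pi$, $x\ge0$, $|\arg y|<\pi$, $y>0$, $$ \begin{aligned} &p^{-1/2}\exp\left(\tfrac12 p(y-x)\right)D_\mu\left(2^{1/2}y^{1/2}p^{1/2}\right)\left\{D_\nu\left(-2^{1/2}x^{1/2}p^{1/2}\right)+D_\nu\left(2^{1/2}x^{1/2}p^{1/2}\right)\right\}\\ &=\frac{2^{(\mu-\nu)/2}\sqrt\pi}{\Gamma\left[1+(\nu-\mu)/2\right]\Gamma[-\nu]}\int_0^x e^{-pt}\,t^{(\nu-\mu)/2}(x-t)^{-(1+\nu)/2}(y+t)^{\mu/2}\\ &\qquad\times{}_2F_1\left(-\frac{\mu}{2},\frac{1+\nu}{2};1+\frac{\nu-\mu}{2};\frac{t(x-y-t)}{(x-t)(y+t)}\right)dt\\ &\quad+\frac{2^{1+(\mu+\nu)/2}\sqrt\pi}{\Gamma\left[(1-\nu)/2\right]\Gamma\left[(1-\mu)/2\right]}\int_x^\infty e^{-pt}\,t^{\nu/2}(t-x)^{-(1+\mu+\nu)/2}(y-x+t)^{\mu/2}\\ &\qquad\times{}_2F_1\left(-\frac{\mu}{2},-\frac{\nu}{2};\frac12;\frac{xy}{t(y-x+t)}\right)dt . \end{aligned} $$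
   Context: $\Gamma[\cdot]$ is the gamma function, with $1/\Gamma$ taken to be $0$ at the nonpositive integers. ${}_2F_1(a,b;c;z)$ is the Gaussian hypergeometric function. $D_\nu(z)$ is Whittaker's parabolic cylinder function of order $\nu$ and argument $z$, given by $$D_\nu(z)=2^{\nu/2}e^{-z^2/4}\left\{\frac{\Gamma[1/2]}{\Gamma[(1-\nu)/2]}\Phi\left(-\frac{\nu}{2};\frac12;\frac{z^2}{2}\right)+\frac{z}{2^{1/2}}\frac{\Gamma[-1/2]}{\Gamma[-\nu/2]}\Phi\left(\frac{1-\nu}{2};\frac32;\frac{z^2}{2}\right)\right\},$$ where $\Phi(a;b;z)=\sum_{n\ge0}\frac{(a)_n}{(b)_n}\frac{z^n}{n!}$ is Kummer's confluent hypergeometric function. All powers are principal values.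
   Formalization: When x = 0 the condition Re μ < 1 is added: there the second integral becomes ∫₀^∞ e^{-pt} t^{-(1+μ)/2}(y+t)^{μ/2} dt, which diverges for Re μ ≥ 1 (e.g. ν = -0.4, μ = 1.2), so the formula as printed fails; nothing is changed for x > 0. *)

theory Defs
  imports "HOL-Complex_Analysis.Complex_Analysis"
begin

text \<open>
  Terms of Gauss's hypergeometric series. The parameter \<open>c\<close> (and \<open>b\<close> in
  \<open>kummer_Phi a b\<close> below) is meant not to be a nonpositive integer.
\<close>

definition gauss_2F1_term :: "complex \<Rightarrow> complex \<Rightarrow> complex \<Rightarrow> complex \<Rightarrow> nat \<Rightarrow> complex" where
  "gauss_2F1_term a b c z n =
     pochhammer a n * pochhammer b n / pochhammer c n * z ^ n / fact n"

text \<open>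
  \<open>f\<close> continues the hypergeometric series, which converges on the unit disc, to a convex open neighbourhood \<open>S\<close> of \<open>0\<close> that avoids the branch cut \<open>[1, \<infinity>)\<close>.
\<close>

definition continues_2F1 ::
    "complex \<Rightarrow> complex \<Rightarrow> complex \<Rightarrow> complex set \<Rightarrow> (complex \<Rightarrow> complex) \<Rightarrow> bool" where
  "continues_2F1 a b c S f \<longleftrightarrow>
     open S \<and> convex S \<and> 0 \<in> S \<and> S \<inter> complex_of_real ` {1..} = {} \<and>
     f holomorphic_on S \<and> (\<forall>u \<in> S \<inter> ball 0 1. gauss_2F1_term a b c u sums f u)"

text \<open>
  The principal branch of \<open>\<^sub>2F\<^sub>1(a, b; c; z)\<close> for \<open>z\<close> outside \<open>[1, \<infinity>)\<close>: the analytic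
  continuation of the series along the segment from \<open>0\<close> to \<open>z\<close>. Such a segment has a
  convex open neighbourhood that avoids the cut, and by the identity theorem the value
  does not depend on its choice (\<open>gauss_2F1_eqI\<close>). No value is specified on the cut.
\<close>

definition gauss_2F1 :: "complex \<Rightarrow> complex \<Rightarrow> complex \<Rightarrow> complex \<Rightarrow> complex" where
  "gauss_2F1 a b c z = (THE w. \<exists>S f. continues_2F1 a b c S f \<and> z \<in> S \<and> w = f z)"

lemma gauss_2F1_eqI:
  assumes "continues_2F1 a b c S f" and "z \<in> S"
  shows "gauss_2F1 a b c z = f z"
  unfolding gauss_2F1_def
proof (rule the_equality)
  show "\<exists>S' f'. continues_2F1 a b c S' f' \<and> z \<in> S' \<and> f z = f' z"
    using assms by blast
next
  fix w assume "\<exists>S' f'. continues_2F1 a b c S' f' \<and> z \<in> S' \<and> w = f' z"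
  then obtain T g where T: "continues_2F1 a b c T g" "z \<in> T" and w: "w = g z" by blast
  define U where "U = S \<inter> T"
  have U: "open U" "connected U" "0 \<in> U" "z \<in> U"
    using assms T unfolding U_def continues_2F1_def
    by (auto intro: convex_connected convex_Int)
  have hol: "f holomorphic_on U" "g holomorphic_on U"
    using assms T unfolding U_def continues_2F1_def
    by (auto intro: holomorphic_on_subset)
  have eq: "f u = g u" if "u \<in> U \<inter> ball 0 1" for u
    using assms T that sums_unique2 unfolding U_def continues_2F1_def by blast
  have "f z = g z"
    by (rule analytic_continuation_open[of "U \<inter> ball 0 1" U f g])
       (use U hol eq in auto)
  with w show "w = f z" by simp
qed

definition kummer_Phi :: "complex \<Rightarrow> complex \<Rightarrow> complex \<Rightarrow> complex" where
  "kummer_Phi a b z = (\<Sum>n. pochhammer a n / pochhammer b n * z ^ n / fact n)"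

text \<open>\<open>rGamma\<close> is the entire function \<open>1/\<Gamma>\<close>, which is \<open>0\<close> at the nonpositive integers.\<close>

definition parabolic_cylinder_D :: "complex \<Rightarrow> complex \<Rightarrow> complex" where
  "parabolic_cylinder_D \<nu> z =
     2 powr (\<nu> / 2) * exp (- (z ^ 2) / 4) *
     (Gamma (1 / 2) * rGamma ((1 - \<nu>) / 2) * kummer_Phi (- \<nu> / 2) (1 / 2) (z ^ 2 / 2)
      + z / 2 powr (1 / 2) * (Gamma (- 1 / 2) * rGamma (- \<nu> / 2))
        * kummer_Phi ((1 - \<nu>) / 2) (3 / 2) (z ^ 2 / 2))"

text \<open>
  For \<open>y > 0\<close> and \<open>0 < t < x\<close>, respectively \<open>t > x \<ge> 0\<close>, the bases of the powers are positive
  and the hypergeometric argument is less than \<open>1\<close>. It lies in \<open>[0, 1)\<close> in \<open>integrand_above\<close>, but it is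
  unbounded below in \<open>integrand_below\<close>, where the series alone would not do.
\<close>

definition integrand_below ::
    "complex \<Rightarrow> complex \<Rightarrow> complex \<Rightarrow> real \<Rightarrow> real \<Rightarrow> real \<Rightarrow> complex" where
  "integrand_below \<nu> \<mu> p x y t =
     exp (- p * of_real t) * of_real t powr ((\<nu> - \<mu>) / 2)
     * of_real (x - t) powr (- (1 + \<nu>) / 2) * of_real (y + t) powr (\<mu> / 2)
     * gauss_2F1 (- \<mu> / 2) ((1 + \<nu>) / 2) (1 + (\<nu> - \<mu>) / 2)
         (of_real (t * (x - y - t) / ((x - t) * (y + t))))"

definition integrand_above ::
    "complex \<Rightarrow> complex \<Rightarrow> complex \<Rightarrow> real \<Rightarrow> real \<Rightarrow> real \<Rightarrow> complex" where
  "integrand_above \<nu> \<mu> p x y t =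
     exp (- p * of_real t) * of_real t powr (\<nu> / 2)
     * of_real (t - x) powr (- (1 + \<mu> + \<nu>) / 2) * of_real (y - x + t) powr (\<mu> / 2)
     * gauss_2F1 (- \<mu> / 2) (- \<nu> / 2) (1 / 2)
         (of_real (x * y / (t * (y - x + t))))"

end

theory Submission
  imports Defs "HOL-Probability.Distributions"
begin

text \<open>
  Write \<open>a = -\<mu>/2\<close>, \<open>b = -\<nu>/2\<close>. The even combination of \<open>D\<^sub>\<nu>\<close> is, up to elementary factors,
  \<open>\<Phi>(b; 1/2; px)\<close>. For real \<open>a > 0\<close> and \<open>0 < b < 1/2\<close> both factors of the product are Laplace
  transforms in \<open>p\<close>: \<open>p\<^bsup>-1/2\<^esup> exp(py/2) D\<^sub>\<mu>\<close> has the density \<open>t\<^bsup>a-1/2\<^esup> (y+t)\<^bsup>-a\<^esup>\<close> on \<open>t > 0\<close>, and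
  \<open>exp(-px) \<Phi>(b; 1/2; px)\<close> has the density \<open>u\<^bsup>-b-1/2\<^esup> (x-u)\<^bsup>b-1\<^esup>\<close> on \<open>0 < u < x\<close>. The convolution of these
  densities is an integral over \<open>0 < u < min x t\<close> with four branch points whose exponents add up to \<open>-2\<close>, so
  that a Moebius substitution turns it into Euler's integral for a hypergeometric function; the two
  ranges \<open>t < x\<close> and \<open>t > x\<close> give the two integrals. Both sides are holomorphic in \<open>\<nu>\<close> and in \<open>\<mu>\<close>, and
  the identity theorem, applied first in \<open>\<nu>\<close> and then in \<open>\<mu>\<close>, extends the formula to all admissible parameters.
\<close>

subsection \<open>Holomorphic dependence of integrals and change of variables\<close>

text \<open>The convolution argument works only for real \<open>\<mu> < 0\<close> and
  \<open>-1 < \<nu> < 0\<close>; everything else is continuation, and the effort goes into showing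
  that both integrals are holomorphic. That takes bounds for the hypergeometric factor which are
  uniform for nearby parameters and cover all arguments that occur: tending to 1 in
  \<open>integrand_above\<close>, unbounded below in \<open>integrand_below\<close>. One coefficient
  estimate settles the first; Pfaff's transformation, which carries the negative axis into
  \<open>[0, 1)\<close>, reduces the second to it. The hypotheses appear as exponents:
  \<open>Re \<mu> < 1 - Re \<nu>\<close> is integrability at \<open>t = x\<close> from either side,
  and \<open>Re \<mu> < 2 + Re \<nu>\<close> is integrability at \<open>t = 0\<close> and also
  positivity of the real part of the lower parameter \<open>1 + (\<nu> - \<mu>) / 2\<close>. At
  \<open>x = 0\<close> the singularities at 0 and at \<open>x\<close> merge into
  \<open>t powr (- (1 + \<mu>) / 2)\<close>. The condition is then \<open>Re \<mu> < 1\<close>, and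
  this case is derived separately, from the Laplace transform of one parabolic cylinder
  function.\<close>

lemma holomorphic_on_suminf_local:
  fixes f :: "nat \<Rightarrow> complex \<Rightarrow> complex"
  assumes "open S" and "\<And>n. f n holomorphic_on S"
    and "\<And>z. z \<in> S \<Longrightarrow> \<exists>d h. 0 < d \<and> summable h \<and> (\<forall>n. \<forall>w\<in>ball z d \<inter> S. norm (f n w) \<le> h n)"
  shows "(\<lambda>z. \<Sum>n. f n z) holomorphic_on S"
proof -
  have "\<exists>g g'. \<forall>x \<in> S. ((\<lambda>n. f n x) sums g x) \<and> ((\<lambda>n. deriv (f n) x) sums g' x)
          \<and> (g has_field_derivative g' x) (at x)"
  proof (rule series_and_derivative_comparison_local[OF assms(1)])
    show "(f n has_field_derivative deriv (f n) x) (at x)" if "x \<in> S" for n x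
      using assms(1,2) that holomorphic_derivI by blast
    fix x assume "x \<in> S"
    then obtain d h where "0 < d" "summable h" "\<forall>n. \<forall>w\<in>ball x d \<inter> S. norm (f n w) \<le> h n"
      using assms(3) by meson
    then show "\<exists>d h. 0 < d \<and> summable h \<and> (\<forall>\<^sub>F n in sequentially. \<forall>y\<in>ball x d \<inter> S. norm (f n y) \<le> h n)"
      by (intro exI[of _ d] exI[of _ h]) auto
  qed
  then obtain g g' where g: "\<forall>x \<in> S. ((\<lambda>n. f n x) sums g x) \<and> ((\<lambda>n. deriv (f n) x) sums g' x)
          \<and> (g has_field_derivative g' x) (at x)" by (elim exE)
  have "g holomorphic_on S"
    unfolding holomorphic_on_open[OF assms(1)] using g by auto
  then show ?thesis
    by (rule holomorphic_transform) (use g sums_unique in auto)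
qed

text \<open>A majorant of \<open>g\<close> itself suffices, with no bound on its derivative: by
  Cauchy's inequality on discs of radius \<open>r\<close> the difference quotients are at most
  \<open>W t / r\<close>, and dominated convergence applies along every sequence tending to
  \<open>z0\<close>.\<close>

lemma holomorphic_on_integral_dominated:
  fixes g :: "complex \<Rightarrow> 'a \<Rightarrow> complex"
  assumes "open S"
    and meas: "\<And>z. z \<in> S \<Longrightarrow> g z \<in> borel_measurable M"
    and hol: "\<And>t. t \<in> space M \<Longrightarrow> (\<lambda>z. g z t) holomorphic_on S"
    and dom: "\<And>z0. z0 \<in> S \<Longrightarrow> \<exists>r>0. \<exists>W. integrable M W \<and>
                (\<forall>z\<in>ball z0 r \<inter> S. \<forall>t\<in>space M. norm (g z t) \<le> W t)"
  shows "(\<lambda>z. \<integral>t. g z t \<partial>M) holomorphic_on S"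
proof -
  have "(\<lambda>z. \<integral>t. g z t \<partial>M) field_differentiable at z0" if z0: "z0 \<in> S" for z0
  proof -
    obtain r1 W where r1: "r1 > 0" "integrable M W"
      and W: "\<And>z t. z \<in> ball z0 r1 \<inter> S \<Longrightarrow> t \<in> space M \<Longrightarrow> norm (g z t) \<le> W t"
      using dom[OF z0] by blast
    obtain r2 where r2: "r2 > 0" "ball z0 r2 \<subseteq> S"
      using assms(1) z0 by (meson openE)
    \<comment> \<open>Small enough that a closed disc of radius \<open>r\<close> about any point of
      \<open>ball z0 r\<close> stays where \<open>W\<close> dominates.\<close>
    define r where "r = min r1 r2 / 3"
    have r: "r > 0" and sub: "ball z0 (3*r) \<subseteq> ball z0 r1 \<inter> S"
      using r1 r2 by (auto simp: r_def)
    define D where "D t = deriv (\<lambda>z. g z t) z0" for t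
    have integ: "integrable M (g z)" if "z \<in> ball z0 (3*r)" for z
      by (rule Bochner_Integration.integrable_bound[OF r1(2)])
        (use meas W that sub in \<open>force+\<close>)
    have lip: "norm (g z t - g z0 t) \<le> (W t / r) * norm (z - z0)"
      if z: "z \<in> ball z0 r" and t: "t \<in> space M" for z t
    proof (rule field_differentiable_bound[of "ball z0 r" "\<lambda>z. g z t" "\<lambda>u. deriv (\<lambda>z. g z t) u"])
      fix u assume u: "u \<in> ball z0 r"
      have sub': "cball u r \<subseteq> ball z0 r1 \<inter> S"
      proof -
        have "cball u r \<subseteq> ball z0 (3*r)" 
        proof
          fix v assume "v \<in> cball u r"
          then have "dist z0 v \<le> dist z0 u + dist u v" "dist u v \<le> r" "dist z0 u < r"
            using u by (auto simp: dist_triangle)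
          then show "v \<in> ball z0 (3*r)" using r by simp
        qed
        then show ?thesis using sub by blast
      qed
      have h: "(\<lambda>z. g z t) holomorphic_on cball u r"
        using hol[OF t] sub' holomorphic_on_subset by blast
      have "norm ((deriv ^^ 1) (\<lambda>z. g z t) u) \<le> fact 1 * W t / r ^ 1"
        by (rule Cauchy_inequality)
          (use h holomorphic_on_imp_continuous_on holomorphic_on_subset[OF h ball_subset_cball] r W t sub'
            in \<open>auto simp: dist_norm norm_minus_commute subset_iff\<close>)
      then show "norm (deriv (\<lambda>z. g z t) u) \<le> W t / r" by simp
      have "u \<in> S" using sub' r by (simp add: subset_iff)
      then show "((\<lambda>z. g z t) has_field_derivative deriv (\<lambda>z. g z t) u) (at u within ball z0 r)"
        using holomorphic_derivI[OF hol[OF t] assms(1)] by blast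
    qed (use z r in auto)
    have "((\<lambda>z. ((\<integral>t. g z t \<partial>M) - (\<integral>t. g z0 t \<partial>M)) / (z - z0)) \<longlongrightarrow> (\<integral>t. D t \<partial>M)) (at z0)"
      unfolding tendsto_at_iff_sequentially
    proof (intro allI impI)
      fix X assume X: "\<forall>i. X i \<in> UNIV - {z0}" "X \<longlonglongrightarrow> z0"
      \<comment> \<open>The Lipschitz bound holds only inside \<open>ball z0 r\<close>, so the first
        \<open>N\<close> members of the sequence are dropped.\<close>
      obtain N where N: "\<And>n. n \<ge> N \<Longrightarrow> X n \<in> ball z0 r"
        using X(2) r unfolding lim_sequentially by (auto simp: dist_commute)
      define Y where "Y n = X (n + N)" for n
      have Y: "\<And>n. Y n \<noteq> z0" "\<And>n. Y n \<in> ball z0 r"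
        using X(1) N by (auto simp: Y_def)
      have Ylim: "Y \<longlonglongrightarrow> z0"
        unfolding Y_def by (rule LIMSEQ_ignore_initial_segment[OF X(2)])
      have Y3: "Y n \<in> ball z0 (3*r)" for n using Y(2)[of n] r by auto
      have conv: "(\<lambda>n. (g (Y n) t - g z0 t) / (Y n - z0)) \<longlonglongrightarrow> D t" if t: "t \<in> space M" for t
      proof -
        have "((\<lambda>z. g z t) has_field_derivative D t) (at z0)"
          unfolding D_def using holomorphic_derivI[OF hol[OF t] assms(1) z0] by blast
        then have "((\<lambda>y. (g y t - g z0 t) / (y - z0)) \<longlongrightarrow> D t) (at z0)"
          by (simp add: has_field_derivative_iff)
        then show ?thesis
          unfolding tendsto_at_iff_sequentially using Y Ylim by (auto simp: o_def)
      qed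
      have "(\<lambda>n. \<integral>t. (g (Y n) t - g z0 t) / (Y n - z0) \<partial>M) \<longlonglongrightarrow> (\<integral>t. D t \<partial>M)"
      proof (rule integral_dominated_convergence[where w = "\<lambda>t. W t / r"])
        have m: "(\<lambda>t. (g (Y n) t - g z0 t) / (Y n - z0)) \<in> borel_measurable M" for n
          using meas[of "Y n"] meas[OF z0] Y3[of n] sub
          by (intro borel_measurable_divide borel_measurable_diff) auto
        then show "(\<lambda>t. (g (Y n) t - g z0 t) / (Y n - z0)) \<in> borel_measurable M" for n .
        show "D \<in> borel_measurable M"
          by (rule borel_measurable_LIMSEQ_metric[where f = "\<lambda>n t. (g (Y n) t - g z0 t) / (Y n - z0)"])
            (use m conv in auto)
        show "AE t in M. (\<lambda>n. (g (Y n) t - g z0 t) / (Y n - z0)) \<longlonglongrightarrow> D t"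
          using conv by auto
        show "AE t in M. norm ((g (Y n) t - g z0 t) / (Y n - z0)) \<le> W t / r" for n
          using lip[OF Y(2)[of n]] Y(1)[of n] by (intro AE_I2) (simp add: norm_divide pos_divide_le_eq)
      qed (use r1 in auto)
      moreover have "(\<integral>t. (g (Y n) t - g z0 t) / (Y n - z0) \<partial>M)
          = ((\<integral>t. g (Y n) t \<partial>M) - (\<integral>t. g z0 t \<partial>M)) / (Y n - z0)" for n
        using Bochner_Integration.integral_diff[OF integ[OF Y3[of n]] integ[of z0]] r
        by (simp only: integral_divide_zero) simp
      ultimately have "(\<lambda>n. ((\<integral>t. g (Y n) t \<partial>M) - (\<integral>t. g z0 t \<partial>M)) / (Y n - z0)) \<longlonglongrightarrow> (\<integral>t. D t \<partial>M)"
        by (simp only:)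
      then show "((\<lambda>z. ((\<integral>t. g z t \<partial>M) - (\<integral>t. g z0 t \<partial>M)) / (z - z0)) \<circ> X) \<longlonglongrightarrow> (\<integral>t. D t \<partial>M)"
        unfolding Y_def o_def
        by (rule LIMSEQ_offset[where k=N and f="\<lambda>n. ((\<integral>t. g (X n) t \<partial>M) - (\<integral>t. g z0 t \<partial>M)) / (X n - z0)"])
    qed
    then show ?thesis
      unfolding field_differentiable_def has_field_derivative_iff by blast
  qed
  then show ?thesis
    using assms(1) by (simp add: holomorphic_on_def field_differentiable_at_within)
qed

lemma holomorphic_on_set_integral_dominated:
  fixes g :: "complex \<Rightarrow> 'a \<Rightarrow> complex"
  assumes "open S"
    and "\<And>z. z \<in> S \<Longrightarrow> set_borel_measurable M A (g z)"
    and "\<And>t. t \<in> A \<Longrightarrow> (\<lambda>z. g z t) holomorphic_on S"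
    and dom: "\<And>z0. z0 \<in> S \<Longrightarrow> \<exists>r>0. \<exists>W. set_integrable M A W \<and>
                (\<forall>z\<in>ball z0 r \<inter> S. \<forall>t\<in>A. norm (g z t) \<le> W t)"
  shows "(\<lambda>z. \<integral>t\<in>A. g z t \<partial>M) holomorphic_on S"
  unfolding set_lebesgue_integral_def
proof (rule holomorphic_on_integral_dominated[OF assms(1)])
  fix z assume "z \<in> S"
  then show "(\<lambda>t. indicator A t *\<^sub>R g z t) \<in> borel_measurable M"
    using assms(2) by (simp add: set_borel_measurable_def)
next
  fix t
  show "(\<lambda>z. indicator A t *\<^sub>R g z t) holomorphic_on S"
    using assms(3)[of t] by (cases "t \<in> A") (auto simp: indicator_def)
next
  fix z0 assume "z0 \<in> S"
  from dom[OF this] obtain r W where r: "r > 0" "set_integrable M A W"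
    "\<And>z t. z\<in>ball z0 r \<inter> S \<Longrightarrow> t\<in>A \<Longrightarrow> norm (g z t) \<le> W t" by blast
  have "norm (indicator A t *\<^sub>R g z t) \<le> indicator A t *\<^sub>R W t" if "z \<in> ball z0 r \<inter> S" for z t
    using r(3)[OF that, of t] by (auto simp: indicator_def)
  with r show "\<exists>r>0. \<exists>W. integrable M W \<and>
      (\<forall>z\<in>ball z0 r \<inter> S. \<forall>t\<in>space M. norm (indicator A t *\<^sub>R g z t) \<le> W t)"
    unfolding set_integrable_def by blast
qed

lemma set_integrable_lborel_iff_absolutely_integrable:
  fixes f :: "'a::euclidean_space \<Rightarrow> 'b::{banach, second_countable_topology}"
  assumes "set_borel_measurable lborel A f"
  shows "set_integrable lborel A f \<longleftrightarrow> set_integrable lebesgue A f"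
  using assms unfolding set_integrable_def set_borel_measurable_def
  by (intro integrable_completion[symmetric]) auto

text \<open>For Borel measurable integrands Lebesgue and Borel integrals agree, so the substitution
  rule transfers. Integrability is an equivalence because the Gamma integrals and the
  Cauchy-Schloemilch integral carry it through a substitution.\<close>

lemma lborel_set_integral_change_of_variables:
  fixes f g g' :: "real \<Rightarrow> real"
  assumes A: "A \<in> sets borel"
    and f: "set_borel_measurable lborel (g ` A) f"
    and fg: "set_borel_measurable lborel A (\<lambda>x. \<bar>g' x\<bar> * f (g x))"
    and der: "\<And>x. x \<in> A \<Longrightarrow> (g has_field_derivative g' x) (at x within A)"
    and inj: "inj_on g A"
  shows "set_integrable lborel (g ` A) f \<longleftrightarrow> set_integrable lborel A (\<lambda>x. \<bar>g' x\<bar> * f (g x))" (is ?P)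
    and "(LBINT x:g ` A. f x) = (LBINT x:A. \<bar>g' x\<bar> * f (g x))" (is ?Q)
proof -
  have "A \<in> sets lebesgue" using A by simp
  note cov = has_absolute_integral_change_of_variables_1'[OF this der inj, of f]
  show P: ?P
    using cov unfolding set_integrable_lborel_iff_absolutely_integrable[OF f]
      set_integrable_lborel_iff_absolutely_integrable[OF fg] by blast
  show ?Q
  proof (cases "set_integrable lborel (g ` A) f")
    case True
    with P have T: "set_integrable lborel A (\<lambda>x. \<bar>g' x\<bar> * f (g x))" by blast
    show ?thesis
      using cov[of "integral (g ` A) f"] True
      unfolding set_borel_integral_eq_integral(2)[OF True] set_borel_integral_eq_integral(2)[OF T]
      using set_integrable_lborel_iff_absolutely_integrable[OF f] by auto
  next
    \<comment> \<open>Then neither side is integrable, and both integrals have the default value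
      0.\<close>
    case False
    then show ?thesis using P
      unfolding set_lebesgue_integral_def set_integrable_def
      by (simp add: not_integrable_integral_eq)
  qed
qed

subsection \<open>The hypergeometric series\<close>

lemma norm_pochhammer_le:
  fixes a :: "'a :: {real_normed_field}"
  assumes "norm a \<le> R"
  shows "norm (pochhammer a n) \<le> pochhammer R n"
proof (induction n)
  case (Suc n)
  have "norm (a + of_nat n) \<le> norm a + norm (of_nat n :: 'a)" by (rule norm_triangle_ineq)
  also have "\<dots> \<le> R + real n" using assms by simp
  finally have "norm (a + of_nat n) \<le> R + real n" .
  with Suc have "norm (pochhammer a n) * norm (a + of_nat n) \<le> pochhammer R n * (R + real n)"
    using norm_ge_zero order_trans by (intro mult_mono) blast+
  then show ?case by (simp add: pochhammer_Suc norm_mult)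
qed simp

lemma norm_pochhammer_ge:
  fixes c :: complex
  assumes "0 \<le> \<delta>" and "\<delta> \<le> Re c"
  shows "pochhammer \<delta> n \<le> norm (pochhammer c n)"
proof (induction n)
  case (Suc n)
  have "\<delta> + real n \<le> Re (c + of_nat n)" using assms by simp
  also have "\<dots> \<le> norm (c + of_nat n)" by (rule complex_Re_le_cmod)
  finally show ?case
    unfolding pochhammer_Suc norm_mult
    using Suc assms by (intro mult_mono) auto
qed simp

lemma gbinomial_minus_times_power:
  fixes s x :: "'a :: field_char_0"
  shows "(- s gchoose n) * (- x) ^ n = pochhammer s n / fact n * x ^ n"
proof -
  have "(- s gchoose n) * (- x) ^ n = ((-1) * (-1)) ^ n * (pochhammer s n / fact n * x ^ n)"
    unfolding gbinomial_pochhammer power_minus[of x] power_mult_distrib by simp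
  then show ?thesis by simp
qed

lemma binomial_series_pochhammer:
  fixes x :: complex
  assumes "norm x < 1"
  shows "(\<lambda>n. pochhammer s n / fact n * x ^ n) sums (1 - x) powr (- s)"
  using gen_binomial_complex[of "-x" "-s"] assms
  unfolding gbinomial_minus_times_power by simp

lemma binomial_series_pochhammer_real:
  fixes x :: real
  assumes "\<bar>x\<bar> < 1"
  shows "(\<lambda>n. pochhammer s n / fact n * x ^ n) sums (1 - x) powr (- s)"
  using gen_binomial_real[of "-x" "-s"] assms
  unfolding gbinomial_minus_times_power by simp

text \<open>The modulus of \<open>a + n\<close> exceeds \<open>n + Re a\<close> only by a term of
  order \<open>(Im a)^2 / n\<close>. For large \<open>n\<close> one \<open>e\<close> covers this and
  the other covers the variation of \<open>Re a\<close>. The triangle inequality would give the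
  modulus of \<open>a\<close> in place of \<open>Re a0\<close> and so lose the sharp growth
  exponent.\<close>

lemma norm_add_of_nat_le:
  fixes a0 :: complex
  assumes "e > 0"
  shows "\<exists>N. \<forall>n\<ge>N. \<forall>a\<in>cball a0 (min e 1). norm (a + of_nat n) \<le> real n + (Re a0 + 2 * e)"
proof -
  define B where "B = \<bar>Im a0\<bar> + 1"
  \<comment> \<open>This makes \<open>2 * e * m \<ge> B^2\<close> for \<open>m = n + Re a\<close>,
    so that \<open>(m + e)^2\<close> absorbs the square of the imaginary part.\<close>
  obtain N where N: "real N \<ge> B\<^sup>2 / (2 * e) + \<bar>Re a0\<bar> + 1" using real_arch_simple by blast
  have "norm (a + of_nat n) \<le> real n + (Re a0 + 2 * e)" if n: "n \<ge> N" and a: "a \<in> cball a0 (min e 1)" for n a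
  proof -
    have d: "norm (a - a0) \<le> e" "norm (a - a0) \<le> 1" using a by (auto simp: dist_norm norm_minus_commute)
    have "\<bar>Re (a - a0)\<bar> \<le> norm (a - a0)" "\<bar>Im (a - a0)\<bar> \<le> norm (a - a0)"
      by (rule abs_Re_le_cmod, rule abs_Im_le_cmod)
    with d have re: "\<bar>Re a - Re a0\<bar> \<le> e" "\<bar>Re a - Re a0\<bar> \<le> 1" and im: "\<bar>Im a - Im a0\<bar> \<le> 1"
      by auto
    define m where "m = real n + Re a"
    have "\<bar>Im a\<bar> \<le> B" using im by (auto simp: B_def)
    then have im2: "(Im a)\<^sup>2 \<le> B\<^sup>2" using abs_le_square_iff[of "Im a" B] by (simp add: B_def)
    have "m \<ge> B\<^sup>2 / (2 * e)" using N n re unfolding m_def by linarith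
    then have m: "B\<^sup>2 \<le> m * (2 * e)" using assms by (simp add: pos_divide_le_eq)
    have "0 \<le> B\<^sup>2 / (2 * e)" using assms by simp
    then have m0: "m \<ge> 0" using \<open>m \<ge> B\<^sup>2 / (2 * e)\<close> by linarith
    have "(m + e)\<^sup>2 = m\<^sup>2 + m * (2 * e) + e\<^sup>2" by (simp add: power2_eq_square algebra_simps)
    then have "m\<^sup>2 + (Im a)\<^sup>2 \<le> (m + e)\<^sup>2"
      using m im2 zero_le_power2[of e] by linarith
    then have "norm (a + of_nat n) \<le> sqrt ((m + e)\<^sup>2)"
      unfolding cmod_def by (intro real_sqrt_le_mono) (simp add: m_def add_ac)
    also have "\<dots> = m + e" using m0 assms by simp
    finally show ?thesis using re by (simp add: m_def)
  qed
  then show ?thesis by blast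
qed

text \<open>The point of the bound is that it is uniform in the parameters near \<open>(a0, b0, c0)\<close>: it provides
  the summability, the growth as \<open>z \<rightarrow> 1\<close> and the holomorphy in the parameters all at once.\<close>

lemma gauss_2F1_term_majorant:
  fixes a0 b0 c0 :: complex
  assumes "Re c0 > 0" and "\<sigma> > 0" and "\<sigma> > Re (a0 + b0 - c0)"
  obtains K r where "K > 0" "r > 0" "r < Re c0"
    "\<And>a b c z n. a \<in> cball a0 r \<Longrightarrow> b \<in> cball b0 r \<Longrightarrow> c \<in> cball c0 r \<Longrightarrow>
       norm (gauss_2F1_term a b c z n) \<le> K * (pochhammer \<sigma> n / fact n * norm z ^ n)"
proof -
  \<comment> \<open>The perturbed parameters below use up \<open>2 * e\<close>, \<open>2 * e\<close>
    and \<open>e\<close> of the gap \<open>8 * e\<close>, which leaves \<open>3 * e\<close>.\<close>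
  define e where "e = (\<sigma> - Re (a0 + b0 - c0)) / 8"
  have e: "e > 0" using assms by (simp add: e_def)
  define r where "r = min (min e 1) (Re c0 / 2)"
  have r: "r > 0" "r \<le> min e 1" "r \<le> Re c0 / 2" using e assms by (auto simp: r_def)
  have sub: "cball w r \<subseteq> cball w (min e 1)" for w :: complex using r by (intro subset_cball)
  define \<alpha> \<beta> \<gamma> where "\<alpha> = Re a0 + 2 * e" and "\<beta> = Re b0 + 2 * e" and "\<gamma> = Re c0 - e"
  obtain Na where Na: "\<And>n a. n \<ge> Na \<Longrightarrow> a \<in> cball a0 r \<Longrightarrow> norm (a + of_nat n) \<le> real n + \<alpha>"
    using norm_add_of_nat_le[OF e, of a0] sub[of a0] unfolding \<alpha>_def by (meson subsetD)
  obtain Nb where Nb: "\<And>n b. n \<ge> Nb \<Longrightarrow> b \<in> cball b0 r \<Longrightarrow> norm (b + of_nat n) \<le> real n + \<beta>"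
    using norm_add_of_nat_le[OF e, of b0] sub[of b0] unfolding \<beta>_def by (meson subsetD)
  have d: "\<gamma> + \<sigma> - \<alpha> - \<beta> > 0" using e by (simp add: \<alpha>_def \<beta>_def \<gamma>_def e_def field_simps)
  \<comment> \<open>From here on \<open>(n + \<alpha>) * (n + \<beta>) \<le> (n + \<gamma>) * (n +
    \<sigma>)\<close>, an inequality that is linear in \<open>n\<close> with positive slope by
    \<open>d\<close>; the first entry of the maximum keeps \<open>n + \<gamma>\<close>
    positive.\<close>
  obtain Nc where Nc: "real Nc \<ge> max (\<bar>\<gamma>\<bar> + 1) ((\<alpha> * \<beta> - \<gamma> * \<sigma>) / (\<gamma> + \<sigma> - \<alpha> - \<beta>))"
    using real_arch_simple by blast
  define N where "N = max (max Na Nb) Nc"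
  define R where "R = norm a0 + norm b0 + 1"
  define \<delta> where "\<delta> = Re c0 / 2"
  have \<delta>: "\<delta> > 0" using assms by (simp add: \<delta>_def)
  \<comment> \<open>Up to \<open>N\<close> crude bounds by \<open>R\<close> and
    \<open>\<delta>\<close> are enough, and the sum stands in for their maximum. Beyond
    \<open>N\<close> each coefficient grows by a factor of at most \<open>n + \<sigma>\<close>, so
    the estimate propagates by induction.\<close>
  define K where "K = (\<Sum>n\<le>N. pochhammer R n * pochhammer R n / pochhammer \<delta> n / pochhammer \<sigma> n) + 1"
  have R: "R > 0" by (simp add: R_def add_nonneg_pos)
  have pos: "pochhammer R n > 0" "pochhammer \<delta> n > 0" "pochhammer \<sigma> n > 0" for n
    using R \<delta> assms by (auto intro: pochhammer_pos)
  have nonneg: "0 \<le> pochhammer R n * pochhammer R n / pochhammer \<delta> n / pochhammer \<sigma> n" for n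
    using pos[of n] by simp
  have K: "K > 0" unfolding K_def
    by (intro add_nonneg_pos sum_nonneg nonneg) simp
  show thesis
  proof (rule that[OF K r(1)])
    show "r < Re c0" using r(3) assms by simp
    fix a b c z :: complex and n :: nat
    assume a: "a \<in> cball a0 r" and b: "b \<in> cball b0 r" and c: "c \<in> cball c0 r"
    have "norm a \<le> norm a0 + r" using norm_triangle_sub[of a a0] a by (simp add: dist_norm norm_minus_commute)
    then have aR: "norm a \<le> R" using r norm_ge_zero[of b0] unfolding R_def by linarith
    have "norm b \<le> norm b0 + r" using norm_triangle_sub[of b b0] b by (simp add: dist_norm norm_minus_commute)
    then have bR: "norm b \<le> R" using r norm_ge_zero[of a0] unfolding R_def by linarith
    have "\<bar>Re (c - c0)\<bar> \<le> r" using abs_Re_le_cmod[of "c - c0"] c by (simp add: dist_norm norm_minus_commute)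
    then have c\<gamma>: "Re c \<ge> \<gamma>" and c\<delta>: "Re c \<ge> \<delta>" using r by (auto simp: \<gamma>_def \<delta>_def)
    define u where "u n = norm (pochhammer a n * pochhammer b n / pochhammer c n)" for n
    have init: "u n \<le> K * pochhammer \<sigma> n" if "n \<le> N" for n
    proof -
      have "u n \<le> pochhammer R n * pochhammer R n / pochhammer \<delta> n"
        unfolding u_def norm_divide norm_mult
        using pos norm_pochhammer_ge[of \<delta> c] \<delta> c\<delta> norm_pochhammer_le[OF aR] norm_pochhammer_le[OF bR] R
        by (intro frac_le mult_mono) (auto intro: less_imp_le)
      also have "\<dots> = pochhammer R n * pochhammer R n / pochhammer \<delta> n / pochhammer \<sigma> n * pochhammer \<sigma> n"
        using pos(3)[of n] by simp
      also have "\<dots> \<le> K * pochhammer \<sigma> n"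
      proof (rule mult_right_mono)
        have "pochhammer R n * pochhammer R n / pochhammer \<delta> n / pochhammer \<sigma> n
            \<le> (\<Sum>n\<le>N. pochhammer R n * pochhammer R n / pochhammer \<delta> n / pochhammer \<sigma> n)"
          using that by (intro member_le_sum nonneg) auto
        then show "pochhammer R n * pochhammer R n / pochhammer \<delta> n / pochhammer \<sigma> n \<le> K"
          by (simp add: K_def)
      qed (rule less_imp_le[OF pos(3)])
      finally show ?thesis .
    qed
    have "u n \<le> K * pochhammer \<sigma> n"
    proof (cases "n \<le> N")
      case True
      then show ?thesis by (rule init)
    next
      case False
      then have "N \<le> n" by simp
      then show ?thesis
      proof (induction n rule: dec_induct)
        case base
        show ?case by (rule init) simp
      next
        case (step n)
        have n: "n \<ge> Na" "n \<ge> Nb" "n \<ge> Nc" using step by (auto simp: N_def)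
        have nc: "real n \<ge> \<bar>\<gamma>\<bar> + 1" "real n \<ge> (\<alpha> * \<beta> - \<gamma> * \<sigma>) / (\<gamma> + \<sigma> - \<alpha> - \<beta>)" using Nc n by auto
        then have ineq: "(real n + \<alpha>) * (real n + \<beta>) \<le> (real n + \<gamma>) * (real n + \<sigma>)"
          using d by (simp add: pos_divide_le_eq algebra_simps)
        have cn: "real n + \<gamma> \<le> norm (c + of_nat n)"
          using c\<gamma> complex_Re_le_cmod[of "c + of_nat n"] by simp
        have "norm (a + of_nat n) * norm (b + of_nat n) \<le> (real n + \<alpha>) * (real n + \<beta>)"
          using Na[OF n(1) a] Nb[OF n(2) b] by (intro mult_mono) (auto intro: order_trans[OF norm_ge_zero])
        also have "\<dots> \<le> (real n + \<gamma>) * (real n + \<sigma>)" by (rule ineq)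
        also have "\<dots> \<le> norm (c + of_nat n) * (real n + \<sigma>)"
          by (rule mult_right_mono[OF cn]) (use assms(2) in simp)
        finally have "norm (a + of_nat n) * norm (b + of_nat n) / norm (c + of_nat n) \<le> real n + \<sigma>"
          using cn nc by (subst pos_divide_le_eq) (auto simp: mult_ac)
        then have "u n * (norm (a + of_nat n) * norm (b + of_nat n) / norm (c + of_nat n))
            \<le> (K * pochhammer \<sigma> n) * (real n + \<sigma>)"
          using step.IH K pos[of n] by (intro mult_mono) (auto simp: u_def intro: less_imp_le)
        then show ?case
          by (simp add: u_def pochhammer_Suc norm_mult norm_divide mult_ac add_ac)
      qed
    qed
    then have "u n * (norm z ^ n / fact n) \<le> K * pochhammer \<sigma> n * (norm z ^ n / fact n)"
      by (intro mult_right_mono) auto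
    then show "norm (gauss_2F1_term a b c z n) \<le> K * (pochhammer \<sigma> n / fact n * norm z ^ n)"
      by (simp add: u_def gauss_2F1_term_def norm_mult norm_divide norm_power mult_ac)
  qed
qed

text \<open>Kept apart from \<open>gauss_2F1\<close>: it is the right object only inside the unit
  disc, but there it can be estimated term by term.\<close>

definition hyp_series :: "complex \<Rightarrow> complex \<Rightarrow> complex \<Rightarrow> complex \<Rightarrow> complex" where
  "hyp_series a b c z = (\<Sum>n. gauss_2F1_term a b c z n)"

lemma summable_norm_gauss_2F1_term:
  assumes "Re c > 0" and "norm z < 1"
  shows "summable (\<lambda>n. norm (gauss_2F1_term a b c z n))"
proof -
  \<comment> \<open>Any admissible exponent serves, since only the interior of the unit disc matters
    here.\<close>
  define \<sigma> where "\<sigma> = max 1 (Re (a + b - c) + 1)"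
  have "\<sigma> > 0" "\<sigma> > Re (a + b - c)" by (auto simp: \<sigma>_def)
  from gauss_2F1_term_majorant[OF assms(1) this] obtain K r where "r > 0" and
    K: "\<And>a' b' c' z n. a' \<in> cball a r \<Longrightarrow> b' \<in> cball b r \<Longrightarrow> c' \<in> cball c r \<Longrightarrow>
       norm (gauss_2F1_term a' b' c' z n) \<le> K * (pochhammer \<sigma> n / fact n * norm z ^ n)" by metis
  have "summable (\<lambda>n. K * (pochhammer \<sigma> n / fact n * norm z ^ n))"
    using binomial_series_pochhammer_real[of "norm z" \<sigma>] assms(2)
    by (intro summable_mult) (simp add: sums_iff)
  moreover have "norm (norm (gauss_2F1_term a b c z n)) \<le> K * (pochhammer \<sigma> n / fact n * norm z ^ n)" for n
    unfolding norm_ge_zero[THEN abs_of_nonneg] real_norm_def by (rule K) (use \<open>r > 0\<close> in auto)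
  ultimately show ?thesis
    by (rule summable_comparison_test')
qed

lemma hyp_series_sums:
  assumes "Re c > 0" and "norm z < 1"
  shows "gauss_2F1_term a b c z sums hyp_series a b c z"
  unfolding hyp_series_def
  by (rule summable_sums[OF summable_norm_cancel[OF summable_norm_gauss_2F1_term[OF assms]]])

lemma hyp_series_0 [simp]: "hyp_series a b c 0 = 1"
proof -
  have "gauss_2F1_term a b c 0 = (\<lambda>n. if n = 0 then 1 else 0)"
    by (rule ext) (simp add: gauss_2F1_term_def)
  then show ?thesis
    unfolding hyp_series_def using sums_single[of 0 "\<lambda>_. 1 :: complex"] by (simp add: sums_iff)
qed

lemma holomorphic_on_pochhammer [holomorphic_intros]:
  assumes "f holomorphic_on S"
  shows "(\<lambda>s. pochhammer (f s) n) holomorphic_on S"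
  by (induction n) (auto simp: pochhammer_Suc intro!: holomorphic_intros assms)

lemma pochhammer_neq_0_of_Re_pos: "Re c > 0 \<Longrightarrow> pochhammer c n \<noteq> 0"
  by (auto simp: pochhammer_eq_0_iff)

text \<open>Parameters and argument may all move with \<open>s\<close>. Near \<open>s0\<close> the
  argument stays in a disc of radius \<open>q < 1\<close> and the parameters stay in the discs of
  the majorant, whose value at \<open>q\<close> is a locally uniform summable bound.\<close>

lemma holomorphic_on_hyp_series:
  assumes S: "open S"
    and hol: "A holomorphic_on S" "B holomorphic_on S" "C holomorphic_on S" "Z holomorphic_on S"
    and C: "\<And>s. s \<in> S \<Longrightarrow> Re (C s) > 0" and Z: "\<And>s. s \<in> S \<Longrightarrow> norm (Z s) < 1"
  shows "(\<lambda>s. hyp_series (A s) (B s) (C s) (Z s)) holomorphic_on S"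
  unfolding hyp_series_def
proof (rule holomorphic_on_suminf_local[OF S])
  show "(\<lambda>s. gauss_2F1_term (A s) (B s) (C s) (Z s) n) holomorphic_on S" for n
    unfolding gauss_2F1_term_def
    by (intro holomorphic_intros hol) (use C pochhammer_neq_0_of_Re_pos in auto)
next
  fix s0 assume s0: "s0 \<in> S"
  define \<sigma> where "\<sigma> = max 1 (Re (A s0 + B s0 - C s0) + 1)"
  have "\<sigma> > 0" "\<sigma> > Re (A s0 + B s0 - C s0)" by (auto simp: \<sigma>_def)
  from gauss_2F1_term_majorant[OF C[OF s0] this] obtain K r where K0: "K > 0" and "r > 0" and
    K: "\<And>a b c z n. a \<in> cball (A s0) r \<Longrightarrow> b \<in> cball (B s0) r \<Longrightarrow> c \<in> cball (C s0) r \<Longrightarrow>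
       norm (gauss_2F1_term a b c z n) \<le> K * (pochhammer \<sigma> n / fact n * norm z ^ n)" by metis
  define q where "q = (1 + norm (Z s0)) / 2"
  have q: "norm (Z s0) < q" "0 \<le> q" "q < 1" using Z[OF s0] by (auto simp: q_def intro: add_nonneg_nonneg)
  have lim: "(f \<longlongrightarrow> f s0) (at s0)" if "f holomorphic_on S" for f
    using that S s0 by (meson continuous_on_eq_continuous_at continuous_within holomorphic_on_imp_continuous_on)
  have ev: "\<forall>\<^sub>F s in at s0. dist (A s) (A s0) < r \<and> dist (B s) (B s0) < r \<and> dist (C s) (C s0) < r \<and> norm (Z s) < q"
    using hol q \<open>r > 0\<close>
    by (intro eventually_conj tendstoD lim order_tendstoD(2)[OF tendsto_norm[OF lim]]) auto
  then obtain d where d: "d > 0" "\<And>s. s \<noteq> s0 \<Longrightarrow> dist s s0 < d \<Longrightarrow>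
      dist (A s) (A s0) < r \<and> dist (B s) (B s0) < r \<and> dist (C s) (C s0) < r \<and> norm (Z s) < q"
    unfolding eventually_at by blast
  have d': "A s \<in> cball (A s0) r" "B s \<in> cball (B s0) r" "C s \<in> cball (C s0) r" "norm (Z s) \<le> q"
    if "s \<in> ball s0 d" for s
    using d(2)[of s] that q \<open>r > 0\<close> by (cases "s = s0"; force simp: dist_commute less_imp_le)+
  have "norm (gauss_2F1_term (A s) (B s) (C s) (Z s) n) \<le> K * (pochhammer \<sigma> n / fact n * q ^ n)"
    if "s \<in> ball s0 d" for s n
  proof -
    have "pochhammer \<sigma> n \<ge> 0" using \<open>\<sigma> > 0\<close> by (intro pochhammer_nonneg)
    then have "K * (pochhammer \<sigma> n / fact n * norm (Z s) ^ n) \<le> K * (pochhammer \<sigma> n / fact n * q ^ n)"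
      using d'(4)[OF that] K0 by (intro mult_left_mono power_mono) auto
    then show ?thesis using K[OF d'(1-3)[OF that], of "Z s" n] by linarith
  qed
  moreover have "summable (\<lambda>n. K * (pochhammer \<sigma> n / fact n * q ^ n))"
    using binomial_series_pochhammer_real[of q \<sigma>] q
    by (intro summable_mult) (simp add: sums_iff)
  ultimately show "\<exists>d h. 0 < d \<and> summable h \<and>
      (\<forall>n. \<forall>w\<in>ball s0 d \<inter> S. norm (gauss_2F1_term (A w) (B w) (C w) (Z w) n) \<le> h n)"
    using d(1) by blast
qed

text \<open>Absolute convergence turns the double series into an unordered sum over pairs, which can
  be regrouped along \<open>k + m = n\<close>. Pfaff's transformation is such a regrouping.\<close>

lemma sums_triangle:
  fixes f :: "nat \<Rightarrow> nat \<Rightarrow> complex"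
  assumes f: "\<And>k. summable (\<lambda>m. norm (f k m))" "summable (\<lambda>k. \<Sum>m. norm (f k m))"
    and "\<And>k. f k sums g k" and "g sums s"
  shows "(\<lambda>n. \<Sum>k\<le>n. f k (n - k)) sums s"
proof -
  have row: "(f k has_sum g k) UNIV" for k
    by (rule norm_summable_imp_has_sum[OF f(1) assms(3)])
  have nrow: "((\<lambda>m. norm (f k m)) has_sum (\<Sum>m. norm (f k m))) UNIV" for k
    by (rule sums_nonneg_imp_has_sum) (use f(1) in \<open>auto simp: summable_sums\<close>)
  have "(\<lambda>k. norm (\<Sum>m. norm (f k m))) summable_on UNIV"
    using f(2) by (subst summable_on_UNIV_nonneg_real_iff) (auto simp: suminf_nonneg[OF f(1)])
  then have "(\<lambda>p. norm (f (fst p) (snd p))) summable_on UNIV \<times> UNIV"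
    using has_sum_imp_summable[OF nrow]
    by (subst Infinite_Sum.abs_summable_on_Sigma_iff) (simp add: infsumI[OF nrow])
  then have "(\<lambda>p. f (fst p) (snd p)) summable_on UNIV \<times> UNIV"
    by (rule Infinite_Sum.abs_summable_summable)
  then obtain t where t: "((\<lambda>(k, m). f k m) has_sum t) (UNIV \<times> UNIV)"
    unfolding summable_on_def case_prod_unfold by blast
  have gt: "(g has_sum t) UNIV"
    using has_sum_SigmaD[OF t, of g] row by simp
  have "t = s" by (rule sums_unique2[OF has_sum_imp_sums[OF gt] assms(4)])
  have "((\<lambda>(n, k). f k (n - k)) has_sum t) (SIGMA n:UNIV. {..n})
      \<longleftrightarrow> ((\<lambda>(k, m). f k m) has_sum t) (UNIV \<times> UNIV)"
    by (rule has_sum_reindex_bij_witness[where i = "\<lambda>(k, m). (k + m, k)" and j = "\<lambda>(n, k). (k, n - k)"]) auto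
  with t have "((\<lambda>(n, k). f k (n - k)) has_sum t) (SIGMA n:UNIV. {..n})" by blast
  then have "((\<lambda>n. \<Sum>k\<le>n. f k (n - k)) has_sum t) UNIV"
  proof (rule has_sum_SigmaD)
    fix n :: nat
    have "((\<lambda>k. f k (n - k)) has_sum (\<Sum>k\<le>n. f k (n - k))) {..n}"
      by (rule has_sum_finite) simp
    then show "((\<lambda>k. case (n, k) of (n, k) \<Rightarrow> f k (n - k)) has_sum (\<Sum>k\<le>n. f k (n - k))) {..n}"
      unfolding prod.case .
  qed
  from has_sum_imp_sums[OF this] show ?thesis unfolding \<open>t = s\<close> .
qed

subsection \<open>Continuation of the hypergeometric series by Pfaff's transformation\<close>

lemma continues_2F1_ball:
  assumes "Re c > 0"
  shows "continues_2F1 a b c (ball 0 1) (hyp_series a b c)"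
  unfolding continues_2F1_def
proof (intro conjI ballI)
  show "ball 0 1 \<inter> complex_of_real ` {1..} = {}" by auto
  show "hyp_series a b c holomorphic_on ball 0 1"
    using holomorphic_on_hyp_series[of "ball 0 1" "\<lambda>_. a" "\<lambda>_. b" "\<lambda>_. c" "\<lambda>z. z"] assms
    by (simp add: holomorphic_on_ident)
qed (use assms hyp_series_sums in auto)

lemma gauss_2F1_eq_hyp_series:
  assumes "Re c > 0" and "norm z < 1"
  shows "gauss_2F1 a b c z = hyp_series a b c z"
  using gauss_2F1_eqI[OF continues_2F1_ball[OF assms(1)]] assms(2) by simp

lemma gauss_2F1_at_0 [simp]: "Re c > 0 \<Longrightarrow> gauss_2F1 a b c 0 = 1"
  by (simp add: gauss_2F1_eq_hyp_series)

text \<open>Points of this half-plane are closer to 0 than to 1. It is the domain on which the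
  transformed series of Pfaff converges.\<close>

lemma norm_divide_minus_1_less_1_iff:
  fixes z :: complex
  assumes "Re z < 1 / 2"
  shows "norm (z / (z - 1)) < 1"
proof -
  have "z \<noteq> 1" using assms by auto
  have "(norm z)\<^sup>2 < (norm (z - 1))\<^sup>2"
    using assms unfolding cmod_power2 by (simp add: power2_eq_square algebra_simps)
  then have "norm z < norm (z - 1)" by (rule power2_less_imp_less) simp
  then show ?thesis using \<open>z \<noteq> 1\<close> by (simp add: norm_divide)
qed

lemma pochhammer_minus_of_nat:
  assumes "k \<le> n"
  shows "pochhammer (- of_nat n :: complex) k = (- 1) ^ k * fact n / fact (n - k)"
proof -
  have "of_nat (n choose k) = ((of_nat n :: complex) gchoose k)" by (simp add: binomial_gbinomial)
  also have "\<dots> = (- 1) ^ k * pochhammer (- of_nat n) k / fact k" by (rule gbinomial_pochhammer)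
  finally have "(fact n / (fact k * fact (n - k)) :: complex) = (- 1) ^ k * pochhammer (- of_nat n) k / fact k"
    using binomial_fact[OF assms, where 'a = complex] by simp
  then have "(- 1) ^ k * ((- 1) ^ k * pochhammer (- of_nat n :: complex) k) = (- 1) ^ k * fact n / fact (n - k)"
    by (simp add: field_simps)
  then show ?thesis by (simp flip: mult.assoc power_mult_distrib)
qed

text \<open>On the right, \<open>(1 - z) powr (- a) * (z / (z - 1)) ^ k\<close> equals
  \<open>(- z) ^ k * (1 - z) powr (- (a + k))\<close>. Expanding it by the binomial series gives a
  double series whose diagonals are Chu-Vandermonde sums with value
  \<open>pochhammer b n / pochhammer c n\<close>. Absolute convergence needs
  \<open>q / (1 - q) < 1\<close> for \<open>q = norm z\<close>, which the bound \<open>1 / 3\<close>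
  ensures.\<close>

lemma hyp_series_pfaff_small:
  assumes c: "Re c > 0" and z: "norm z < 1 / 3"
  shows "hyp_series a b c z = (1 - z) powr (- a) * hyp_series a (c - b) c (z / (z - 1))"
proof -
  define q where "q = norm z"
  have q: "0 \<le> q" "q < 1 / 3" using z by (auto simp: q_def)
  have z1: "1 - z \<noteq> 0" "z - 1 \<noteq> 0" using z by auto
  define w where "w = z / (z - 1)"
  have nz: "1 - q \<le> norm (z - 1)"
    using norm_triangle_ineq2[of 1 z] by (simp add: q_def norm_minus_commute)
  have q1: "q / (1 - q) < 1" "0 \<le> q / (1 - q)" using q by (auto simp: field_simps)
  have w: "norm w < 1"
  proof -
    have "norm w \<le> q / (1 - q)" unfolding w_def norm_divide using nz q by (intro frac_le) (auto simp: q_def)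
    then show ?thesis using q1 by linarith
  qed
  define A where "A k = pochhammer a k * pochhammer (c - b) k / pochhammer c k / fact k" for k
  define f where "f k m = A k * (- z) ^ k * (pochhammer (a + of_nat k) m / fact m * z ^ m)" for k m
  have row: "f k sums ((1 - z) powr (- a) * gauss_2F1_term a (c - b) c w k)" for k
  proof -
    have *: "(\<lambda>m. A k * (- z) ^ k * (pochhammer (a + of_nat k) m / fact m * z ^ m))
        sums (A k * (- z) ^ k * (1 - z) powr (- (a + of_nat k)))"
      by (intro sums_mult binomial_series_pochhammer) (use z in auto)
    have "(1 - z) powr (- (a + of_nat k)) = (1 - z) powr (- a) / (1 - z) ^ k"
      using z1 by (simp add: powr_diff powr_nat')
    moreover have "(- z) ^ k / (1 - z) ^ k = w ^ k"
      unfolding w_def power_divide[symmetric] using minus_divide_divide[of z "z - 1"] by simp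
    ultimately have "A k * (- z) ^ k * (1 - z) powr (- (a + of_nat k)) = A k * (1 - z) powr (- a) * w ^ k"
      by (metis (no_types, lifting) mult.assoc mult.commute times_divide_eq_right)
    note ** = *[unfolded this]
    have gt: "gauss_2F1_term a (c - b) c w k = A k * w ^ k"
      by (simp add: gauss_2F1_term_def A_def)
    have eq: "(1 - z) powr (- a) * (A k * w ^ k) = A k * (1 - z) powr (- a) * w ^ k" by simp
    show ?thesis unfolding f_def[abs_def] gt eq by (rule **)
  qed
  have tot: "(\<lambda>k. (1 - z) powr (- a) * gauss_2F1_term a (c - b) c w k)
      sums ((1 - z) powr (- a) * hyp_series a (c - b) c w)"
    by (intro sums_mult hyp_series_sums c w)
  have nf: "norm (f k m) \<le> norm (A k) * q ^ k * (pochhammer (norm a + real k) m / fact m * q ^ m)" for k m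
  proof -
    have "norm (pochhammer (a + of_nat k) m) \<le> pochhammer (norm a + real k) m"
      by (rule norm_pochhammer_le) (use norm_triangle_ineq[of a "of_nat k"] in simp)
    then have "norm (A k) * q ^ k * (norm (pochhammer (a + of_nat k) m) / fact m * q ^ m)
        \<le> norm (A k) * q ^ k * (pochhammer (norm a + real k) m / fact m * q ^ m)"
      using q by (intro mult_left_mono mult_right_mono divide_right_mono) auto
    then show ?thesis by (simp add: f_def norm_mult norm_power norm_divide q_def)
  qed
  have bs: "(\<lambda>m. norm (A k) * q ^ k * (pochhammer (norm a + real k) m / fact m * q ^ m))
      sums (norm (A k) * q ^ k * (1 - q) powr (- (norm a + real k)))" for k
    by (intro sums_mult binomial_series_pochhammer_real) (use q in auto)
  have sf: "summable (\<lambda>m. norm (f k m))" for k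
    by (rule summable_comparison_test'[OF sums_summable[OF bs[of k]]]) (use nf in auto)
  have "(\<lambda>n. \<Sum>k\<le>n. f k (n - k)) sums ((1 - z) powr (- a) * hyp_series a (c - b) c w)"
  proof (rule sums_triangle[OF sf _ row tot])
    \<comment> \<open>Up to a constant factor, the row sums of the norms are bounded by the terms of
      a hypergeometric series at the real point \<open>q / (1 - q)\<close>.\<close>
    have "summable (\<lambda>k. (1 - q) powr (- norm a) * norm (gauss_2F1_term a (c - b) c (of_real (q / (1 - q))) k))"
      by (intro summable_mult summable_norm_gauss_2F1_term c) (use q1 in \<open>simp only: norm_of_real abs_of_nonneg\<close>)
    moreover have "norm (\<Sum>m. norm (f k m)) \<le>
        (1 - q) powr (- norm a) * norm (gauss_2F1_term a (c - b) c (of_real (q / (1 - q))) k)" for k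
    proof -
      have "(\<Sum>m. norm (f k m)) \<le> norm (A k) * q ^ k * (1 - q) powr (- (norm a + real k))"
        using suminf_le[OF nf sf sums_summable[OF bs]] sums_unique[OF bs[of k]] by simp
      also have "(1 - q) powr (- (norm a + real k)) = (1 - q) powr (- norm a) / (1 - q) ^ k"
        using q by (simp add: powr_diff powr_realpow)
      also have "norm (A k) * q ^ k * ((1 - q) powr (- norm a) / (1 - q) ^ k)
          = (1 - q) powr (- norm a) * (norm (A k) * (q / (1 - q)) ^ k)"
        by (simp add: power_divide)
      also have "norm (A k) * (q / (1 - q)) ^ k = norm (gauss_2F1_term a (c - b) c (of_real (q / (1 - q))) k)"
        unfolding gauss_2F1_term_def A_def norm_mult norm_divide norm_power norm_of_real
          abs_of_nonneg[OF q1(2)] by simp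
      finally show ?thesis using suminf_nonneg[OF sf[of k]] by simp
    qed
    ultimately show "summable (\<lambda>k. \<Sum>m. norm (f k m))"
      by (rule summable_comparison_test')
  qed
  moreover have "(\<Sum>k\<le>n. f k (n - k)) = gauss_2F1_term a b c z n" for n
  proof -
    have "f k (n - k) = pochhammer a n / fact n * z ^ n *
        ((pochhammer (c - b) k * pochhammer (- of_nat n) k) / (of_nat (fact k) * pochhammer c k))"
      if "k \<le> n" for k
    proof -
      have "pochhammer a k * pochhammer (a + of_nat k) (n - k) = pochhammer a n"
        using pochhammer_product[OF that, of a] by simp
      moreover have "z ^ k * z ^ (n - k) = z ^ n" using that by (simp flip: power_add)
      moreover have "f k (n - k) = (pochhammer a k * pochhammer (a + of_nat k) (n - k)) * (z ^ k * z ^ (n - k))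
          * (pochhammer (c - b) k / pochhammer c k / fact k * ((- 1) ^ k / fact (n - k)))"
        by (simp add: f_def A_def power_minus[of z])
      ultimately show ?thesis
        by (simp add: pochhammer_minus_of_nat[OF that] mult_ac)
    qed
    then have "(\<Sum>k\<le>n. f k (n - k)) = pochhammer a n / fact n * z ^ n *
        (\<Sum>k=0..n. (pochhammer (c - b) k * pochhammer (- of_nat n) k) / (of_nat (fact k) * pochhammer c k))"
      by (simp add: sum_distrib_left atLeast0AtMost)
    also have "(\<Sum>k=0..n. (pochhammer (c - b) k * pochhammer (- of_nat n) k) / (of_nat (fact k) * pochhammer c k))
        = pochhammer (c - (c - b)) n / pochhammer c n"
      by (rule Vandermonde_pochhammer) (use c in auto)
    finally show ?thesis by (simp add: gauss_2F1_term_def mult_ac)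
  qed
  ultimately have "gauss_2F1_term a b c z sums ((1 - z) powr (- a) * hyp_series a (c - b) c w)" by simp
  moreover have "gauss_2F1_term a b c z sums hyp_series a b c z"
    by (rule hyp_series_sums[OF c]) (use z in simp)
  ultimately show ?thesis unfolding w_def by (metis sums_unique2)
qed

text \<open>Pfaff's right-hand side is holomorphic on the whole half-plane, and the identity theorem
  spreads its agreement with the series from the small disc to the intersection with the unit disc.
  The half-plane contains the negative axis, so together with the unit disc it reaches all real
  arguments below 1.\<close>

lemma continues_2F1_halfspace:
  assumes c: "Re c > 0"
  shows "continues_2F1 a b c {z. Re z < 1 / 2} (\<lambda>z. (1 - z) powr (- a) * hyp_series a (c - b) c (z / (z - 1)))"
    (is "continues_2F1 a b c ?S ?f")
proof -
  have S: "open ?S" "convex ?S" by (rule open_halfspace_Re_lt, rule convex_halfspace_Re_lt)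
  have hol: "?f holomorphic_on ?S"
  proof (intro holomorphic_on_mult)
    show "(\<lambda>z. (1 - z) powr (- a)) holomorphic_on ?S"
      by (intro holomorphic_intros) (auto simp: complex_nonpos_Reals_iff)
    show "(\<lambda>z. hyp_series a (c - b) c (z / (z - 1))) holomorphic_on ?S"
      by (rule holomorphic_on_hyp_series[OF S(1)])
        (use c norm_divide_minus_1_less_1_iff in \<open>auto intro!: holomorphic_intros\<close>)
  qed
  have sums: "gauss_2F1_term a b c u sums ?f u" if u: "u \<in> ?S \<inter> ball 0 1" for u
  proof -
    have "?f u = hyp_series a b c u"
    proof (rule analytic_continuation_open[of "ball 0 (1/3)" "?S \<inter> ball 0 1" ?f "hyp_series a b c"])
      show "connected (?S \<inter> ball 0 1)" using S by (intro convex_connected convex_Int) auto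
      show "ball 0 (1 / 3) \<subseteq> ?S \<inter> ball 0 1"
      proof
        fix z :: complex assume "z \<in> ball 0 (1 / 3)"
        then show "z \<in> ?S \<inter> ball 0 1" using complex_Re_le_cmod[of z] by simp
      qed
      show "?f holomorphic_on ?S \<inter> ball 0 1" by (rule holomorphic_on_subset[OF hol]) auto
      have "hyp_series a b c holomorphic_on ball 0 1"
        using continues_2F1_ball[OF c, of a b] by (simp add: continues_2F1_def)
      then show "hyp_series a b c holomorphic_on ?S \<inter> ball 0 1"
        by (rule holomorphic_on_subset) auto
      show "?f z = hyp_series a b c z" if "z \<in> ball 0 (1 / 3)" for z
        by (rule hyp_series_pfaff_small[OF c, symmetric]) (use that in simp)
      show "open (?S \<inter> ball 0 1)" using S(1) by (intro open_Int) auto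
    qed (use u in auto)
    moreover have "norm u < 1" using u by simp
    ultimately show ?thesis using hyp_series_sums[OF c, of u a b] by (simp only:)
  qed
  have "?S \<inter> complex_of_real ` {1..} = {}" by auto
  with S hol sums show ?thesis unfolding continues_2F1_def by (intro conjI ballI) auto
qed

lemma gauss_2F1_pfaff:
  assumes "Re c > 0" and "Re z < 1 / 2"
  shows "gauss_2F1 a b c z = (1 - z) powr (- a) * hyp_series a (c - b) c (z / (z - 1))"
  using gauss_2F1_eqI[OF continues_2F1_halfspace[OF assms(1)]] assms(2) by simp

lemma norm_of_real_powr:
  "0 \<le> s \<Longrightarrow> norm (complex_of_real s powr z) = s powr Re z"
  by (simp add: norm_powr_real_powr)

text \<open>The binomial series sums the majorant in closed form, which turns the coefficient
  estimate into a growth bound at the unit circle.\<close>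

lemma hyp_series_bound:
  fixes a0 b0 c0 :: complex
  assumes "Re c0 > 0" and "\<sigma> > 0" and "\<sigma> > Re (a0 + b0 - c0)"
  obtains K r where "K > 0" "r > 0" "r < Re c0"
    "\<And>a b c z. a \<in> cball a0 r \<Longrightarrow> b \<in> cball b0 r \<Longrightarrow> c \<in> cball c0 r \<Longrightarrow> norm z < 1 \<Longrightarrow>
       norm (hyp_series a b c z) \<le> K * (1 - norm z) powr (- \<sigma>)"
proof -
  obtain K r where K: "K > 0" "r > 0" "r < Re c0" and
    bnd: "\<And>a b c z n. a \<in> cball a0 r \<Longrightarrow> b \<in> cball b0 r \<Longrightarrow> c \<in> cball c0 r \<Longrightarrow>
       norm (gauss_2F1_term a b c z n) \<le> K * (pochhammer \<sigma> n / fact n * norm z ^ n)"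
    using gauss_2F1_term_majorant[OF assms] by metis
  show thesis
  proof (rule that[OF K])
    fix a b c z :: complex
    assume abc: "a \<in> cball a0 r" "b \<in> cball b0 r" "c \<in> cball c0 r" and z: "norm z < 1"
    have s: "(\<lambda>n. K * (pochhammer \<sigma> n / fact n * norm z ^ n)) sums (K * (1 - norm z) powr (- \<sigma>))"
      by (intro sums_mult binomial_series_pochhammer_real) (use z in auto)
    show "norm (hyp_series a b c z) \<le> K * (1 - norm z) powr (- \<sigma>)"
      unfolding hyp_series_def sums_unique[OF s]
      by (rule norm_suminf_le[OF bnd[OF abc] sums_summable[OF s]])
  qed
qed

lemma gauss_2F1_bound_near_1:
  fixes a0 b0 c0 :: complex
  assumes "Re c0 > 0" and "\<sigma> > 0" and "\<sigma> > Re (a0 + b0 - c0)"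
  obtains K r where "K > 0" "r > 0" "r < Re c0"
    "\<And>a b c x. a \<in> cball a0 r \<Longrightarrow> b \<in> cball b0 r \<Longrightarrow> c \<in> cball c0 r \<Longrightarrow> 0 \<le> x \<Longrightarrow> x < 1 \<Longrightarrow>
       norm (gauss_2F1 a b c (of_real x)) \<le> K * (1 - x) powr (- \<sigma>)"
proof -
  obtain K r where K: "K > 0" "r > 0" "r < Re c0" and
    bnd: "\<And>a b c z. a \<in> cball a0 r \<Longrightarrow> b \<in> cball b0 r \<Longrightarrow> c \<in> cball c0 r \<Longrightarrow> norm z < 1 \<Longrightarrow>
       norm (hyp_series a b c z) \<le> K * (1 - norm z) powr (- \<sigma>)"
    using hyp_series_bound[OF assms] by metis
  show thesis
  proof (rule that[OF K])
    fix a b c :: complex and x :: real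
    assume abc: "a \<in> cball a0 r" "b \<in> cball b0 r" "c \<in> cball c0 r" and x: "0 \<le> x" "x < 1"
    have "\<bar>Re (c - c0)\<bar> \<le> r" using abs_Re_le_cmod[of "c - c0"] abc by (simp add: dist_norm norm_minus_commute)
    then have "Re c > 0" using K by simp
    then show "norm (gauss_2F1 a b c (of_real x)) \<le> K * (1 - x) powr (- \<sigma>)"
      using bnd[OF abc, of "of_real x"] x by (simp add: gauss_2F1_eq_hyp_series)
  qed
qed

text \<open>At minus infinity the function grows like the larger of the powers with exponents
  \<open>- a\<close> and \<open>- b\<close>, up to a logarithm, and \<open>\<tau>\<close> lies
  strictly above both. After Pfaff's transformation the argument \<open>w\<close> satisfies
  \<open>1 - w = 1 / (1 - x)\<close>, so growth of order \<open>\<sigma>\<close> at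
  \<open>w = 1\<close> becomes \<open>(1 - x) powr \<sigma>\<close>, to be multiplied by
  \<open>(1 - x) powr (- Re a)\<close>.\<close>

lemma gauss_2F1_bound_at_minus_infinity:
  fixes a0 b0 c0 :: complex
  assumes c0: "Re c0 > 0" and \<tau>: "\<tau> > - Re a0" "\<tau> > - Re b0" and "x0 < 1"
  obtains K r where "K > 0" "r > 0" "r < Re c0"
    "\<And>a b c x. a \<in> cball a0 r \<Longrightarrow> b \<in> cball b0 r \<Longrightarrow> c \<in> cball c0 r \<Longrightarrow> x \<le> x0 \<Longrightarrow>
       norm (gauss_2F1 a b c (of_real x)) \<le> K * (1 - x) powr \<tau>"
proof -
  \<comment> \<open>The transformed series has the critical exponent
    \<open>Re (a0 + (c0 - b0) - c0) = Re (a0 - b0)\<close>. The midpoint \<open>\<sigma>\<close>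
    lies above it and still below \<open>\<tau> + Re a0\<close>, which leaves room for moving
    \<open>a\<close>.\<close>
  define m where "m = max 0 (Re (a0 - b0))"
  define \<sigma> where "\<sigma> = (\<tau> + Re a0 + m) / 2"
  have \<sigma>: "\<sigma> > m" "\<sigma> < \<tau> + Re a0" using \<tau> by (auto simp: \<sigma>_def m_def)
  then have "\<sigma> > 0" "\<sigma> > Re (a0 + (c0 - b0) - c0)" by (auto simp: m_def)
  from hyp_series_bound[OF c0 this] obtain K1 r1 where K1: "K1 > 0" "r1 > 0" "r1 < Re c0" and
    bnd1: "\<And>a b c z. a \<in> cball a0 r1 \<Longrightarrow> b \<in> cball (c0 - b0) r1 \<Longrightarrow> c \<in> cball c0 r1 \<Longrightarrow> norm z < 1 \<Longrightarrow>
       norm (hyp_series a b c z) \<le> K1 * (1 - norm z) powr (- \<sigma>)" by metis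
  define \<sigma>' where "\<sigma>' = max 1 (Re (a0 + b0 - c0) + 1)"
  have "\<sigma>' > 0" "\<sigma>' > Re (a0 + b0 - c0)" by (auto simp: \<sigma>'_def)
  from gauss_2F1_bound_near_1[OF c0 this] obtain K2 r2 where K2: "K2 > 0" "r2 > 0" "r2 < Re c0" and
    bnd2: "\<And>a b c x. a \<in> cball a0 r2 \<Longrightarrow> b \<in> cball b0 r2 \<Longrightarrow> c \<in> cball c0 r2 \<Longrightarrow> 0 \<le> x \<Longrightarrow> x < 1 \<Longrightarrow>
       norm (gauss_2F1 a b c (of_real x)) \<le> K2 * (1 - x) powr (- \<sigma>')" by metis
  \<comment> \<open>Half of \<open>r1\<close>, because \<open>c - b\<close> may move by twice the
    radius; the last entry keeps \<open>\<sigma> - Re a \<le> \<tau>\<close>.\<close>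
  define r where "r = min (min (r1 / 2) r2) (\<tau> + Re a0 - \<sigma>)"
  have r: "r > 0" "r \<le> r1 / 2" "r \<le> r2" "r \<le> \<tau> + Re a0 - \<sigma>" using K1(2) K2(2) \<sigma>(2) unfolding r_def by linarith+
  \<comment> \<open>A lower bound for \<open>(1 - x) powr \<tau>\<close> on
    \<open>0 \<le> x \<le> x0\<close>, whatever the sign of \<open>\<tau>\<close>.\<close>
  define d where "d = min 1 ((1 - x0) powr \<tau>)"
  have d: "d > 0" using assms by (simp add: d_def)
  define K where "K = K1 + K2 * (1 - x0) powr (- \<sigma>') / d"
  have KK: "K1 \<le> K" "K2 * (1 - x0) powr (- \<sigma>') / d \<le> K" "K > 0" using K1 K2 d by (auto simp: K_def add_pos_nonneg)
  show thesis
  proof (rule that[OF KK(3) r(1)])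
    show "r < Re c0" using r(3) K2 by simp
    fix a b c :: complex and x :: real
    assume abc: "a \<in> cball a0 r" "b \<in> cball b0 r" "c \<in> cball c0 r" and x: "x \<le> x0"
    have n: "norm (a - a0) \<le> r" "norm (b - b0) \<le> r" "norm (c - c0) \<le> r"
      using abc by (auto simp: dist_norm norm_minus_commute)
    have "\<bar>Re (c - c0)\<bar> \<le> r" using abs_Re_le_cmod[of "c - c0"] n by linarith
    then have c: "Re c > 0" using K2 r by simp
    have "\<bar>Re (a - a0)\<bar> \<le> r" using abs_Re_le_cmod[of "a - a0"] n by linarith
    then have a: "\<sigma> - Re a \<le> \<tau>" using r by simp
    show "norm (gauss_2F1 a b c (of_real x)) \<le> K * (1 - x) powr \<tau>"
    proof (cases "x \<le> 0")
      case True
      define w where "w = x / (x - 1)"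
      have w: "0 \<le> w" "w < 1" "1 - w = 1 / (1 - x)"
        using True by (auto simp: w_def field_simps divide_simps)
      have "norm ((c - b) - (c0 - b0)) \<le> norm (c - c0) + norm (b - b0)"
        using norm_triangle_ineq4[of "c - c0" "b - b0"] by (simp add: algebra_simps)
      then have "c - b \<in> cball (c0 - b0) r1" using n r by (simp add: dist_norm norm_minus_commute)
      moreover have "a \<in> cball a0 r1" "c \<in> cball c0 r1" using n r K1 by (auto simp: dist_norm norm_minus_commute)
      ultimately have "norm (hyp_series a (c - b) c (of_real w)) \<le> K1 * (1 - norm (of_real w :: complex)) powr (- \<sigma>)"
        using bnd1[of a "c - b" c "of_real w"] w by simp
      then have h: "norm (hyp_series a (c - b) c (of_real w)) \<le> K1 * (1 - x) powr \<sigma>"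
        using w True by (simp add: powr_minus_divide powr_divide)
      have "gauss_2F1 a b c (of_real x) = of_real (1 - x) powr (- a) * hyp_series a (c - b) c (of_real w)"
        using gauss_2F1_pfaff[OF c, of "of_real x" a b] True by (simp add: w_def)
      also have "norm \<dots> = (1 - x) powr (- Re a) * norm (hyp_series a (c - b) c (of_real w))"
        using norm_of_real_powr[of "1 - x" "- a"] True by (simp add: norm_mult)
      also have "\<dots> \<le> (1 - x) powr (- Re a) * (K1 * (1 - x) powr \<sigma>)"
        by (intro mult_left_mono h) simp
      also have "\<dots> = K1 * (1 - x) powr (\<sigma> - Re a)" by (simp add: powr_diff powr_minus_divide)
      also have "\<dots> \<le> K * (1 - x) powr \<tau>"
        using a True KK K1 by (intro mult_mono powr_mono) auto
      finally show ?thesis .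
    next
      case False
      then have x01: "0 \<le> x" "x < 1" using x assms by auto
      have "norm (gauss_2F1 a b c (of_real x)) \<le> K2 * (1 - x) powr (- \<sigma>')"
        using n r x01 by (intro bnd2) (auto simp: dist_norm norm_minus_commute)
      also have "\<dots> \<le> K2 * (1 - x0) powr (- \<sigma>')"
        using x assms K2 \<open>\<sigma>' > 0\<close> by (intro mult_left_mono powr_mono2') auto
      also have "\<dots> \<le> K * d" using KK(2) d by (simp add: field_simps)
      also have "\<dots> \<le> K * (1 - x) powr \<tau>"
      proof (rule mult_left_mono)
        show "d \<le> (1 - x) powr \<tau>"
        proof (cases "\<tau> \<ge> 0")
          case True
          then have "(1 - x0) powr \<tau> \<le> (1 - x) powr \<tau>" using x assms by (intro powr_mono2) auto
          then show ?thesis by (simp add: d_def)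
        next
          case False
          then have "1 \<le> (1 - x) powr \<tau>"
            using powr_mono2'[of "- \<tau>" "1 - x" 1] powr_mono2'[of "\<tau>" "1 - x" 1] x01 by simp
          then show ?thesis by (simp add: d_def)
        qed
      qed (use KK in simp)
      finally show ?thesis .
    qed
  qed
qed

lemma holomorphic_on_gauss_2F1_param:
  fixes x :: real
  assumes "open S" and "A holomorphic_on S" "B holomorphic_on S" "C holomorphic_on S"
    and C: "\<And>s. s \<in> S \<Longrightarrow> Re (C s) > 0" and x: "x < 1"
  shows "(\<lambda>s. gauss_2F1 (A s) (B s) (C s) (of_real x)) holomorphic_on S"
proof (cases "x \<ge> 0")
  case True
  have "(\<lambda>s. hyp_series (A s) (B s) (C s) (of_real x)) holomorphic_on S"
    by (rule holomorphic_on_hyp_series) (use assms True in auto)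
  then show ?thesis
    by (rule holomorphic_transform) (use C x True in \<open>simp add: gauss_2F1_eq_hyp_series\<close>)
next
  case False
  have "norm (of_real x / (of_real x - 1) :: complex) < 1"
    by (rule norm_divide_minus_1_less_1_iff) (use False in simp)
  then have "(\<lambda>s. (1 - of_real x) powr (- A s) * hyp_series (A s) (C s - B s) (C s) (of_real x / (of_real x - 1))) holomorphic_on S"
    using assms False by (intro holomorphic_intros holomorphic_on_hyp_series)
  then show ?thesis
    by (rule holomorphic_transform) (use C x False in \<open>simp add: gauss_2F1_pfaff\<close>)
qed

text \<open>The unit disc and the half-plane \<open>Re z < 1 / 2\<close> together cover the real ray
  below 1.\<close>

lemma continuous_on_gauss_2F1_real:
  assumes c: "Re c > 0"
  shows "continuous_on {..<1} (\<lambda>x. gauss_2F1 a b c (of_real x))"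
proof -
  have 1: "gauss_2F1 a b c holomorphic_on S" if "continues_2F1 a b c S f" for S f
    by (rule holomorphic_transform[of f])
      (use that gauss_2F1_eqI[OF that] in \<open>auto simp: continues_2F1_def\<close>)
  have "gauss_2F1 a b c holomorphic_on ball 0 1 \<union> {z. Re z < 1 / 2}"
    by (intro holomorphic_on_Un 1[OF continues_2F1_ball[OF c]] 1[OF continues_2F1_halfspace[OF c]]
        open_ball open_halfspace_Re_lt)
  then have "continuous_on (complex_of_real ` {..<1}) (gauss_2F1 a b c)"
    by (intro continuous_on_subset[OF holomorphic_on_imp_continuous_on]) auto
  then show ?thesis
    using continuous_on_compose[of "{..<1}" complex_of_real "gauss_2F1 a b c"]
    by (simp add: o_def continuous_intros)
qed

subsection \<open>Gamma and Beta integrals\<close>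

text \<open>Nonnegativity makes gauge integrability absolute, so the classical Beta and Gamma
  integrals carry over to \<open>lborel\<close>.\<close>

lemma has_integral_nonneg_imp_lborel:
  fixes f :: "real \<Rightarrow> real"
  assumes "(f has_integral I) A" and "\<And>x. x \<in> A \<Longrightarrow> 0 \<le> f x" and "set_borel_measurable lborel A f"
  shows "set_integrable lborel A f" and "(LBINT x:A. f x) = I"
proof -
  have "f absolutely_integrable_on A"
    by (rule nonnegative_absolutely_integrable_1) (use assms in auto)
  then show i: "set_integrable lborel A f"
    using set_integrable_lborel_iff_absolutely_integrable[OF assms(3)] by simp
  show "(LBINT x:A. f x) = I"
    using set_borel_integral_eq_integral(2)[OF i] assms(1) by (simp add: integral_unique)
qed

lemma Beta_lborel:
  fixes a b :: real
  assumes "a > 0" "b > 0"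
  shows "set_integrable lborel {0<..<1} (\<lambda>t. t powr (a - 1) * (1 - t) powr (b - 1))"
    and "(LBINT t:{0<..<1}. t powr (a - 1) * (1 - t) powr (b - 1)) = Beta a b"
proof -
  have "((\<lambda>t. t powr (a - 1) * (1 - t) powr (b - 1)) has_integral Beta a b) {0<..<1}"
    using has_integral_Beta_real[OF assms] by (simp add: has_integral_Icc_iff_Ioo)
  note * = has_integral_nonneg_imp_lborel[OF this]
  show "set_integrable lborel {0<..<1} (\<lambda>t. t powr (a - 1) * (1 - t) powr (b - 1))"
    by (rule *(1)) (auto simp: set_borel_measurable_def)
  show "(LBINT t:{0<..<1}. t powr (a - 1) * (1 - t) powr (b - 1)) = Beta a b"
    by (rule *(2)) (auto simp: set_borel_measurable_def)
qed

lemma Gamma_lborel: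
  fixes a :: real
  assumes "a > 0"
  shows "set_integrable lborel {0<..} (\<lambda>t. t powr (a - 1) * exp (- t))"
    and "(LBINT t:{0<..}. t powr (a - 1) * exp (- t)) = Gamma a"
proof -
  have "((\<lambda>t. t powr (a - 1) * exp (- t)) has_integral Gamma a) {0..}"
    using Gamma_integral_real[OF assms] by (simp add: exp_minus divide_inverse)
  then have "((\<lambda>t. if t \<in> {0<..} then t powr (a - 1) * exp (- t) else 0) has_integral Gamma a) {0..}"
    by (rule has_integral_spike [of "{0}", rotated 2]) auto
  then have "((\<lambda>t. t powr (a - 1) * exp (- t)) has_integral Gamma a) {0<..}"
    by (subst (asm) has_integral_restrict) auto
  note * = has_integral_nonneg_imp_lborel[OF this]
  show "set_integrable lborel {0<..} (\<lambda>t. t powr (a - 1) * exp (- t))"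
    by (rule *(1)) (auto simp: set_borel_measurable_def)
  show "(LBINT t:{0<..}. t powr (a - 1) * exp (- t)) = Gamma a"
    by (rule *(2)) (auto simp: set_borel_measurable_def)
qed

lemma image_real_Ioi_eqI:
  fixes g h :: "real \<Rightarrow> real"
  assumes "\<And>x. x > 0 \<Longrightarrow> g x > 0" and "\<And>y. y > 0 \<Longrightarrow> h y > 0 \<and> g (h y) = y"
  shows "g ` {0<..} = {0<..}"
  using assms by (force simp: image_iff)

lemma Gamma_scaled_lborel:
  fixes a k :: real
  assumes "a > 0" "k > 0"
  shows "set_integrable lborel {0<..} (\<lambda>t. t powr (a - 1) * exp (- (k * t)))"
    and "(LBINT t:{0<..}. t powr (a - 1) * exp (- (k * t))) = Gamma a / k powr a"
proof -
  have im: "(\<lambda>t. k * t) ` {0<..} = {0<..}"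
    by (rule image_real_Ioi_eqI[where h = "\<lambda>t. t / k"]) (use assms in auto)
  have eq: "\<bar>k\<bar> * ((k * t) powr (a - 1) * exp (- (k * t))) = k powr a * (t powr (a - 1) * exp (- (k * t)))"
    if "t \<in> {0<..}" for t
    using that assms by (simp add: powr_mult powr_diff)
  note cov = lborel_set_integral_change_of_variables[of "{0<..}" "\<lambda>t. k * t" "\<lambda>t. t powr (a - 1) * exp (- t)" "\<lambda>_. k",
    unfolded im]
  have m: "set_borel_measurable lborel {0<..} (\<lambda>t. t powr (a - 1) * exp (- t))"
    "set_borel_measurable lborel {0<..} (\<lambda>t. \<bar>k\<bar> * ((k * t) powr (a - 1) * exp (- (k * t))))"
    by (auto simp: set_borel_measurable_def)
  have d: "((*) k has_real_derivative k) (at t within {0<..})" for t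
    by (auto intro!: derivative_eq_intros)
  have inj: "inj_on ((*) k) {0<..}" using assms by (auto simp: inj_on_def)
  have "set_integrable lborel {0<..} (\<lambda>t. \<bar>k\<bar> * ((k * t) powr (a - 1) * exp (- (k * t))))"
    using cov(1)[OF _ m d inj] Gamma_lborel(1)[OF assms(1)] by simp
  also have "?this \<longleftrightarrow> set_integrable lborel {0<..} (\<lambda>t. k powr a * (t powr (a - 1) * exp (- (k * t))))"
    by (rule set_integrable_cong[OF refl refl eq])
  finally show "set_integrable lborel {0<..} (\<lambda>t. t powr (a - 1) * exp (- (k * t)))"
    using assms by simp
  have "Gamma a = (LBINT t:{0<..}. \<bar>k\<bar> * ((k * t) powr (a - 1) * exp (- (k * t))))"
    using cov(2)[OF _ m d inj] Gamma_lborel(2)[OF assms(1)] by simp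
  also have "\<dots> = (LBINT t:{0<..}. k powr a * (t powr (a - 1) * exp (- (k * t))))"
    by (rule set_lebesgue_integral_cong) (use eq in auto)
  finally show "(LBINT t:{0<..}. t powr (a - 1) * exp (- (k * t))) = Gamma a / k powr a"
    using assms by (simp add: field_simps)
qed

lemma Gamma_square_lborel:
  fixes a k :: real
  assumes "a > 0" "k > 0"
  shows "set_integrable lborel {0<..} (\<lambda>t. t powr (2 * a - 1) * exp (- (k * t\<^sup>2)))"
    and "(LBINT t:{0<..}. t powr (2 * a - 1) * exp (- (k * t\<^sup>2))) = Gamma a / (2 * k powr a)"
proof -
  have im: "(\<lambda>t::real. t\<^sup>2) ` {0<..} = {0<..}"
    by (rule image_real_Ioi_eqI[where h = sqrt]) auto
  have eq: "\<bar>2 * t\<bar> * ((t\<^sup>2) powr (a - 1) * exp (- (k * t\<^sup>2))) = 2 * (t powr (2 * a - 1) * exp (- (k * t\<^sup>2)))"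
    if "t \<in> {0<..}" for t :: real
  proof -
    have "t\<^sup>2 = t powr 2" using that by simp
    then have "(t\<^sup>2) powr (a - 1) = t powr (2 * (a - 1))" by (simp only: powr_powr)
    then have "t * (t\<^sup>2) powr (a - 1) = t powr (1 + 2 * (a - 1))"
      using that by (simp only: powr_add greaterThan_iff powr_one)
    then show ?thesis using that by (simp add: algebra_simps)
  qed
  note cov = lborel_set_integral_change_of_variables[of "{0<..}" "\<lambda>t. t\<^sup>2" "\<lambda>t. t powr (a - 1) * exp (- (k * t))" "\<lambda>t. 2 * t",
    unfolded im]
  have m: "set_borel_measurable lborel {0<..} (\<lambda>t. t powr (a - 1) * exp (- (k * t)))"
    "set_borel_measurable lborel {0<..} (\<lambda>t. \<bar>2 * t\<bar> * ((t\<^sup>2) powr (a - 1) * exp (- (k * t\<^sup>2))))"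
    by (auto simp: set_borel_measurable_def)
  have d: "((\<lambda>t. t\<^sup>2) has_real_derivative 2 * t) (at t within {0<..})" for t :: real
    by (auto intro!: derivative_eq_intros)
  have inj: "inj_on (\<lambda>t. t\<^sup>2) {0::real<..}" by (auto simp: inj_on_def)
  have "set_integrable lborel {0<..} (\<lambda>t. \<bar>2 * t\<bar> * ((t\<^sup>2) powr (a - 1) * exp (- (k * t\<^sup>2))))"
    using cov(1)[OF _ m d inj] Gamma_scaled_lborel(1)[OF assms] by simp
  also have "?this \<longleftrightarrow> set_integrable lborel {0<..} (\<lambda>t. 2 * (t powr (2 * a - 1) * exp (- (k * t\<^sup>2))))"
    by (rule set_integrable_cong[OF refl refl eq])
  finally show "set_integrable lborel {0<..} (\<lambda>t. t powr (2 * a - 1) * exp (- (k * t\<^sup>2)))"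
    by simp
  have "Gamma a / k powr a = (LBINT t:{0<..}. \<bar>2 * t\<bar> * ((t\<^sup>2) powr (a - 1) * exp (- (k * t\<^sup>2))))"
    using cov(2)[OF _ m d inj] Gamma_scaled_lborel(2)[OF assms] by simp
  also have "\<dots> = (LBINT t:{0<..}. 2 * (t powr (2 * a - 1) * exp (- (k * t\<^sup>2))))"
    by (rule set_lebesgue_integral_cong) (use eq in auto)
  finally show "(LBINT t:{0<..}. t powr (2 * a - 1) * exp (- (k * t\<^sup>2))) = Gamma a / (2 * k powr a)"
    by simp
qed

section \<open>Termwise integration and Kummer's series\<close>

lemma sums_set_integral_dominated:
  fixes f :: "nat \<Rightarrow> 'a \<Rightarrow> 'b :: {banach, second_countable_topology}"
  assumes meas: "\<And>n. set_borel_measurable M A (f n)"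
    and W: "set_integrable M A W"
    and sums: "\<And>t. t \<in> A \<Longrightarrow> (\<lambda>n. f n t) sums F t"
    and bound: "\<And>n t. t \<in> A \<Longrightarrow> (\<Sum>i<n. norm (f i t)) \<le> W t"
  shows "set_integrable M A F" and "(\<lambda>n. \<integral>t\<in>A. f n t \<partial>M) sums (\<integral>t\<in>A. F t \<partial>M)"
proof -
  have int: "set_integrable M A (f n)" for n
  proof (rule set_integrable_bound[OF W meas])
    have "norm (f n t) \<le> norm (W t)" if "t \<in> A" for t
    proof -
      have "norm (f n t) \<le> (\<Sum>i<Suc n. norm (f i t))" by (simp add: sum_nonneg)
      also have "\<dots> \<le> norm (W t)" using bound[OF that, of "Suc n"] by simp
      finally show ?thesis .
    qed
    then show "AE t in M. t \<in> A \<longrightarrow> norm (f n t) \<le> norm (W t)" by simp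
  qed
  define s where "s n t = (\<Sum>i<n. indicator A t *\<^sub>R f i t)" for n t
  have s: "s n \<in> borel_measurable M" for n
    unfolding s_def[abs_def] using meas by (intro borel_measurable_sum) (simp add: set_borel_measurable_def)
  have lim: "(\<lambda>n. s n t) \<longlonglongrightarrow> indicator A t *\<^sub>R F t" for t
    using sums[of t] unfolding s_def sums_def by (cases "t \<in> A") auto
  have F: "(\<lambda>t. indicator A t *\<^sub>R F t) \<in> borel_measurable M"
    by (rule borel_measurable_LIMSEQ_metric[where f = s]) (use s lim in auto)
  have W': "integrable M (\<lambda>t. indicator A t *\<^sub>R W t)" using W by (simp add: set_integrable_def)
  have bnd: "norm (s n t) \<le> indicator A t *\<^sub>R W t" for n t
    using bound[of t n] by (cases "t \<in> A") (auto simp: s_def intro: order_trans[OF norm_sum])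
  show "set_integrable M A F"
    unfolding set_integrable_def
    by (rule integrable_dominated_convergence[where s = s, OF F s W']) (use lim bnd in auto)
  have "(\<lambda>n. integral\<^sup>L M (s n)) \<longlonglongrightarrow> integral\<^sup>L M (\<lambda>t. indicator A t *\<^sub>R F t)"
    by (rule integral_dominated_convergence[where s = s, OF F s W']) (use lim bnd in auto)
  moreover have "integral\<^sup>L M (s n) = (\<Sum>i<n. \<integral>t\<in>A. f i t \<partial>M)" for n
    unfolding s_def set_lebesgue_integral_def
    by (rule Bochner_Integration.integral_sum) (use int in \<open>simp add: set_integrable_def\<close>)
  ultimately show "(\<lambda>n. \<integral>t\<in>A. f n t \<partial>M) sums (\<integral>t\<in>A. F t \<partial>M)"
    unfolding sums_def set_lebesgue_integral_def by simp
qed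

text \<open>Each quotient \<open>(R + j) / (\<delta> + j)\<close> is at most
  \<open>max 1 (R / \<delta>)\<close>, so an exponential series dominates, locally uniformly in
  \<open>a\<close>.\<close>

lemma norm_kummer_Phi_term_le:
  fixes a b z :: complex
  assumes "norm a \<le> R" "0 < \<delta>" "\<delta> \<le> Re b"
  shows "norm (pochhammer a n / pochhammer b n * z ^ n / fact n) \<le> (max 1 (R / \<delta>) * norm z) ^ n / fact n"
proof -
  have R: "0 \<le> R" using assms(1) norm_ge_zero order_trans by blast
  have "pochhammer R n \<le> max 1 (R / \<delta>) ^ n * pochhammer \<delta> n"
  proof (induction n)
    case (Suc n)
    have "R \<le> max 1 (R / \<delta>) * \<delta>" using assms by (simp add: max_def field_simps)
    moreover have "real n \<le> max 1 (R / \<delta>) * real n" using mult_right_mono[of 1 "max 1 (R / \<delta>)" "real n"] by simp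
    ultimately have "R + real n \<le> max 1 (R / \<delta>) * (\<delta> + real n)" by (simp add: distrib_left)
    with Suc have "pochhammer R n * (R + real n)
        \<le> (max 1 (R / \<delta>) ^ n * pochhammer \<delta> n) * (max 1 (R / \<delta>) * (\<delta> + real n))"
      using R assms by (intro mult_mono) (auto intro!: mult_nonneg_nonneg pochhammer_nonneg)
    then show ?case by (simp add: pochhammer_Suc mult_ac)
  qed simp
  then have "pochhammer R n / pochhammer \<delta> n \<le> max 1 (R / \<delta>) ^ n"
    using pochhammer_pos[OF assms(2), of n] by (simp add: pos_divide_le_eq)
  moreover have "norm (pochhammer a n) / norm (pochhammer b n) \<le> pochhammer R n / pochhammer \<delta> n"
    using norm_pochhammer_le[OF assms(1), of n] norm_pochhammer_ge[of \<delta> b n] assms pochhammer_pos[OF assms(2), of n]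
    by (intro frac_le) (auto intro: order_trans[OF norm_ge_zero])
  ultimately have "norm (pochhammer a n) / norm (pochhammer b n) \<le> max 1 (R / \<delta>) ^ n" by simp
  then have "norm (pochhammer a n) / norm (pochhammer b n) * (norm z ^ n / fact n) \<le> max 1 (R / \<delta>) ^ n * (norm z ^ n / fact n)"
    by (intro mult_right_mono) auto
  then show ?thesis by (simp add: norm_mult norm_divide norm_power power_mult_distrib)
qed

lemma summable_exp_terms: "summable (\<lambda>n. (x::real) ^ n / fact n)"
  using summable_exp[of x] by (simp add: divide_inverse mult.commute)

lemma kummer_Phi_sums:
  assumes "Re b > 0"
  shows "(\<lambda>n. pochhammer a n / pochhammer b n * z ^ n / fact n) sums kummer_Phi a b z"
  unfolding kummer_Phi_def
  by (rule summable_sums, rule summable_comparison_test'[OF summable_exp_terms],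
      rule norm_kummer_Phi_term_le[OF order_refl assms order_refl])

lemma holomorphic_on_kummer_Phi_param:
  assumes "open S" "A holomorphic_on S" "Re b > 0"
  shows "(\<lambda>s. kummer_Phi (A s) b z) holomorphic_on S"
  unfolding kummer_Phi_def
proof (rule holomorphic_on_suminf_local[OF assms(1)])
  have "b \<noteq> - of_nat k" for k using assms(3) by auto
  then show "(\<lambda>s. pochhammer (A s) n / pochhammer b n * z ^ n / fact n) holomorphic_on S" for n
    by (intro holomorphic_intros assms) (auto simp: pochhammer_eq_0_iff)
next
  fix s0 assume s0: "s0 \<in> S"
  have "isCont A s0"
    using assms s0 by (meson continuous_on_eq_continuous_at holomorphic_on_imp_continuous_on)
  then obtain d where d: "d > 0" "\<And>s. dist s s0 < d \<Longrightarrow> dist (A s) (A s0) < 1"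
    unfolding continuous_at_eps_delta by (meson zero_less_one)
  have "norm (A s) \<le> norm (A s0) + 1" if "s \<in> ball s0 d" for s
    using d(2)[of s] that norm_triangle_sub[of "A s" "A s0"] by (simp add: dist_norm norm_minus_commute)
  then have "norm (pochhammer (A s) n / pochhammer b n * z ^ n / fact n)
      \<le> (max 1 ((norm (A s0) + 1) / Re b) * norm z) ^ n / fact n" if "s \<in> ball s0 d" for s n
    by (intro norm_kummer_Phi_term_le) (use that assms(3) in auto)
  then show "\<exists>d h. 0 < d \<and> summable h \<and>
      (\<forall>n. \<forall>w\<in>ball s0 d \<inter> S. norm (pochhammer (A w) n / pochhammer b n * z ^ n / fact n) \<le> h n)"
    using d(1) summable_exp_terms by blast
qed

subsection \<open>Laplace transform of a parabolic cylinder function\<close>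

lemma sums_even_odd:
  fixes f :: "nat \<Rightarrow> 'a :: real_normed_vector"
  assumes "f sums s" and "(\<lambda>n. f (2 * n)) sums e" and "(\<lambda>n. f (2 * n + 1)) sums d"
  shows "s = e + d"
proof -
  have "(\<lambda>n. sum f {n * 2..<n * 2 + 2}) sums s"
    by (rule sums_group[OF assms(1)]) simp
  moreover have "sum f {n * 2..<n * 2 + 2} = f (2 * n) + f (2 * n + 1)" for n
    by (simp add: numeral_2_eq_2 mult.commute)
  ultimately have "(\<lambda>n. f (2 * n) + f (2 * n + 1)) sums s" by simp
  then show ?thesis using sums_add[OF assms(2,3)] sums_unique2 by blast
qed

text \<open>The odd companion of \<open>fact_double\<close>. It is the source of the lower parameter
  \<open>3 / 2\<close> in the odd part of the parabolic cylinder function.\<close>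

lemma fact_double_Suc:
  "fact (2 * n + 1) = (4 ^ n * pochhammer (3 / 2) n * fact n :: 'a :: field_char_0)"
proof -
  have "pochhammer (1 / 2) n * (1 / 2 + of_nat n) = (1 / 2 :: 'a) * pochhammer (3 / 2) n"
    using pochhammer_rec[of "1 / 2 :: 'a" n] by (simp add: pochhammer_Suc)
  then have "2 * (1 / 2 * pochhammer (3 / 2) n) = 2 * (pochhammer (1 / 2) n * (1 / 2 + of_nat n :: 'a))"
    by (simp only:)
  then have "pochhammer (3 / 2) n = pochhammer (1 / 2) n * (1 + 2 * of_nat n :: 'a)"
    by (simp add: algebra_simps)
  moreover have "fact (2 * n + 1) = (1 + 2 * of_nat n :: 'a) * fact (2 * n)" by simp
  moreover have "(2 :: 'a) ^ (2 * n) = 4 ^ n" by (simp add: power_mult)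
  ultimately show ?thesis unfolding fact_double by (simp only: mult_ac)
qed

text \<open>Expand \<open>exp (- z * s)\<close> and integrate termwise against the Gaussian weight:
  the even powers assemble to the first Kummer function in the definition of
  \<open>parabolic_cylinder_D\<close>, the odd powers to the second.\<close>

lemma parabolic_integral_expansion:
  fixes a :: real and z :: complex
  assumes a: "a > 0"
  shows "set_integrable lborel {0<..} (\<lambda>s. exp (- z * of_real s) * of_real (s powr (2 * a - 1) * exp (- (s\<^sup>2 / 2))))"
    and "(LBINT s:{0<..}. exp (- z * of_real s) * of_real (s powr (2 * a - 1) * exp (- (s\<^sup>2 / 2))))
      = of_real (2 powr (a - 1) * Gamma a) * kummer_Phi (of_real a) (1 / 2) (z\<^sup>2 / 2)
        - z * of_real (2 powr (a - 1 / 2) * Gamma (a + 1 / 2)) * kummer_Phi (of_real a + 1 / 2) (3 / 2) (z\<^sup>2 / 2)"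
proof -
  define g where "g s = s powr (2 * a - 1) * exp (- (s\<^sup>2 / 2))" for s :: real
  define f where "f n s = (- z * of_real s) ^ n / fact n * complex_of_real (g s)" for n :: nat and s :: real
  \<comment> \<open>From \<open>norm z * s \<le> (norm z)^2 + s^2 / 4\<close>, which costs half of
    the Gaussian exponent.\<close>
  define W where "W s = exp ((norm z)\<^sup>2) * (s powr (2 * a - 1) * exp (- (1 / 4 * s\<^sup>2)))" for s :: real
  have meas: "set_borel_measurable lborel {0<..} (f n)" for n
    unfolding set_borel_measurable_def f_def g_def by measurable
  have W: "set_integrable lborel {0<..} W"
    unfolding W_def[abs_def] using Gamma_square_lborel(1)[OF a, of "1/4"] by simp
  have sums: "(\<lambda>n. f n s) sums (exp (- z * of_real s) * of_real (g s))" for s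
    unfolding f_def using exp_converges[of "- z * of_real s"]
    by (intro sums_mult2) (simp add: scaleR_conv_of_real divide_inverse mult.commute)
  have bound: "(\<Sum>i<n. norm (f i s)) \<le> W s" if "s \<in> {0<..}" for n s
  proof -
    have s: "s > 0" using that by simp
    have g: "g s \<ge> 0" by (simp add: g_def)
    have "(\<Sum>i<n. norm (f i s)) = (\<Sum>i<n. (norm z * s) ^ i / fact i) * g s"
      unfolding sum_distrib_right f_def norm_mult norm_divide norm_power norm_minus_cancel norm_of_real
        norm_fact abs_of_nonneg[OF g] abs_of_pos[OF s] by (rule refl)
    also have "\<dots> \<le> exp (norm z * s) * g s"
    proof (rule mult_right_mono[OF _ g])
      have sm: "(\<lambda>i. (norm z * s) ^ i / fact i) sums exp (norm z * s)"
        using exp_converges[of "norm z * s"] by (simp add: divide_inverse mult.commute)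
      show "(\<Sum>i<n. (norm z * s) ^ i / fact i) \<le> exp (norm z * s)"
        unfolding sums_unique[OF sm]
        by (rule sum_le_suminf[OF sums_summable[OF sm]]) (use s in auto)
    qed
    also have "\<dots> = s powr (2 * a - 1) * exp (norm z * s - s\<^sup>2 / 2)"
      unfolding g_def diff_conv_add_uminus exp_add by simp
    also have "\<dots> \<le> s powr (2 * a - 1) * exp ((norm z)\<^sup>2 - 1 / 4 * s\<^sup>2)"
    proof (intro mult_left_mono)
      have "0 \<le> (norm z - s / 2)\<^sup>2" by simp
      then have "norm z * s - s\<^sup>2 / 2 \<le> (norm z)\<^sup>2 - 1 / 4 * s\<^sup>2"
        by (simp add: power2_eq_square algebra_simps)
      then show "exp (norm z * s - s\<^sup>2 / 2) \<le> exp ((norm z)\<^sup>2 - 1 / 4 * s\<^sup>2)" by simp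
    qed simp
    also have "\<dots> = W s" unfolding W_def diff_conv_add_uminus exp_add by simp
    finally show ?thesis .
  qed
  note S = sums_set_integral_dominated[OF meas W sums bound]
  show "set_integrable lborel {0<..} (\<lambda>s. exp (- z * of_real s) * of_real (s powr (2 * a - 1) * exp (- (s\<^sup>2 / 2))))"
    using S(1) by (simp add: g_def)
  define c where "c n = (- z) ^ n / fact n * of_real (2 powr (real n / 2 + a - 1) * Gamma (real n / 2 + a))" for n
  have trm: "(LBINT s:{0<..}. f n s) = c n" for n
  proof -
    have "(LBINT s:{0<..}. f n s)
        = (LBINT s:{0<..}. (- z) ^ n / fact n * complex_of_real (s powr (2 * (real n / 2 + a) - 1) * exp (- (1 / 2 * s\<^sup>2))))"
    proof (rule set_lebesgue_integral_cong, simp, intro allI impI)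
      fix s :: real assume "s \<in> {0<..}"
      then have "s ^ n * s powr (2 * a - 1) = s powr (2 * (real n / 2 + a) - 1)"
        by (simp add: powr_add powr_realpow[symmetric] flip: powr_add) (simp add: algebra_simps)
      then have "complex_of_real s ^ n * of_real (s powr (2 * a - 1)) = of_real (s powr (2 * (real n / 2 + a) - 1))"
        by (metis of_real_mult of_real_power)
      then show "f n s = (- z) ^ n / fact n * complex_of_real (s powr (2 * (real n / 2 + a) - 1) * exp (- (1 / 2 * s\<^sup>2)))"
        unfolding f_def g_def power_mult_distrib of_real_mult by (simp add: mult_ac)
    qed
    also have "\<dots> = (- z) ^ n / fact n * of_real (LBINT s:{0<..}. s powr (2 * (real n / 2 + a) - 1) * exp (- (1 / 2 * s\<^sup>2)))"
      by (simp only: set_integral_mult_right set_integral_complex_of_real)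
    also have "(LBINT s:{0<..}. s powr (2 * (real n / 2 + a) - 1) * exp (- (1 / 2 * s\<^sup>2)))
        = Gamma (real n / 2 + a) / (2 * (1 / 2) powr (real n / 2 + a))"
      by (rule Gamma_square_lborel(2)) (use a in \<open>auto intro: add_nonneg_pos\<close>)
    also have "\<dots> = 2 powr (real n / 2 + a - 1) * Gamma (real n / 2 + a)"
      by (simp add: powr_divide powr_diff)
    finally show ?thesis by (simp add: c_def)
  qed
  have csums: "c sums (LBINT s:{0<..}. exp (- z * of_real s) * of_real (g s))"
    using S(2) by (simp add: trm)
  have na: "complex_of_real a \<notin> \<int>\<^sub>\<le>\<^sub>0" "complex_of_real a + 1 / 2 \<notin> \<int>\<^sub>\<le>\<^sub>0"
    using a by (auto elim!: nonpos_Ints_cases simp: complex_eq_iff)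
  have E: "c (2 * m) = of_real (2 powr (a - 1) * Gamma a) * (pochhammer (of_real a) m / pochhammer (1 / 2) m * (z\<^sup>2 / 2) ^ m / fact m)" for m
  proof -
    have "pochhammer a m = Gamma (a + real m) / Gamma a" using a by (intro pochhammer_Gamma) (auto elim!: nonpos_Ints_cases)
    then have G: "Gamma (a + real m) = pochhammer a m * Gamma a" using Gamma_real_pos[OF a] by (simp add: field_simps)
    have "2 powr (real m + a - 1) = 2 ^ m * 2 powr (a - 1)" by (simp add: powr_add powr_diff powr_realpow)
    then have "c (2 * m) = (z\<^sup>2) ^ m / (4 ^ m * pochhammer (1 / 2) m * fact m) * of_real (2 ^ m * 2 powr (a - 1) * (pochhammer a m * Gamma a))"
      by (simp add: c_def power_mult fact_double G[symmetric] add.commute)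
    also have "\<dots> = of_real (2 powr (a - 1) * Gamma a) * (pochhammer (of_real a) m / pochhammer (1 / 2) m * (z\<^sup>2 / 2) ^ m / fact m)"
    proof -
      have "(4 :: complex) ^ m = 2 ^ m * 2 ^ m" by (simp flip: power_mult_distrib)
      then show ?thesis by (simp add: pochhammer_of_real power_divide mult_ac)
    qed
    finally show ?thesis .
  qed
  have even: "(\<lambda>m. c (2 * m)) sums (of_real (2 powr (a - 1) * Gamma a) * kummer_Phi (of_real a) (1 / 2) (z\<^sup>2 / 2))"
    unfolding E by (intro sums_mult kummer_Phi_sums) simp
  have O: "c (2 * m + 1) = - z * of_real (2 powr (a - 1 / 2) * Gamma (a + 1 / 2))
      * (pochhammer (of_real a + 1 / 2) m / pochhammer (3 / 2) m * (z\<^sup>2 / 2) ^ m / fact m)" for m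
  proof -
    have "pochhammer (a + 1 / 2) m = Gamma (a + 1 / 2 + real m) / Gamma (a + 1 / 2)"
      using a by (intro pochhammer_Gamma) (auto elim!: nonpos_Ints_cases)
    moreover have "Gamma (a + 1 / 2) > 0" by (rule Gamma_real_pos) (use a in simp)
    then have "Gamma (a + 1 / 2) \<noteq> 0" by simp
    moreover have "real (2 * m + 1) / 2 + a = a + 1 / 2 + real m" by simp
    ultimately have G: "Gamma (real (2 * m + 1) / 2 + a) = pochhammer (a + 1 / 2) m * Gamma (a + 1 / 2)"
      by (simp only: eq_divide_eq if_True not_False_eq_True)
    have P: "2 powr (real (2 * m + 1) / 2 + a - 1) = 2 ^ m * 2 powr (a - 1 / 2)"
      by (simp add: powr_realpow[symmetric] flip: powr_add) (simp add: field_simps)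
    have "(- z) ^ (2 * m + 1) = - z * (z\<^sup>2) ^ m" by (simp add: power_mult)
    then have "c (2 * m + 1) = - z * (z\<^sup>2) ^ m / (4 ^ m * pochhammer (3 / 2) m * fact m)
        * of_real (2 ^ m * 2 powr (a - 1 / 2) * (pochhammer (a + 1 / 2) m * Gamma (a + 1 / 2)))"
      unfolding c_def G P fact_double_Suc by simp
    also have "\<dots> = - z * of_real (2 powr (a - 1 / 2) * Gamma (a + 1 / 2))
      * (pochhammer (of_real a + 1 / 2) m / pochhammer (3 / 2) m * (z\<^sup>2 / 2) ^ m / fact m)"
    proof -
      have "(4 :: complex) ^ m = 2 ^ m * 2 ^ m" by (simp flip: power_mult_distrib)
      moreover have "pochhammer (complex_of_real a + 1 / 2) m = of_real (pochhammer (a + 1 / 2) m)"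
        by (simp flip: pochhammer_of_real)
      ultimately show ?thesis by (simp add: power_divide mult_ac)
    qed
    finally show ?thesis .
  qed
  have odd: "(\<lambda>m. c (2 * m + 1)) sums (- z * of_real (2 powr (a - 1 / 2) * Gamma (a + 1 / 2)) * kummer_Phi (of_real a + 1 / 2) (3 / 2) (z\<^sup>2 / 2))"
    unfolding O by (intro sums_mult kummer_Phi_sums) simp
  from sums_even_odd[OF csums even odd]
  show "(LBINT s:{0<..}. exp (- z * of_real s) * of_real (s powr (2 * a - 1) * exp (- (s\<^sup>2 / 2))))
      = of_real (2 powr (a - 1) * Gamma a) * kummer_Phi (of_real a) (1 / 2) (z\<^sup>2 / 2)
        - z * of_real (2 powr (a - 1 / 2) * Gamma (a + 1 / 2)) * kummer_Phi (of_real a + 1 / 2) (3 / 2) (z\<^sup>2 / 2)"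
    by (simp add: g_def)
qed

section \<open>The function whose Laplace transform contains the exponential of
  \<open>sqrt p\<close>\<close>

lemma gauss_integral_real: "(LBINT v. exp (- (v\<^sup>2))) = sqrt pi" "integrable lborel (\<lambda>v::real. exp (- (v\<^sup>2)))"
proof -
  have "has_bochner_integral lborel (\<lambda>x::real. exp (- x\<^sup>2)) (2 *\<^sub>R (sqrt pi / 2))"
    by (rule has_bochner_integral_even_function[OF gaussian_moment_0]) simp
  then show "(LBINT v. exp (- (v\<^sup>2))) = sqrt pi" "integrable lborel (\<lambda>v::real. exp (- (v\<^sup>2)))"
    by (auto simp: has_bochner_integral_iff)
qed

text \<open>The substitution \<open>v = q u - k / (2 u)\<close> turns \<open>dv\<close> into \<open>(q + k / (2 u\<^sup>2)) du\<close>, and by the inversion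
  \<open>u \<mapsto> k / (2 q u)\<close> the two summands contribute equally to the Gaussian integral.\<close>

lemma cauchy_schloemilch_integral:
  fixes q k :: real
  assumes q: "q > 0" and k: "k > 0"
  shows "set_integrable lborel {0<..} (\<lambda>u. exp (- (q * u - k / (2 * u))\<^sup>2))"
    and "(LBINT u:{0<..}. exp (- (q * u - k / (2 * u))\<^sup>2)) = sqrt pi / (2 * q)"
proof -
  define G where "G u = exp (- (q * u - k / (2 * u))\<^sup>2)" for u :: real
  define H where "H u = k / (2 * q * u\<^sup>2) * G u" for u
  have Gm: "set_borel_measurable lborel {0<..} G" "set_borel_measurable lborel {0<..} H"
    unfolding set_borel_measurable_def G_def H_def by measurable
  have G0: "G u \<ge> 0" "H u \<ge> 0" for u using q k by (auto simp: G_def H_def)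

  define g where "g u = q * u - k / (2 * u)" for u
  have g_image: "g ` {0<..} = UNIV"
  proof (intro equalityI subsetI)
    fix v :: real
    \<comment> \<open>The preimage \<open>u\<close> is the positive root of
      \<open>2 * q * u^2 - 2 * v * u - k = 0\<close>, an equation equivalent to
      \<open>g u = v\<close>.\<close>
    define s where "s = sqrt (v\<^sup>2 + 2 * q * k)"
    define u where "u = (v + s) / (2 * q)"
    have s2: "s\<^sup>2 = v\<^sup>2 + 2 * q * k" unfolding s_def using q k by simp
    have "\<bar>v\<bar> < s" unfolding s_def
      by (metis add_less_cancel_left add.right_neutral mult_pos_pos q k real_sqrt_abs real_sqrt_less_iff zero_less_numeral)
    then have u: "u > 0" using q by (simp add: u_def)
    have "2 * q * u = v + s" using q by (simp add: u_def)
    then have "(2 * q * u - v)\<^sup>2 = v\<^sup>2 + 2 * q * k" using s2 by simp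
    then have "4 * q * (q * u\<^sup>2 - v * u - k / 2) = 0" by (simp add: power2_eq_square algebra_simps)
    then have "q * u\<^sup>2 - k / 2 = v * u" using q by simp
    then have "g u = v" using u by (simp add: g_def field_simps power2_eq_square)
    then show "v \<in> g ` {0<..}" using u by auto
  qed auto
  have g_inj: "inj_on g {0<..}"
  proof (rule strict_mono_on_imp_inj_on, rule strict_mono_onI)
    fix r s :: real assume "r \<in> {0<..}" "s \<in> {0<..}" "r < s"
    then have "q * r < q * s" "k / (2 * s) < k / (2 * r)" using q k by (auto intro!: divide_strict_left_mono)
    then show "g r < g s" by (simp add: g_def)
  qed
  have g_der: "(g has_real_derivative (q + k / (2 * u\<^sup>2))) (at u within {0<..})" if "u \<in> {0<..}" for u
    unfolding g_def using that
    by (auto intro!: derivative_eq_intros simp: power2_eq_square)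
  have g': "\<bar>q + k / (2 * u\<^sup>2)\<bar> * exp (- (g u)\<^sup>2) = q * (G u + H u)" for u
  proof -
    have "\<bar>q + k / (2 * u\<^sup>2)\<bar> = q + k / (2 * u\<^sup>2)" using q k by (intro abs_of_nonneg) simp
    also have "\<dots> = q * (1 + k / (2 * q * u\<^sup>2))" using q by (simp add: field_simps)
    finally show ?thesis by (simp add: G_def g_def H_def algebra_simps)
  qed
  have g_meas: "set_borel_measurable lborel (g ` {0<..}) (\<lambda>v. exp (- v\<^sup>2))"
    unfolding g_image set_borel_measurable_def by simp
  have g_meas': "set_borel_measurable lborel {0<..} (\<lambda>u. \<bar>q + k / (2 * u\<^sup>2)\<bar> * exp (- (g u)\<^sup>2))"
    unfolding set_borel_measurable_def g_def by measurable
  note cov = lborel_set_integral_change_of_variables[OF _ g_meas g_meas' g_der g_inj, unfolded g_image g']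
  have GH: "set_integrable lborel {0<..} (\<lambda>u. q * (G u + H u))"
    using cov(1) gauss_integral_real(2) by (simp add: set_integrable_def)
  have GHv: "(LBINT u:{0<..}. q * (G u + H u)) = sqrt pi"
    using cov(2) gauss_integral_real(1) by (simp add: set_lebesgue_integral_def)
  have GH': "set_integrable lborel {0<..} (\<lambda>u. G u + H u)" using GH q by simp
  have Gi: "set_integrable lborel {0<..} G"
    by (rule set_integrable_bound[OF GH' Gm(1)]) (use G0 in auto)
  have Hi: "set_integrable lborel {0<..} H"
    by (rule set_integrable_bound[OF GH' Gm(2)]) (use G0 in auto)

  define h where "h u = k / (2 * q * u)" for u
  have h_image: "h ` {0<..} = {0<..}"
    by (rule image_real_Ioi_eqI[where h = h]) (use q k in \<open>auto simp: h_def\<close>)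
  have h_inj: "inj_on h {0<..}" using q k by (auto simp: inj_on_def h_def)
  have h_der: "(h has_real_derivative (- k / (2 * q * u\<^sup>2))) (at u within {0<..})" if "u \<in> {0<..}" for u
    unfolding h_def using that q
    by (auto intro!: derivative_eq_intros simp: power2_eq_square)
  have h': "\<bar>- k / (2 * q * u\<^sup>2)\<bar> * G (h u) = H u" if "u \<in> {0<..}" for u
  proof -
    have "q * h u = k / (2 * u)" "k / (2 * h u) = q * u" using that q k by (auto simp: h_def)
    then have "G (h u) = G u" unfolding G_def by (simp add: power2_commute)
    moreover have "\<bar>- k / (2 * q * u\<^sup>2)\<bar> = k / (2 * q * u\<^sup>2)" using q k by (simp add: abs_divide abs_mult)
    ultimately show ?thesis by (simp add: H_def)
  qed
  have h_meas: "set_borel_measurable lborel {0<..} (\<lambda>u. \<bar>- k / (2 * q * u\<^sup>2)\<bar> * G (h u))"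
    unfolding set_borel_measurable_def h_def G_def by measurable
  have "(LBINT u:{0<..}. G u) = (LBINT u:{0<..}. \<bar>- k / (2 * q * u\<^sup>2)\<bar> * G (h u))"
    using lborel_set_integral_change_of_variables(2)[OF _ _ h_meas h_der h_inj] Gm h_image by simp
  also have "\<dots> = (LBINT u:{0<..}. H u)"
    by (rule set_lebesgue_integral_cong) (use h' in auto)
  finally have eq: "(LBINT u:{0<..}. G u) = (LBINT u:{0<..}. H u)" .
  have "q * ((LBINT u:{0<..}. G u) + (LBINT u:{0<..}. H u)) = sqrt pi"
    using GHv set_integral_add(2)[OF Gi Hi] by simp
  then have "(LBINT u:{0<..}. G u) = sqrt pi / (2 * q)" using eq q by (simp add: field_simps)
  then show "set_integrable lborel {0<..} (\<lambda>u. exp (- (q * u - k / (2 * u))\<^sup>2))"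
    "(LBINT u:{0<..}. exp (- (q * u - k / (2 * u))\<^sup>2)) = sqrt pi / (2 * q)"
    using Gi unfolding G_def by simp_all
qed

text \<open>With \<open>t = u^2\<close> the Jacobian cancels \<open>t powr (- 1 / 2)\<close> up to
  the factor 2. Completing the square with \<open>q = sqrt p\<close> splits off
  \<open>exp (- q * k)\<close> and leaves the Cauchy-Schloemilch integrand.\<close>

lemma laplace_exp_sqrt_real:
  fixes p k :: real
  assumes p: "p > 0" and k: "k > 0"
  shows "(LBINT t:{0<..}. exp (- p * t) * (t powr (- 1 / 2) * exp (- k\<^sup>2 / (4 * t)))) = sqrt pi / sqrt p * exp (- k * sqrt p)"
proof -
  define q where "q = sqrt p"
  have q: "q > 0" "p = q\<^sup>2" using p by (auto simp: q_def)
  define f where "f t = exp (- p * t) * (t powr (- 1 / 2) * exp (- k\<^sup>2 / (4 * t)))" for t :: real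
  have im: "(\<lambda>t::real. t\<^sup>2) ` {0<..} = {0<..}"
    by (rule image_real_Ioi_eqI[where h = sqrt]) auto
  have inj: "inj_on (\<lambda>t. t\<^sup>2) {0::real<..}" by (auto simp: inj_on_def)
  have d: "((\<lambda>t. t\<^sup>2) has_real_derivative 2 * t) (at t within {0<..})" for t :: real
    by (auto intro!: derivative_eq_intros)
  have m: "set_borel_measurable lborel {0<..} f" "set_borel_measurable lborel {0<..} (\<lambda>u. \<bar>2 * u\<bar> * f (u\<^sup>2))"
    unfolding set_borel_measurable_def f_def by measurable
  have "(LBINT t:{0<..}. f t) = (LBINT u:{0<..}. \<bar>2 * u\<bar> * f (u\<^sup>2))"
    using lborel_set_integral_change_of_variables(2)[OF _ _ m(2) d inj] m(1) im by simp
  also have "\<dots> = (LBINT u:{0<..}. 2 * exp (- (q * k)) * exp (- (q * u - k / (2 * u))\<^sup>2))"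
  proof (rule set_lebesgue_integral_cong, simp, intro allI impI)
    fix u :: real assume "u \<in> {0<..}"
    then have u: "u > 0" by simp
    have "u\<^sup>2 = u powr 2" using u by simp
    then have "(u\<^sup>2) powr (- 1 / 2) = u powr (2 * (- 1 / 2))" by (simp only: powr_powr)
    then have a: "\<bar>2 * u\<bar> * (u\<^sup>2) powr (- 1 / 2) = 2" using u by (simp add: powr_minus_divide)
    have "- p * u\<^sup>2 + - k\<^sup>2 / (4 * u\<^sup>2) = - (q * k) + - (q * u - k / (2 * u))\<^sup>2"
      using u unfolding q(2) by (simp add: power2_eq_square field_simps)
    then have "exp (- p * u\<^sup>2) * exp (- k\<^sup>2 / (4 * u\<^sup>2)) = exp (- (q * k)) * exp (- (q * u - k / (2 * u))\<^sup>2)"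
      by (simp only: exp_add[symmetric])
    then have "(\<bar>2 * u\<bar> * (u\<^sup>2) powr (- 1 / 2)) * (exp (- p * u\<^sup>2) * exp (- k\<^sup>2 / (4 * u\<^sup>2)))
        = 2 * (exp (- (q * k)) * exp (- (q * u - k / (2 * u))\<^sup>2))" by (simp only: a)
    then show "\<bar>2 * u\<bar> * f (u\<^sup>2) = 2 * exp (- (q * k)) * exp (- (q * u - k / (2 * u))\<^sup>2)"
      unfolding f_def by (simp only: mult_ac)
  qed
  also have "\<dots> = 2 * exp (- (q * k)) * (sqrt pi / (2 * q))"
    using cauchy_schloemilch_integral(2)[OF q(1) k] by simp
  finally show ?thesis using q(1) by (simp add: f_def q_def mult.commute)
qed

lemma norm_exp_times_of_real: "norm (exp (- p * complex_of_real t)) = exp (- Re p * t)"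
  by (simp add: norm_exp)

lemma holomorphic_on_laplace:
  fixes f :: "real \<Rightarrow> complex"
  assumes m: "set_borel_measurable lborel {0<..} f"
    and int: "\<And>q. q > 0 \<Longrightarrow> set_integrable lborel {0<..} (\<lambda>t. exp (- q * t) * norm (f t))"
  shows "(\<lambda>p. LBINT t:{0<..}. exp (- p * of_real t) * f t) holomorphic_on {p. Re p > 0}"
proof (rule holomorphic_on_set_integral_dominated)
  show "open {p. Re p > 0}" by (rule open_halfspace_Re_gt)
  fix p :: complex
  have "(\<lambda>t. exp (- p * of_real t) * (indicator {0<..} t *\<^sub>R f t)) \<in> borel_measurable lborel"
    using m unfolding set_borel_measurable_def by measurable
  then show "set_borel_measurable lborel {0<..} (\<lambda>t. exp (- p * of_real t) * f t)"
    unfolding set_borel_measurable_def by (simp add: mult.commute scaleR_conv_of_real mult.left_commute)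
next
  fix t :: real
  show "(\<lambda>p. exp (- p * of_real t) * f t) holomorphic_on {p. Re p > 0}" by (intro holomorphic_intros)
next
  fix p0 :: complex assume "p0 \<in> {p. Re p > 0}"
  then have p0: "Re p0 > 0" by simp
  define q where "q = Re p0 / 2"
  have "norm (exp (- p * of_real t) * f t) \<le> exp (- q * t) * norm (f t)"
    if p: "p \<in> ball p0 q" and t: "t \<in> {0<..}" for p t
  proof -
    have "\<bar>Re (p0 - p)\<bar> \<le> norm (p0 - p)" by (rule abs_Re_le_cmod)
    then have "Re p \<ge> q" using p by (simp add: dist_norm q_def)
    then have "exp (- Re p * t) \<le> exp (- q * t)" using t by simp
    then show ?thesis unfolding norm_mult norm_exp_times_of_real by (rule mult_right_mono) simp
  qed
  then show "\<exists>r>0. \<exists>W. set_integrable lborel {0<..} W \<and>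
      (\<forall>p\<in>ball p0 r \<inter> {p. Re p > 0}. \<forall>t\<in>{0<..}. norm (exp (- p * of_real t) * f t) \<le> W t)"
    using int[of q] p0 by (intro exI[of _ q] conjI exI[of _ "\<lambda>t. exp (- q * t) * norm (f t)"]) (auto simp: q_def)
qed

text \<open>Points of a real open set accumulate inside the complex domain. In this form the
  identity theorem performs the continuations in \<open>p\<close>, in \<open>\<nu>\<close> and in
  \<open>\<mu>\<close>.\<close>

lemma identity_theorem_real:
  fixes f g :: "complex \<Rightarrow> complex" and T :: "real set"
  assumes "f holomorphic_on S" "g holomorphic_on S" "open S" "connected S"
    and T: "open T" "\<xi> \<in> T" "complex_of_real ` T \<subseteq> S"
    and "\<And>r. r \<in> T \<Longrightarrow> f (of_real r) = g (of_real r)" and "w \<in> S"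
  shows "f w = g w"
proof -
  have "f w - g w = 0"
  proof (rule analytic_continuation[of "\<lambda>p. f p - g p" S "complex_of_real ` T" "of_real \<xi>"])
    show "complex_of_real \<xi> islimpt complex_of_real ` T"
      unfolding islimpt_approachable
    proof (intro allI impI)
      fix e :: real assume "e > 0"
      moreover have "\<xi> islimpt T" using T by (intro open_imp_islimpt)
      ultimately obtain r where "r \<in> T" "r \<noteq> \<xi>" "dist r \<xi> < e"
        unfolding islimpt_approachable by blast
      then show "\<exists>x'\<in>complex_of_real ` T. x' \<noteq> complex_of_real \<xi> \<and> dist x' (complex_of_real \<xi>) < e"
        by (intro bexI[of _ "of_real r"]) auto
    qed
  qed (use assms in \<open>auto intro!: holomorphic_intros\<close>)
  then show ?thesis by simp
qed

text \<open>The substitution above is real, so complex \<open>p\<close> is reached by continuation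
  from the positive axis.\<close>

lemma laplace_exp_sqrt:
  fixes p :: complex and k :: real
  assumes p: "Re p > 0" and k: "k > 0"
  shows "(LBINT t:{0<..}. exp (- p * of_real t) * of_real (t powr (- 1 / 2) * exp (- k\<^sup>2 / (4 * t))))
    = of_real (sqrt pi) * p powr (- 1 / 2) * exp (- of_real k * p powr (1 / 2))"
proof -
  define f where "f t = t powr (- 1 / 2) * exp (- k\<^sup>2 / (4 * t))" for t :: real
  have m: "set_borel_measurable lborel {0<..} f"
    unfolding set_borel_measurable_def f_def by measurable
  have "(LBINT t:{0<..}. exp (- p * of_real t) * of_real (f t))
    = of_real (sqrt pi) * p powr (- 1 / 2) * exp (- of_real k * p powr (1 / 2))"
  proof (rule identity_theorem_real[of "\<lambda>p. (LBINT t:{0<..}. exp (- p * of_real t) * of_real (f t))"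
        "{p. Re p > 0}" _ "{0<..}" 1])
    show "connected {p. Re p > 0}" by (intro convex_connected convex_halfspace_Re_gt)
    show "(\<lambda>p. (LBINT t:{0<..}. exp (- p * of_real t) * complex_of_real (f t))) holomorphic_on {p. Re p > 0}"
    proof (rule holomorphic_on_laplace)
      show "set_borel_measurable lborel {0<..} (\<lambda>t. complex_of_real (f t))"
        unfolding set_borel_measurable_def f_def by measurable
      fix q :: real assume q: "q > 0"
      show "set_integrable lborel {0<..} (\<lambda>t. exp (- q * t) * norm (complex_of_real (f t)))"
      proof (rule set_integrable_bound)
        show "set_integrable lborel {0<..} (\<lambda>t. t powr (1 / 2 - 1) * exp (- (q * t)))"
          by (rule Gamma_scaled_lborel(1)) (use q in auto)
        show "set_borel_measurable lborel {0<..} (\<lambda>t. exp (- q * t) * norm (complex_of_real (f t)))"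
          unfolding set_borel_measurable_def f_def by measurable
        have "exp (- q * t) * norm (complex_of_real (f t)) \<le> t powr (1 / 2 - 1) * exp (- (q * t))" if "t > 0" for t
          unfolding norm_of_real f_def using that by (simp add: abs_mult mult.commute)
        then show "AE t in lborel. t \<in> {0<..} \<longrightarrow> norm (exp (- q * t) * norm (complex_of_real (f t)))
            \<le> norm (t powr (1 / 2 - 1) * exp (- (q * t)))" by auto
      qed
    qed
    show "(\<lambda>p. of_real (sqrt pi) * p powr (- 1 / 2) * exp (- of_real k * p powr (1 / 2))) holomorphic_on {p. Re p > 0}"
      by (intro holomorphic_intros) (auto simp: complex_nonpos_Reals_iff)
    fix x :: real assume "x \<in> {0<..}"
    then have x: "x > 0" by simp
    have "(LBINT t:{0<..}. exp (- of_real x * of_real t) * complex_of_real (f t))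
        = (LBINT t:{0<..}. complex_of_real (exp (- x * t) * f t))"
      by (simp add: exp_of_real flip: of_real_mult of_real_minus)
    also have "\<dots> = of_real (sqrt pi / sqrt x * exp (- k * sqrt x))"
      using laplace_exp_sqrt_real[OF x k] by (simp only: set_integral_complex_of_real f_def)
    also have "\<dots> = of_real (sqrt pi) * complex_of_real (1 / sqrt x) * exp (- of_real k * complex_of_real (sqrt x))"
      by (simp add: exp_of_real flip: of_real_mult of_real_minus)
    also have "complex_of_real (1 / sqrt x) = of_real x powr (- 1 / 2)"
      using x powr_of_real[of x "- 1 / 2"] by (simp add: powr_minus_divide powr_half_sqrt)
    also have "complex_of_real (sqrt x) = of_real x powr (1 / 2)"
      using x powr_of_real[of x "1 / 2"] by (simp add: powr_half_sqrt)
    finally show "(LBINT t:{0<..}. exp (- of_real x * of_real t) * complex_of_real (f t))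
      = of_real (sqrt pi) * of_real x powr (- 1 / 2) * exp (- of_real k * of_real x powr (1 / 2))" .
  qed (use p in \<open>auto intro: open_halfspace_Re_gt\<close>)
  then show ?thesis by (simp add: f_def)
qed

lemma Fubini_dominated_product:
  fixes F :: "real \<Rightarrow> real \<Rightarrow> complex"
  assumes F: "(\<lambda>(x, y). F x y) \<in> borel_measurable (lborel \<Otimes>\<^sub>M lborel)"
    and f: "integrable lborel f" and g: "integrable lborel (g :: real \<Rightarrow> real)"
    and bound: "\<And>x y. norm (F x y) \<le> f x * g y"
  shows "(LBINT x. (LBINT y. F x y)) = (LBINT y. (LBINT x. F x y))"
proof -
  have [measurable]: "f \<in> borel_measurable lborel" "g \<in> borel_measurable lborel" using f g by auto
  have "integrable (lborel \<Otimes>\<^sub>M lborel) (\<lambda>(x, y). f x * g y)"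
    by (rule lborel_pair.Fubini_integrable) (use f g in \<open>auto simp: abs_mult\<close>)
  then have "integrable (lborel \<Otimes>\<^sub>M lborel) (\<lambda>(x, y). F x y)"
  proof (rule Bochner_Integration.integrable_bound[OF _ F])
    have "norm (F x y) \<le> norm (f x * g y)" for x y using bound[of x y] by simp
    then show "AE z in lborel \<Otimes>\<^sub>M lborel. norm (case z of (x, y) \<Rightarrow> F x y) \<le> norm (case z of (x, y) \<Rightarrow> f x * g y)"
      by auto
  qed
  from lborel_pair.Fubini_integral[OF this] show ?thesis by simp
qed

lemma Fubini_dominated_product_set:
  fixes H :: "real \<Rightarrow> real \<Rightarrow> complex" and f g :: "real \<Rightarrow> real"
  assumes A: "A \<in> sets borel" and B: "B \<in> sets borel"
    and H: "(\<lambda>(x, y). H x y) \<in> borel_measurable (lborel \<Otimes>\<^sub>M lborel)"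
    and f: "set_integrable lborel A f" and g: "set_integrable lborel B g"
    and bound: "\<And>x y. x \<in> A \<Longrightarrow> y \<in> B \<Longrightarrow> norm (H x y) \<le> f x * g y"
  shows "(LBINT x:A. (LBINT y:B. H x y)) = (LBINT y:B. (LBINT x:A. H x y))"
proof -
  define F where "F x y = indicat_real A x *\<^sub>R indicat_real B y *\<^sub>R H x y" for x y
  have [measurable]: "A \<in> sets lborel" "B \<in> sets lborel" using A B by auto
  have "(LBINT x. (LBINT y. F x y)) = (LBINT y. (LBINT x. F x y))"
  proof (rule Fubini_dominated_product)
    have "(\<lambda>z. indicat_real A (fst z) *\<^sub>R indicat_real B (snd z) *\<^sub>R (case z of (x, y) \<Rightarrow> H x y))
        \<in> borel_measurable (lborel \<Otimes>\<^sub>M lborel)"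
      using H by measurable
    then show "(\<lambda>(x, y). F x y) \<in> borel_measurable (lborel \<Otimes>\<^sub>M lborel)"
      by (simp add: F_def case_prod_unfold)
    show "integrable lborel (\<lambda>x. indicat_real A x * f x)" "integrable lborel (\<lambda>x. indicat_real B x * g x)"
      using f g by (simp_all add: set_integrable_def)
    show "norm (F x y) \<le> indicat_real A x * f x * (indicat_real B y * g y)" for x y
      using bound[of x y] by (auto simp: F_def indicator_def)
  qed
  moreover have "(LBINT y. F x y) = indicat_real A x *\<^sub>R (LBINT y:B. H x y)" for x
    unfolding F_def set_lebesgue_integral_def by (rule integral_scaleR_right)
  moreover have "(LBINT x. F x y) = indicat_real B y *\<^sub>R (LBINT x:A. H x y)" for y
    unfolding F_def set_lebesgue_integral_def scaleR_left_commute[of "indicat_real A _"]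
    by (rule integral_scaleR_right)
  ultimately show ?thesis unfolding set_lebesgue_integral_def by simp
qed

lemma Gamma_minus_half: "Gamma (- 1 / 2 :: complex) = - 2 * of_real (sqrt pi)"
proof -
  have "rGamma (- 1 / 2 :: complex) = (- 1 / 2) * rGamma (1 / 2)"
    using rGamma_plus1[of "- 1 / 2 :: complex"] by simp
  then have "Gamma (- 1 / 2 :: complex) = - 2 * Gamma (1 / 2)"
    unfolding Gamma_def by (simp only: inverse_mult_distrib) simp
  then show ?thesis using Gamma_one_half_complex by simp
qed

lemma Gamma_duplication_real:
  fixes a :: real
  assumes "a > 0"
  shows "Gamma (2 * a) * sqrt pi = 2 powr (2 * a - 1) * Gamma a * Gamma (a + 1 / 2)"
proof -
  have "complex_of_real a \<notin> \<int>\<^sub>\<le>\<^sub>0" "complex_of_real a + 1 / 2 \<notin> \<int>\<^sub>\<le>\<^sub>0"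
    using assms by (auto elim!: nonpos_Ints_cases simp: complex_eq_iff)
  from Gamma_legendre_duplication[OF this]
  have "complex_of_real (Gamma a * Gamma (a + 1 / 2)) = of_real (exp ((1 - 2 * a) * ln 2) * sqrt pi * Gamma (2 * a))"
    by (simp flip: Gamma_complex_of_real exp_of_real)
  then have "Gamma a * Gamma (a + 1 / 2) = exp ((1 - 2 * a) * ln 2) * sqrt pi * Gamma (2 * a)"
    by (simp only: of_real_eq_iff)
  also have "exp ((1 - 2 * a) * ln 2) = 2 powr (1 - 2 * a)" by (simp add: powr_def)
  finally have "2 powr (2 * a - 1) * (Gamma a * Gamma (a + 1 / 2))
      = (2 powr (2 * a - 1) * 2 powr (1 - 2 * a)) * (sqrt pi * Gamma (2 * a))" by simp
  also have "2 powr (2 * a - 1) * 2 powr (1 - 2 * a) = (1::real)" by (simp flip: powr_add)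
  finally show ?thesis by (simp add: mult_ac)
qed

text \<open>The classical integral representation for negative order, valid for every complex
  \<open>z\<close>. Legendre's duplication formula matches the coefficients of the expansion with
  those in the definition.\<close>

lemma parabolic_cylinder_D_integral:
  fixes a :: real and z :: complex
  assumes a: "a > 0"
  shows "exp (z\<^sup>2 / 4) * parabolic_cylinder_D (of_real (- 2 * a)) z = of_real (1 / Gamma (2 * a)) *
     (LBINT s:{0<..}. exp (- z * of_real s) * of_real (s powr (2 * a - 1) * exp (- (s\<^sup>2 / 2))))"
proof -
  define G1 G2 G3 where "G1 = Gamma a" and "G2 = Gamma (a + 1 / 2)" and "G3 = Gamma (2 * a)"
  have G: "G1 > 0" "G2 > 0" "G3 > 0" unfolding G1_def G2_def G3_def
    by (rule Gamma_real_pos, use a in simp)+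
  have dup: "G3 * sqrt pi = 2 powr (2 * a - 1) * G1 * G2"
    using Gamma_duplication_real[OF a] by (simp add: G1_def G2_def G3_def)
  have "2 powr (2 * a - 1) = 2 powr (a - 1) * (2 powr a :: real)" by (simp flip: powr_add)
  then have c1: "1 / G3 * (2 powr (a - 1) * G1) = 2 powr (- a) * sqrt pi / G2"
    using dup G by (simp add: powr_minus_divide field_simps)
  have aux: "1 / g * x = 1 / q * t / v" if "g > 0" "q > 0" "v > 0" "x * (q * v) = t * g" for g x q t v :: real
    using that by (simp add: field_simps)
  have c2': "2 * 2 powr (2 * a - 1) = 2 powr (a - 1 / 2) * (2 powr a * sqrt 2 :: real)"
    by (simp add: powr_half_sqrt[symmetric] powr_mult_base flip: powr_add)
  have c2: "1 / G3 * (2 powr (a - 1 / 2) * G2) = 2 powr (- a) * (2 * sqrt pi) / (sqrt 2 * G1)"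
    unfolding powr_minus_divide
  proof (rule aux)
    have "2 powr (a - 1 / 2) * G2 * (2 powr a * (sqrt 2 * G1)) = (2 powr (a - 1 / 2) * (2 powr a * sqrt 2)) * G1 * G2"
      by (simp only: mult_ac)
    also have "\<dots> = 2 * (2 powr (2 * a - 1) * G1 * G2)" unfolding c2'[symmetric] by (simp only: mult_ac)
    also have "\<dots> = 2 * sqrt pi * G3" unfolding dup[symmetric] by simp
    finally show "2 powr (a - 1 / 2) * G2 * (2 powr a * (sqrt 2 * G1)) = 2 * sqrt pi * G3" .
  qed (use G in auto)
  have two: "(2 :: complex) powr of_real r = of_real (2 powr r)" for r
    using powr_of_real[of 2 r] by simp
  have "rGamma (complex_of_real (a + 1 / 2)) = of_real (1 / G2)" "rGamma (complex_of_real a) = of_real (1 / G1)"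
    unfolding rGamma_inverse_Gamma G1_def G2_def
    by (simp_all only: Gamma_complex_of_real of_real_divide of_real_1 inverse_eq_divide)
  then have rG: "rGamma (complex_of_real a + 1 / 2) = of_real (1 / G2)" "rGamma (complex_of_real a) = of_real (1 / G1)"
    by simp_all
  have half: "(1 - of_real (- 2 * a)) / 2 = complex_of_real a + 1 / 2" "- of_real (- 2 * a) / 2 = complex_of_real a"
    by (simp_all add: field_simps)
  have "exp (z\<^sup>2 / 4) * parabolic_cylinder_D (of_real (- 2 * a)) z
      = of_real (2 powr (- a)) *
     (of_real (sqrt pi) * of_real (1 / G2) * kummer_Phi (of_real a) (1 / 2) (z\<^sup>2 / 2)
      + z / of_real (sqrt 2) * (- 2 * of_real (sqrt pi) * of_real (1 / G1))
        * kummer_Phi (of_real a + 1 / 2) (3 / 2) (z\<^sup>2 / 2))"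
  proof -
    have e1: "(2 :: complex) powr (of_real (- 2 * a) / 2) = of_real (2 powr (- a))" using two[of "- a"] by simp
    have e2: "(2 :: complex) powr (1 / 2) = of_real (sqrt 2)" using two[of "1 / 2"] by (simp add: powr_half_sqrt)
    have "exp (z\<^sup>2 / 4) * exp (- (z\<^sup>2) / 4) = 1" by (simp flip: exp_add)
    moreover have "exp (z\<^sup>2 / 4) * (P * exp (- (z\<^sup>2) / 4) * Y) = (exp (z\<^sup>2 / 4) * exp (- (z\<^sup>2) / 4)) * (P * Y)" for P Y
      by (simp only: mult_ac)
    ultimately have e3: "exp (z\<^sup>2 / 4) * (P * exp (- (z\<^sup>2) / 4) * Y) = P * Y" for P Y by simp
    show ?thesis
      unfolding parabolic_cylinder_D_def half rG e1 e2 e3 Gamma_minus_half Gamma_one_half_complex ..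
  qed
  also have "\<dots> = of_real (2 powr (- a) * sqrt pi / G2) * kummer_Phi (of_real a) (1 / 2) (z\<^sup>2 / 2)
      - z * of_real (2 powr (- a) * (2 * sqrt pi) / (sqrt 2 * G1)) * kummer_Phi (of_real a + 1 / 2) (3 / 2) (z\<^sup>2 / 2)"
    by (simp add: algebra_simps)
  also have "\<dots> = of_real (1 / G3) * (of_real (2 powr (a - 1) * G1) * kummer_Phi (of_real a) (1 / 2) (z\<^sup>2 / 2)
        - z * of_real (2 powr (a - 1 / 2) * G2) * kummer_Phi (of_real a + 1 / 2) (3 / 2) (z\<^sup>2 / 2))"
    unfolding c1[symmetric] c2[symmetric] by (simp add: algebra_simps)
  also have "\<dots> = of_real (1 / Gamma (2 * a)) *
     (LBINT s:{0<..}. exp (- z * of_real s) * of_real (s powr (2 * a - 1) * exp (- (s\<^sup>2 / 2))))"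
    unfolding parabolic_integral_expansion(2)[OF a] G1_def G2_def G3_def ..
  finally show ?thesis .
qed

text \<open>The argument \<open>z\<close> is \<open>sqrt (2 * y)\<close> times the root of
  \<open>p\<close>, so \<open>p powr (- 1 / 2) * exp (- z * s)\<close> is itself a Laplace transform
  in \<open>p\<close>, and \<open>exp (p * y / 2)\<close> cancels the Gaussian factor of the
  cylinder function. After exchanging the integrals, the integral over \<open>s\<close> is a Gamma
  integral with coefficient \<open>(y + t) / (2 * t)\<close>, and its power of order
  \<open>- a\<close> yields the density.\<close>

lemma parabolic_cylinder_D_laplace_real:
  fixes a y :: real and p :: complex
  assumes a: "a > 0" and y: "y > 0" and p: "Re p > 0"
  shows "p powr (- 1 / 2) * exp (p * of_real y / 2) *
      parabolic_cylinder_D (of_real (- 2 * a)) (2 powr (1 / 2) * of_real y powr (1 / 2) * p powr (1 / 2))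
    = of_real (2 powr (- a) / Gamma (a + 1 / 2)) *
      (LBINT t:{0<..}. exp (- p * of_real t) * of_real (t powr (a - 1 / 2) * (y + t) powr (- a)))"
proof -
  define z where "z = 2 powr (1 / 2) * of_real y powr (1 / 2) * p powr (1 / 2)"
  have "(2 :: complex) powr (1 / 2) * of_real y powr (1 / 2) = of_real (sqrt 2) * of_real (sqrt y)"
    using powr_of_real[of 2 "1/2"] powr_of_real[of y "1/2"] y by (simp add: powr_half_sqrt)
  then have z: "z = of_real (sqrt (2 * y)) * p powr (1 / 2)"
    unfolding z_def by (simp add: real_sqrt_mult)
  have p0: "p \<noteq> 0" using p by auto
  have "(p powr (1 / 2))\<^sup>2 = p" using p0 by (simp add: power2_eq_square flip: powr_add)
  moreover have "(complex_of_real (sqrt (2 * y)))\<^sup>2 = 2 * of_real y"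
    using y by (simp flip: of_real_power)
  ultimately have z2: "z\<^sup>2 / 4 = p * of_real y / 2" unfolding z by (simp add: power_mult_distrib)
  define w where "w s = s powr (2 * a - 1) * exp (- (s\<^sup>2 / 2))" for s :: real
  define H where "H s t = exp (- p * of_real t) * complex_of_real (t powr (- 1 / 2) * exp (- (sqrt (2 * y) * s)\<^sup>2 / (4 * t)) * w s)" for s t
  have swap: "(LBINT s:{0<..}. (LBINT t:{0<..}. H s t)) = (LBINT t:{0<..}. (LBINT s:{0<..}. H s t))"
  proof (rule Fubini_dominated_product_set)
    show "(\<lambda>(s, t). H s t) \<in> borel_measurable (lborel \<Otimes>\<^sub>M lborel)"
      unfolding H_def w_def by measurable
    show "set_integrable lborel {0<..} w"
      unfolding w_def[abs_def] using Gamma_square_lborel(1)[OF a, of "1 / 2"] by simp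
    show "set_integrable lborel {0<..} (\<lambda>t. t powr (1 / 2 - 1) * exp (- (Re p * t)))"
      by (rule Gamma_scaled_lborel(1)) (use p in auto)
    fix s t :: real assume st: "s \<in> {0<..}" "t \<in> {0<..}"
    have w0: "w s \<ge> 0" by (simp add: w_def)
    have "norm (H s t) = exp (- (Re p * t)) * (t powr (- 1 / 2) * exp (- (sqrt (2 * y) * s)\<^sup>2 / (4 * t)) * w s)"
      unfolding H_def norm_mult norm_exp_times_of_real norm_of_real using w0 by (simp add: abs_mult)
    also have "\<dots> \<le> exp (- (Re p * t)) * (t powr (- 1 / 2) * 1 * w s)"
      using st w0 by (intro mult_left_mono mult_right_mono) auto
    finally show "norm (H s t) \<le> w s * (t powr (1 / 2 - 1) * exp (- (Re p * t)))" by (simp add: mult_ac)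
  qed auto
  have "(LBINT s:{0<..}. (LBINT t:{0<..}. H s t))
      = (LBINT s:{0<..}. of_real (sqrt pi) * p powr (- 1 / 2) * (exp (- z * of_real s) * of_real (w s)))"
  proof (rule set_lebesgue_integral_cong, simp, intro allI impI)
    fix s :: real assume "s \<in> {0<..}"
    then have k: "sqrt (2 * y) * s > 0" using y by simp
    have "(LBINT t:{0<..}. H s t) = of_real (w s) *
        (LBINT t:{0<..}. exp (- p * of_real t) * of_real (t powr (- 1 / 2) * exp (- (sqrt (2 * y) * s)\<^sup>2 / (4 * t))))"
      unfolding H_def set_integral_mult_right[symmetric]
      by (rule set_lebesgue_integral_cong) auto
    then show "(LBINT t:{0<..}. H s t) = of_real (sqrt pi) * p powr (- 1 / 2) * (exp (- z * of_real s) * of_real (w s))"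
      unfolding laplace_exp_sqrt[OF p k] by (simp add: z mult_ac)
  qed
  also have "\<dots> = of_real (sqrt pi) * p powr (- 1 / 2) * (LBINT s:{0<..}. exp (- z * of_real s) * of_real (w s))"
    by (rule set_integral_mult_right)
  finally have L: "(LBINT s:{0<..}. (LBINT t:{0<..}. H s t))
      = of_real (sqrt pi) * p powr (- 1 / 2) * (LBINT s:{0<..}. exp (- z * of_real s) * of_real (w s))" .
  have "(LBINT t:{0<..}. (LBINT s:{0<..}. H s t))
      = (LBINT t:{0<..}. of_real (Gamma a * 2 powr (a - 1)) * (exp (- p * of_real t) * of_real (t powr (a - 1 / 2) * (y + t) powr (- a))))"
  proof (rule set_lebesgue_integral_cong, simp, intro allI impI)
    fix t :: real assume "t \<in> {0<..}"
    then have t: "t > 0" by simp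
    \<comment> \<open>The two Gaussian exponents \<open>y * s^2 / (2 * t)\<close> and
      \<open>s^2 / 2\<close> added together.\<close>
    define K where "K = (y + t) / (2 * t)"
    have K: "K > 0" using t y by (simp add: K_def)
    have ta: "t powr a = t powr (1 / 2) * t powr (a - 1 / 2)" by (simp flip: powr_add)
    have "(LBINT s:{0<..}. H s t) = exp (- p * of_real t) * of_real (t powr (- 1 / 2)) *
        (LBINT s:{0<..}. complex_of_real (s powr (2 * a - 1) * exp (- (K * s\<^sup>2))))"
      unfolding set_integral_mult_right[symmetric]
    proof (rule set_lebesgue_integral_cong, simp, intro allI impI)
      fix s :: real assume "s \<in> {0<..}"
      have "- (sqrt (2 * y) * s)\<^sup>2 / (4 * t) + - (s\<^sup>2 / 2) = - (K * s\<^sup>2)"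
        using t y by (simp add: K_def power_mult_distrib field_simps)
      then have E: "exp (- (sqrt (2 * y) * s)\<^sup>2 / (4 * t)) * exp (- (s\<^sup>2 / 2)) = exp (- (K * s\<^sup>2))"
        by (simp only: exp_add[symmetric])
      have "t powr (- 1 / 2) * exp (- (sqrt (2 * y) * s)\<^sup>2 / (4 * t)) * w s
          = t powr (- 1 / 2) * (s powr (2 * a - 1) * (exp (- (sqrt (2 * y) * s)\<^sup>2 / (4 * t)) * exp (- (s\<^sup>2 / 2))))"
        unfolding w_def by (simp only: mult_ac)
      then have "t powr (- 1 / 2) * exp (- (sqrt (2 * y) * s)\<^sup>2 / (4 * t)) * w s
          = t powr (- 1 / 2) * (s powr (2 * a - 1) * exp (- (K * s\<^sup>2)))"
        unfolding E .
      then show "H s t = exp (- p * of_real t) * of_real (t powr (- 1 / 2)) * complex_of_real (s powr (2 * a - 1) * exp (- (K * s\<^sup>2)))"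
        unfolding H_def by (simp only: of_real_mult mult.assoc)
    qed
    also have "(LBINT s:{0<..}. complex_of_real (s powr (2 * a - 1) * exp (- (K * s\<^sup>2)))) = of_real (Gamma a / (2 * K powr a))"
      unfolding set_integral_complex_of_real Gamma_square_lborel(2)[OF a K] ..
    finally have "(LBINT s:{0<..}. H s t) = exp (- p * of_real t) * of_real (t powr (- 1 / 2) * (Gamma a / (2 * K powr a)))"
      by simp
    also have "t powr (- 1 / 2) * (Gamma a / (2 * K powr a)) = Gamma a * 2 powr (a - 1) * (t powr (a - 1 / 2) * (y + t) powr (- a))"
      using t y ta by (simp add: K_def powr_divide powr_mult powr_diff powr_minus_divide field_simps)
    finally show "(LBINT s:{0<..}. H s t) = of_real (Gamma a * 2 powr (a - 1)) * (exp (- p * of_real t) * of_real (t powr (a - 1 / 2) * (y + t) powr (- a)))"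
      by (simp only: of_real_mult mult_ac)
  qed
  also have "\<dots> = of_real (Gamma a * 2 powr (a - 1)) * (LBINT t:{0<..}. exp (- p * of_real t) * of_real (t powr (a - 1 / 2) * (y + t) powr (- a)))"
    by (rule set_integral_mult_right)
  finally have R: "(LBINT t:{0<..}. (LBINT s:{0<..}. H s t)) = of_real (Gamma a * 2 powr (a - 1)) *
      (LBINT t:{0<..}. exp (- p * of_real t) * of_real (t powr (a - 1 / 2) * (y + t) powr (- a)))" .
  have G: "Gamma a > 0" "Gamma (a + 1 / 2) > 0" "Gamma (2 * a) > 0"
    by (rule Gamma_real_pos, use a in simp)+
  have "2 powr (2 * a - 1) = 2 powr (a - 1) * (2 powr a :: real)" by (simp flip: powr_add)
  then have dup: "Gamma (2 * a) * sqrt pi = 2 powr (a - 1) * 2 powr a * Gamma a * Gamma (a + 1 / 2)"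
    using Gamma_duplication_real[OF a] by simp
  have "1 / Gamma (2 * a) / sqrt pi * (Gamma a * 2 powr (a - 1)) = Gamma a * 2 powr (a - 1) / (Gamma (2 * a) * sqrt pi)"
    by simp
  also have "\<dots> = 2 powr (- a) / Gamma (a + 1 / 2)"
    unfolding dup powr_minus_divide using G by simp
  finally have const: "1 / Gamma (2 * a) / sqrt pi * (Gamma a * 2 powr (a - 1)) = 2 powr (- a) / Gamma (a + 1 / 2)" .
  have "p powr (- 1 / 2) * exp (p * of_real y / 2) * parabolic_cylinder_D (of_real (- 2 * a)) z
      = p powr (- 1 / 2) * (exp (z\<^sup>2 / 4) * parabolic_cylinder_D (of_real (- 2 * a)) z)" by (simp add: z2)
  also have "\<dots> = of_real (1 / Gamma (2 * a) / sqrt pi) * (of_real (sqrt pi) * p powr (- 1 / 2) * (LBINT s:{0<..}. exp (- z * of_real s) * of_real (w s)))"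
    unfolding parabolic_cylinder_D_integral[OF a] w_def by simp
  also have "\<dots> = of_real (1 / Gamma (2 * a) / sqrt pi * (Gamma a * 2 powr (a - 1))) *
      (LBINT t:{0<..}. exp (- p * of_real t) * of_real (t powr (a - 1 / 2) * (y + t) powr (- a)))"
    unfolding L[symmetric] swap R by (simp only: of_real_mult mult.assoc)
  finally show ?thesis unfolding const z_def .
qed

subsection \<open>Euler integrals\<close>

lemma Beta_shift_real:
  fixes b d :: real
  assumes "b > 0" "d > 0"
  shows "Beta (b + real n) d = Beta b d * (pochhammer b n / pochhammer (b + d) n)"
proof -
  have n: "b \<notin> \<int>\<^sub>\<le>\<^sub>0" "b + d \<notin> \<int>\<^sub>\<le>\<^sub>0" using assms by (auto elim!: nonpos_Ints_cases)
  have G: "Gamma b > 0" "Gamma (b + d) > 0" "Gamma (b + d + real n) > 0"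
    by (rule Gamma_real_pos, use assms in simp)+
  have "Gamma (b + real n) = pochhammer b n * Gamma b" "Gamma (b + d + real n) = pochhammer (b + d) n * Gamma (b + d)"
    using pochhammer_Gamma[OF n(1), of n] pochhammer_Gamma[OF n(2), of n] G by (simp_all add: field_simps)
  moreover have eq: "b + real n + d = b + d + real n" by simp
  ultimately show ?thesis
    unfolding Beta_def eq by (simp add: mult_ac)
qed

lemma kummer_Phi_Euler:
  fixes b c :: real and w :: complex
  assumes b: "0 < b" "b < c"
  shows "kummer_Phi (of_real b) (of_real c) w = of_real (1 / Beta b (c - b)) *
    (LBINT s:{0<..<1}. exp (w * of_real s) * of_real (s powr (b - 1) * (1 - s) powr (c - b - 1)))"
proof -
  define g where "g s = s powr (b - 1) * (1 - s) powr (c - b - 1)" for s :: real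
  define f where "f n s = (w * of_real s) ^ n / fact n * complex_of_real (g s)" for n :: nat and s :: real
  have g0: "g s \<ge> 0" for s by (simp add: g_def)
  have gint: "set_integrable lborel {0<..<1} g" "(LBINT s:{0<..<1}. g s) = Beta b (c - b)"
    unfolding g_def using Beta_lborel[of b "c - b"] b by simp_all
  have expw: "(\<lambda>n. x ^ n / fact n) sums exp x" for x :: "'a :: {banach, real_normed_field}"
    using exp_converges[of x] by (simp add: scaleR_conv_of_real divide_inverse mult.commute)
  have "(\<lambda>n. LBINT s:{0<..<1}. f n s) sums (LBINT s:{0<..<1}. exp (w * of_real s) * of_real (g s))"
  proof (rule sums_set_integral_dominated(2))
    show "set_borel_measurable lborel {0<..<1} (f n)" for n
      unfolding set_borel_measurable_def f_def g_def by measurable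
    show "set_integrable lborel {0<..<1} (\<lambda>s. exp (norm w) * g s)" using gint by simp
    show "(\<lambda>n. f n s) sums (exp (w * of_real s) * of_real (g s))" for s
      unfolding f_def by (intro sums_mult2 expw)
    fix n and s :: real assume s: "s \<in> {0<..<1}"
    have "(\<Sum>i<n. norm (f i s)) = (\<Sum>i<n. (norm w * s) ^ i / fact i) * g s"
      unfolding sum_distrib_right f_def norm_mult norm_divide norm_power norm_of_real norm_fact
        abs_of_nonneg[OF g0] using s by simp
    also have "\<dots> \<le> exp (norm w) * g s"
    proof (rule mult_right_mono[OF _ g0])
      have "(\<Sum>i<n. (norm w * s) ^ i / fact i) \<le> (\<Sum>i<n. norm w ^ i / fact i)"
        using s by (intro sum_mono divide_right_mono power_mono) (auto simp: mult_left_le)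
      also have "\<dots> \<le> exp (norm w)"
        unfolding sums_unique[OF expw] by (rule sum_le_suminf[OF sums_summable[OF expw]]) auto
      finally show "(\<Sum>i<n. (norm w * s) ^ i / fact i) \<le> exp (norm w)" .
    qed
    finally show "(\<Sum>i<n. norm (f i s)) \<le> exp (norm w) * g s" .
  qed
  moreover have "(LBINT s:{0<..<1}. f n s) = of_real (Beta b (c - b)) *
      (pochhammer (of_real b) n / pochhammer (of_real c) n * w ^ n / fact n)" for n
  proof -
    have "(LBINT s:{0<..<1}. f n s) = (LBINT s:{0<..<1}. w ^ n / fact n * complex_of_real (s powr (b + real n - 1) * (1 - s) powr (c - b - 1)))"
    proof (rule set_lebesgue_integral_cong, simp, intro allI impI)
      fix s :: real assume s: "s \<in> {0<..<1}"
      have "b + real n - 1 = real n + (b - 1)" by simp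
      then have "s powr (b + real n - 1) = s ^ n * s powr (b - 1)"
        using s by (simp only: powr_add powr_realpow greaterThanLessThan_iff)
      then show "f n s = w ^ n / fact n * complex_of_real (s powr (b + real n - 1) * (1 - s) powr (c - b - 1))"
        by (simp add: f_def g_def power_mult_distrib)
    qed
    also have "\<dots> = w ^ n / fact n * of_real (LBINT s:{0<..<1}. s powr (b + real n - 1) * (1 - s) powr (c - b - 1))"
      by (simp only: set_integral_mult_right set_integral_complex_of_real)
    also have "(LBINT s:{0<..<1}. s powr (b + real n - 1) * (1 - s) powr (c - b - 1)) = Beta b (c - b) * (pochhammer b n / pochhammer c n)"
      using Beta_lborel(2)[of "b + real n" "c - b"] Beta_shift_real[of b "c - b" n] b by simp
    finally show ?thesis by (simp add: pochhammer_of_real mult_ac)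
  qed
  ultimately have "(\<lambda>n. of_real (Beta b (c - b)) * (pochhammer (of_real b) n / pochhammer (of_real c) n * w ^ n / fact n))
      sums (LBINT s:{0<..<1}. exp (w * of_real s) * of_real (g s))" by (simp only:)
  moreover have "(\<lambda>n. of_real (Beta b (c - b)) * (pochhammer (of_real b) n / pochhammer (of_real c) n * w ^ n / fact n))
      sums (of_real (Beta b (c - b)) * kummer_Phi (of_real b) (of_real c) w)"
    by (intro sums_mult kummer_Phi_sums) (use b in simp)
  ultimately have "of_real (Beta b (c - b)) * kummer_Phi (of_real b) (of_real c) w
      = (LBINT s:{0<..<1}. exp (w * of_real s) * of_real (g s))" by (rule sums_unique2[symmetric])
  moreover have "Beta b (c - b) > 0"
    unfolding Beta_def using b by (auto intro!: divide_pos_pos mult_pos_pos Gamma_real_pos)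
  ultimately show ?thesis unfolding g_def by (simp add: field_simps)
qed

lemma gauss_2F1_Euler_disc:
  fixes a b c z :: real
  assumes b: "0 < b" "b < c" and z: "\<bar>z\<bar> < 1"
  shows "hyp_series (of_real a) (of_real b) (of_real c) (of_real z) = of_real (1 / Beta b (c - b) *
    (LBINT s:{0<..<1}. s powr (b - 1) * (1 - s) powr (c - b - 1) * (1 - z * s) powr (- a)))"
proof -
  define g where "g s = s powr (b - 1) * (1 - s) powr (c - b - 1)" for s :: real
  define f where "f n s = pochhammer a n / fact n * (z * s) ^ n * g s" for n :: nat and s :: real
  have g0: "g s \<ge> 0" for s by (simp add: g_def)
  have gint: "set_integrable lborel {0<..<1} g" "(LBINT s:{0<..<1}. g s) = Beta b (c - b)"
    unfolding g_def using Beta_lborel[of b "c - b"] b by simp_all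
  have zs: "\<bar>z * s\<bar> \<le> \<bar>z\<bar>" if "s \<in> {0<..<1}" for s using that by (auto simp: abs_mult mult_left_le)
  have "(\<lambda>n. LBINT s:{0<..<1}. f n s) sums (LBINT s:{0<..<1}. (1 - z * s) powr (- a) * g s)"
  proof (rule sums_set_integral_dominated(2))
    show "set_borel_measurable lborel {0<..<1} (f n)" for n
      unfolding set_borel_measurable_def f_def g_def by measurable
    show "set_integrable lborel {0<..<1} (\<lambda>s. (1 - \<bar>z\<bar>) powr (- \<bar>a\<bar>) * g s)" using gint by simp
    fix s :: real assume s: "s \<in> {0<..<1}"
    show "(\<lambda>n. f n s) sums ((1 - z * s) powr (- a) * g s)"
      unfolding f_def by (intro sums_mult2 binomial_series_pochhammer_real) (use zs[OF s] z in simp)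
    fix n
    have "(\<Sum>i<n. norm (f i s)) \<le> (\<Sum>i<n. pochhammer \<bar>a\<bar> i / fact i * \<bar>z\<bar> ^ i) * g s"
      unfolding sum_distrib_right
    proof (rule sum_mono)
      fix i
      have "\<bar>pochhammer a i\<bar> \<le> pochhammer \<bar>a\<bar> i" using norm_pochhammer_le[of a "\<bar>a\<bar>" i] by simp
      moreover have "\<bar>z * s\<bar> ^ i \<le> \<bar>z\<bar> ^ i" using zs[OF s] by (intro power_mono) auto
      ultimately have "\<bar>pochhammer a i\<bar> / fact i * \<bar>z * s\<bar> ^ i * g s \<le> pochhammer \<bar>a\<bar> i / fact i * \<bar>z\<bar> ^ i * g s"
        using g0 by (intro mult_right_mono mult_mono divide_right_mono) (auto intro: divide_nonneg_pos pochhammer_nonneg order_trans[OF abs_ge_zero])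
      then show "norm (f i s) \<le> pochhammer \<bar>a\<bar> i / fact i * \<bar>z\<bar> ^ i * g s"
        unfolding f_def real_norm_def abs_mult abs_divide power_abs abs_of_nonneg[OF g0] by simp
    qed
    also have "\<dots> \<le> (1 - \<bar>z\<bar>) powr (- \<bar>a\<bar>) * g s"
    proof (rule mult_right_mono[OF _ g0])
      have bs: "(\<lambda>i. pochhammer \<bar>a\<bar> i / fact i * \<bar>z\<bar> ^ i) sums (1 - \<bar>z\<bar>) powr (- \<bar>a\<bar>)"
        by (rule binomial_series_pochhammer_real) (use z in simp)
      have nn: "0 \<le> pochhammer \<bar>a\<bar> i" for i
        using norm_pochhammer_le[of a "\<bar>a\<bar>" i] norm_ge_zero[of "pochhammer a i"] by simp
      show "(\<Sum>i<n. pochhammer \<bar>a\<bar> i / fact i * \<bar>z\<bar> ^ i) \<le> (1 - \<bar>z\<bar>) powr (- \<bar>a\<bar>)"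
        unfolding sums_unique[OF bs]
        by (rule sum_le_suminf[OF sums_summable[OF bs]]) (use nn in auto)
    qed
    finally show "(\<Sum>i<n. norm (f i s)) \<le> (1 - \<bar>z\<bar>) powr (- \<bar>a\<bar>) * g s" .
  qed
  moreover have "(LBINT s:{0<..<1}. f n s) = Beta b (c - b) *
      (pochhammer a n * pochhammer b n / pochhammer c n * z ^ n / fact n)" for n
  proof -
    have "(LBINT s:{0<..<1}. f n s) = (LBINT s:{0<..<1}. pochhammer a n / fact n * z ^ n * (s powr (b + real n - 1) * (1 - s) powr (c - b - 1)))"
    proof (rule set_lebesgue_integral_cong, simp, intro allI impI)
      fix s :: real assume s: "s \<in> {0<..<1}"
      have "b + real n - 1 = real n + (b - 1)" by simp
      then have "s powr (b + real n - 1) = s ^ n * s powr (b - 1)"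
        using s by (simp only: powr_add powr_realpow greaterThanLessThan_iff)
      then show "f n s = pochhammer a n / fact n * z ^ n * (s powr (b + real n - 1) * (1 - s) powr (c - b - 1))"
        by (simp add: f_def g_def power_mult_distrib)
    qed
    also have "\<dots> = pochhammer a n / fact n * z ^ n * (LBINT s:{0<..<1}. s powr (b + real n - 1) * (1 - s) powr (c - b - 1))"
      by (rule set_integral_mult_right)
    also have "(LBINT s:{0<..<1}. s powr (b + real n - 1) * (1 - s) powr (c - b - 1)) = Beta b (c - b) * (pochhammer b n / pochhammer c n)"
      using Beta_lborel(2)[of "b + real n" "c - b"] Beta_shift_real[of b "c - b" n] b by simp
    finally show ?thesis by (simp add: mult_ac)
  qed
  ultimately have "(\<lambda>n. Beta b (c - b) * (pochhammer a n * pochhammer b n / pochhammer c n * z ^ n / fact n))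
      sums (LBINT s:{0<..<1}. (1 - z * s) powr (- a) * g s)" by (simp only:)
  moreover have B: "Beta b (c - b) > 0"
    unfolding Beta_def using b by (auto intro!: divide_pos_pos mult_pos_pos Gamma_real_pos)
  ultimately have "(\<lambda>n. 1 / Beta b (c - b) * (Beta b (c - b) * (pochhammer a n * pochhammer b n / pochhammer c n * z ^ n / fact n)))
      sums (1 / Beta b (c - b) * (LBINT s:{0<..<1}. (1 - z * s) powr (- a) * g s))" by (intro sums_mult)
  then have "(\<lambda>n. complex_of_real (pochhammer a n * pochhammer b n / pochhammer c n * z ^ n / fact n))
      sums of_real (1 / Beta b (c - b) * (LBINT s:{0<..<1}. (1 - z * s) powr (- a) * g s))"
    using B by (simp only: sums_of_real_iff) simp
  moreover have "complex_of_real (pochhammer a n * pochhammer b n / pochhammer c n * z ^ n / fact n)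
      = gauss_2F1_term (of_real a) (of_real b) (of_real c) (of_real z) n" for n
    by (simp add: gauss_2F1_term_def pochhammer_of_real)
  ultimately have "gauss_2F1_term (of_real a) (of_real b) (of_real c) (of_real z)
      sums of_real (1 / Beta b (c - b) * (LBINT s:{0<..<1}. (1 - z * s) powr (- a) * g s))" by simp
  moreover have "gauss_2F1_term (of_real a) (of_real b) (of_real c) (of_real z) sums hyp_series (of_real a) (of_real b) (of_real c) (of_real z)"
    by (rule hyp_series_sums) (use b z in auto)
  ultimately have "hyp_series (of_real a) (of_real b) (of_real c) (of_real z)
      = of_real (1 / Beta b (c - b) * (LBINT s:{0<..<1}. (1 - z * s) powr (- a) * g s))" by (rule sums_unique2[rotated])
  then show ?thesis unfolding g_def by (simp only: mult_ac)
qed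

text \<open>For \<open>z < 0\<close> Pfaff's transformation leads back to an argument
  \<open>w\<close> in the unit disc. On the level of Euler's integral it is the reflection
  \<open>s \<mapsto> 1 - s\<close>, because
  \<open>1 - w * (1 - s) = (1 - z * s) / (1 - z)\<close>.\<close>

lemma gauss_2F1_Euler:
  fixes a b c z :: real
  assumes b: "0 < b" "b < c" and z: "z < 1"
  shows "gauss_2F1 (of_real a) (of_real b) (of_real c) (of_real z) = of_real (1 / Beta b (c - b) *
    (LBINT s:{0<..<1}. s powr (b - 1) * (1 - s) powr (c - b - 1) * (1 - z * s) powr (- a)))"
proof (cases "z \<ge> 0")
  case True
  then show ?thesis
    using gauss_2F1_Euler_disc[OF b, of z a] z b by (simp add: gauss_2F1_eq_hyp_series)
next
  case False
  define w where "w = z / (z - 1)"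
  have w: "\<bar>w\<bar> < 1" using False by (simp add: w_def abs_if field_simps)
  define F where "F s = s powr (c - b - 1) * (1 - s) powr (b - 1) * (1 - w * s) powr (- a)" for s
  have im: "(\<lambda>s::real. 1 - s) ` {0<..<1} = {0<..<1}"
  proof (intro equalityI subsetI)
    fix s :: real assume "s \<in> {0<..<1}"
    then show "s \<in> (\<lambda>s. 1 - s) ` {0<..<1}" by (intro image_eqI[of _ _ "1 - s"]) auto
  qed auto
  have d: "((\<lambda>s. 1 - s) has_real_derivative - 1) (at s within {0<..<1})" for s :: real
    by (auto intro!: derivative_eq_intros)
  have inj: "inj_on (\<lambda>s. 1 - s) {0<..<1::real}" by (auto simp: inj_on_def)
  have m: "set_borel_measurable lborel {0<..<1} F" "set_borel_measurable lborel {0<..<1} (\<lambda>s. \<bar>- 1\<bar> * F (1 - s))"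
    unfolding set_borel_measurable_def F_def by measurable
  have "(LBINT s:{0<..<1}. F s) = (LBINT s:{0<..<1}. \<bar>- 1\<bar> * F (1 - s))"
    using lborel_set_integral_change_of_variables(2)[OF _ _ m(2) d inj] m(1) im by simp
  also have "\<dots> = (LBINT s:{0<..<1}. (1 - z) powr a * (s powr (b - 1) * (1 - s) powr (c - b - 1) * (1 - z * s) powr (- a)))"
  proof (rule set_lebesgue_integral_cong, simp, intro allI impI)
    fix s :: real assume s: "s \<in> {0<..<1}"
    have "z * s \<le> 0" using s False by (simp add: mult_nonpos_nonneg)
    then have "1 - z * s > 0" by simp
    moreover have "1 - w * (1 - s) = (1 - z * s) / (1 - z)" using False by (simp add: w_def field_simps)
    ultimately have "(1 - w * (1 - s)) powr (- a) = (1 - z) powr a * (1 - z * s) powr (- a)"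
      using False by (simp add: powr_divide powr_minus_divide)
    then show "\<bar>- 1\<bar> * F (1 - s) = (1 - z) powr a * (s powr (b - 1) * (1 - s) powr (c - b - 1) * (1 - z * s) powr (- a))"
      by (simp add: F_def mult_ac)
  qed
  also have "\<dots> = (1 - z) powr a * (LBINT s:{0<..<1}. s powr (b - 1) * (1 - s) powr (c - b - 1) * (1 - z * s) powr (- a))"
    by (rule set_integral_mult_right)
  finally have I: "(LBINT s:{0<..<1}. F s)
      = (1 - z) powr a * (LBINT s:{0<..<1}. s powr (b - 1) * (1 - s) powr (c - b - 1) * (1 - z * s) powr (- a))" .
  have "gauss_2F1 (of_real a) (of_real b) (of_real c) (of_real z)
      = (1 - of_real z) powr (- of_real a) * hyp_series (of_real a) (of_real c - of_real b) (of_real c) (of_real z / (of_real z - 1))"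
    by (rule gauss_2F1_pfaff) (use b False in auto)
  also have "(1 - of_real z) powr (- of_real a) = complex_of_real ((1 - z) powr (- a))"
    using powr_of_real[of "1 - z" "- a"] False by simp
  also have "hyp_series (of_real a) (of_real c - of_real b) (of_real c) (of_real z / (of_real z - 1))
      = of_real (1 / Beta (c - b) b * (LBINT s:{0<..<1}. F s))"
    using gauss_2F1_Euler_disc[of "c - b" c w a] b w by (simp add: w_def F_def)
  finally show ?thesis
    unfolding I using False by (simp add: Beta_commute powr_minus_divide)
qed

subsection \<open>Convolution and Moebius substitutions\<close>

text \<open>The substitution \<open>s = t (x - u) / (x (t - u))\<close> maps \<open>x, 0, t\<close> to \<open>0, 1, \<infinity>\<close>.\<close>

lemma moebius_integral_above:
  fixes a b x y t :: real
  assumes x: "0 < x" "x < t" and y: "y > 0" and b: "0 < b" "b < 1 / 2"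
  shows "(LBINT u:{0<..<x}. u powr (- b - 1 / 2) * (x - u) powr (b - 1) * ((t - u) powr (a - 1 / 2) * (y + (t - u)) powr (- a)))
    = t powr (- b) * x powr (- 1 / 2) * (t - x) powr (a + b - 1 / 2) * (y - x + t) powr (- a) *
      (LBINT s:{0<..<1}. s powr (b - 1) * (1 - s) powr (1 / 2 - b - 1) * (1 - x * y / (t * (y - x + t)) * s) powr (- a))"
proof -
  \<comment> \<open>The substitution sends the fourth branch point \<open>u = y + t\<close> to
    \<open>1 / v\<close>; this determines the hypergeometric argument.\<close>
  define v where "v = x * y / (t * (y - x + t))"
  define F where "F s = s powr (b - 1) * (1 - s) powr (1 / 2 - b - 1) * (1 - v * s) powr (- a)" for s
  define g where "g u = t * (x - u) / (x * (t - u))" for u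
  define g' where "g' u = - (t * (t - x) / (x * (t - u)\<^sup>2))" for u
  define E where "E u = u powr (- b - 1 / 2) * (x - u) powr (b - 1) * ((t - u) powr (a - 1 / 2) * (y + (t - u)) powr (- a))" for u
  have t: "t > 0" using x by simp
  have im: "g ` {0<..<x} = {0<..<1}"
  proof (intro equalityI subsetI)
    fix s assume "s \<in> g ` {0<..<x}"
    then obtain u where u: "0 < u" "u < x" "s = g u" by auto
    have "1 - g u = u * (t - x) / (x * (t - u))" using u x t by (simp add: g_def field_simps)
    moreover have "g u > 0" "u * (t - x) / (x * (t - u)) > 0" using u x t by (auto simp: g_def)
    ultimately show "s \<in> {0<..<1}" using u by auto
  next
    fix s :: real assume s: "s \<in> {0<..<1}"
    \<comment> \<open>The inverse Moebius map.\<close>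
    define u where "u = t * x * (1 - s) / (t - s * x)"
    have "s * x < x" using s x by simp
    then have d: "t - s * x > 0" using x by linarith
    have "u > 0" using d s x t by (simp add: u_def)
    have xu: "x - u = x * s * (t - x) / (t - s * x)" and tu: "t - u = t * (t - x) / (t - s * x)"
      using d by (simp_all add: u_def field_simps)
    have "x - u > 0" unfolding xu using d s x by simp
    moreover have "t * (x * s * W / D) / (x * (t * W / D)) = s" if "D > 0" "W > 0" for D W
      using that x t by (simp add: field_simps)
    then have "g u = s" unfolding g_def xu tu using d x by simp
    ultimately show "s \<in> g ` {0<..<x}" using \<open>u > 0\<close> by force
  qed
  have inj: "inj_on g {0<..<x}"
  proof (rule inj_onI)
    fix r s assume rs: "r \<in> {0<..<x}" "s \<in> {0<..<x}" "g r = g s"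
    then have "t * (x - r) * (x * (t - s)) = t * (x - s) * (x * (t - r))"
      using x t by (simp add: g_def frac_eq_eq)
    then have "t * x * ((t - x) * (r - s)) = 0" by (simp add: algebra_simps)
    then show "r = s" using x t by simp
  qed
  have der: "(g has_real_derivative g' u) (at u within {0<..<x})" if "u \<in> {0<..<x}" for u
    unfolding g_def g'_def using that x t
    by (auto intro!: derivative_eq_intros simp: power2_eq_square divide_simps) (simp_all add: algebra_simps)
  have m: "set_borel_measurable lborel {0<..<1} F" "set_borel_measurable lborel {0<..<x} (\<lambda>u. \<bar>g' u\<bar> * F (g u))"
    unfolding set_borel_measurable_def F_def g_def g'_def by measurable
  have pw: "t powr (- b) * x powr (- 1 / 2) * (t - x) powr (a + b - 1 / 2) * (y - x + t) powr (- a) * (\<bar>g' u\<bar> * F (g u)) = E u"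
    if "u \<in> {0<..<x}" for u
  proof -
    have u: "u > 0" "x - u > 0" "t - u > 0" "t - x > 0" "y + (t - u) > 0" "y - x + t > 0" using that x y by auto
    have e1: "1 - g u = u * (t - x) / (x * (t - u))" using u x t by (simp add: g_def field_simps)
    have e2: "1 - v * g u = (t - x) * (y + (t - u)) / ((y - x + t) * (t - u))"
      using u x t by (simp add: g_def v_def divide_simps) (simp add: algebra_simps)
    have e3: "\<bar>g' u\<bar> = t * (t - x) / (x * (t - u) * (t - u))" using u x t by (simp add: g'_def power2_eq_square abs_mult)
    have "F (g u) = (t * (x - u) / (x * (t - u))) powr (b - 1) * (u * (t - x) / (x * (t - u))) powr (1 / 2 - b - 1)
        * ((t - x) * (y + (t - u)) / ((y - x + t) * (t - u))) powr (- a)"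
      unfolding F_def e1 e2 by (simp add: g_def)
    \<comment> \<open>All bases are positive, so taking logarithms reduces the identity between
      products of powers to linear algebra in the exponents.\<close>
    then have "ln (t powr (- b) * x powr (- 1 / 2) * (t - x) powr (a + b - 1 / 2) * (y - x + t) powr (- a) * (\<bar>g' u\<bar> * F (g u))) = ln (E u)"
      unfolding e3 E_def using u x t by (simp add: ln_mult ln_div ln_powr) (simp add: algebra_simps)
    moreover have "F (g u) > 0"
      unfolding F_def e1 e2 using u x t by (auto simp: g_def intro!: mult_pos_pos)
    ultimately show ?thesis
      using u x t e3 by (subst (asm) ln_inj_iff) (auto simp: E_def intro!: mult_pos_pos divide_pos_pos)
  qed
  have "(LBINT s:{0<..<1}. F s) = (LBINT u:{0<..<x}. \<bar>g' u\<bar> * F (g u))"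
    using lborel_set_integral_change_of_variables(2)[OF _ _ m(2) der inj] m(1) im by simp
  then have "t powr (- b) * x powr (- 1 / 2) * (t - x) powr (a + b - 1 / 2) * (y - x + t) powr (- a) * (LBINT s:{0<..<1}. F s)
      = (LBINT u:{0<..<x}. t powr (- b) * x powr (- 1 / 2) * (t - x) powr (a + b - 1 / 2) * (y - x + t) powr (- a) * (\<bar>g' u\<bar> * F (g u)))"
    by (simp only: set_integral_mult_right)
  also have "\<dots> = (LBINT u:{0<..<x}. E u)"
    by (rule set_lebesgue_integral_cong) (use pw in auto)
  finally show ?thesis unfolding E_def F_def v_def by simp
qed

text \<open>The substitution \<open>s = u (x - t) / (t (x - u))\<close> maps \<open>0, t, x\<close> to \<open>0, 1, \<infinity>\<close>.\<close>

lemma moebius_integral_below: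
  fixes a b x y t :: real
  assumes t: "0 < t" "t < x" and y: "y > 0"
  shows "(LBINT u:{0<..<t}. u powr (- b - 1 / 2) * (x - u) powr (b - 1) * ((t - u) powr (a - 1 / 2) * (y + (t - u)) powr (- a)))
    = t powr (a - b) * x powr (- 1 / 2) * (x - t) powr (b - 1 / 2) * (y + t) powr (- a) *
      (LBINT s:{0<..<1}. s powr (1 / 2 - b - 1) * (1 - s) powr (1 + a - b - (1 / 2 - b) - 1)
         * (1 - t * (x - y - t) / ((x - t) * (y + t)) * s) powr (- a))"
proof -
  \<comment> \<open>As before, \<open>1 - z * g u\<close> vanishes at the fourth branch point
    \<open>u = y + t\<close>.\<close>
  define z where "z = t * (x - y - t) / ((x - t) * (y + t))"
  define F where "F s = s powr (1 / 2 - b - 1) * (1 - s) powr (1 + a - b - (1 / 2 - b) - 1) * (1 - z * s) powr (- a)" for s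
  define g where "g u = u * (x - t) / (t * (x - u))" for u
  define g' where "g' u = x * (x - t) / (t * (x - u)\<^sup>2)" for u
  define E where "E u = u powr (- b - 1 / 2) * (x - u) powr (b - 1) * ((t - u) powr (a - 1 / 2) * (y + (t - u)) powr (- a))" for u
  have x: "x > 0" using t by simp
  have im: "g ` {0<..<t} = {0<..<1}"
  proof (intro equalityI subsetI)
    fix s assume "s \<in> g ` {0<..<t}"
    then obtain u where u: "0 < u" "u < t" "s = g u" by auto
    have "1 - g u = x * (t - u) / (t * (x - u))" using u x t by (simp add: g_def field_simps)
    moreover have "g u > 0" "x * (t - u) / (t * (x - u)) > 0" using u x t by (auto simp: g_def)
    ultimately show "s \<in> {0<..<1}" using u by auto
  next
    fix s :: real assume s: "s \<in> {0<..<1}"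
    define u where "u = s * t * x / (x - t + s * t)"
    have d: "x - t + s * t > 0" using s t by (simp add: add_pos_pos)
    have "u > 0" using d s x t by (simp add: u_def)
    have xu: "x - u = x * (x - t) / (x - t + s * t)" and tu: "t - u = t * (x - t) * (1 - s) / (x - t + s * t)"
      using d by (simp_all add: u_def field_simps)
    have "t - u > 0" unfolding tu using d s t by simp
    moreover have "s * t * x / D * W / (t * (x * W / D)) = s" if "D > 0" "W > 0" for D W
      using that x t by (simp add: field_simps)
    then have "g u = s" unfolding g_def xu unfolding u_def using d t by simp
    ultimately show "s \<in> g ` {0<..<t}" using \<open>u > 0\<close> by force
  qed
  have inj: "inj_on g {0<..<t}"
  proof (rule inj_onI)
    fix r s assume rs: "r \<in> {0<..<t}" "s \<in> {0<..<t}" "g r = g s"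
    then have "r * (x - t) * (t * (x - s)) = s * (x - t) * (t * (x - r))"
      using x t by (simp add: g_def frac_eq_eq)
    then have "(x - t) * t * (x * (r - s)) = 0" by (simp add: algebra_simps)
    then show "r = s" using x t by simp
  qed
  have der: "(g has_real_derivative g' u) (at u within {0<..<t})" if "u \<in> {0<..<t}" for u
    unfolding g_def g'_def using that x t
    by (auto intro!: derivative_eq_intros simp: power2_eq_square divide_simps) (simp_all add: algebra_simps)
  have m: "set_borel_measurable lborel {0<..<1} F" "set_borel_measurable lborel {0<..<t} (\<lambda>u. \<bar>g' u\<bar> * F (g u))"
    unfolding set_borel_measurable_def F_def g_def g'_def by measurable
  have pw: "t powr (a - b) * x powr (- 1 / 2) * (x - t) powr (b - 1 / 2) * (y + t) powr (- a) * (\<bar>g' u\<bar> * F (g u)) = E u"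
    if "u \<in> {0<..<t}" for u
  proof -
    have u: "u > 0" "x - u > 0" "t - u > 0" "x - t > 0" "y + (t - u) > 0" "y + t > 0" using that t y by auto
    have e1: "1 - g u = x * (t - u) / (t * (x - u))" using u x t by (simp add: g_def field_simps)
    have e2: "1 - z * g u = x * (y + (t - u)) / ((y + t) * (x - u))"
      using u x t by (simp add: g_def z_def divide_simps) (simp add: algebra_simps)
    have e3: "\<bar>g' u\<bar> = x * (x - t) / (t * (x - u) * (x - u))" using u x t by (simp add: g'_def power2_eq_square abs_mult)
    have "F (g u) = (u * (x - t) / (t * (x - u))) powr (1 / 2 - b - 1) * (x * (t - u) / (t * (x - u))) powr (1 + a - b - (1 / 2 - b) - 1)
        * (x * (y + (t - u)) / ((y + t) * (x - u))) powr (- a)"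
      unfolding F_def e1 e2 by (simp add: g_def)
    then have "ln (t powr (a - b) * x powr (- 1 / 2) * (x - t) powr (b - 1 / 2) * (y + t) powr (- a) * (\<bar>g' u\<bar> * F (g u))) = ln (E u)"
      unfolding e3 E_def using u x t by (simp add: ln_mult ln_div ln_powr) (simp add: algebra_simps)
    moreover have "F (g u) > 0"
      unfolding F_def e1 e2 using u x t by (auto simp: g_def intro!: mult_pos_pos)
    ultimately show ?thesis
      using u x t e3 by (subst (asm) ln_inj_iff) (auto simp: E_def intro!: mult_pos_pos divide_pos_pos)
  qed
  have "(LBINT s:{0<..<1}. F s) = (LBINT u:{0<..<t}. \<bar>g' u\<bar> * F (g u))"
    using lborel_set_integral_change_of_variables(2)[OF _ _ m(2) der inj] m(1) im by simp
  then have "t powr (a - b) * x powr (- 1 / 2) * (x - t) powr (b - 1 / 2) * (y + t) powr (- a) * (LBINT s:{0<..<1}. F s)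
      = (LBINT u:{0<..<t}. t powr (a - b) * x powr (- 1 / 2) * (x - t) powr (b - 1 / 2) * (y + t) powr (- a) * (\<bar>g' u\<bar> * F (g u)))"
    by (simp only: set_integral_mult_right)
  also have "\<dots> = (LBINT u:{0<..<t}. E u)"
    by (rule set_lebesgue_integral_cong) (use pw in auto)
  finally show ?thesis unfolding E_def F_def z_def by simp
qed

section \<open>The product of the two Laplace transforms\<close>

lemma integral_convolution_lborel:
  fixes H G :: "real \<Rightarrow> complex"
  assumes H: "integrable lborel H" and G: "integrable lborel G"
  shows "integrable lborel (\<lambda>t. LBINT u. H u * G (t - u))"
    and "(LBINT t. (LBINT u. H u * G (t - u))) = (LBINT u. H u) * (LBINT s. G s)"
proof -
  have [measurable]: "H \<in> borel_measurable borel" "G \<in> borel_measurable borel" using H G by auto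
  have shift: "integrable lborel (\<lambda>t. f (t - u))" "(LBINT t. f (t - u)) = (LBINT s. f s)"
    if "integrable lborel f" for f :: "real \<Rightarrow> 'b :: {banach, second_countable_topology}" and u
    using that lborel_integrable_real_affine_iff[of 1 f "- u"] lborel_integral_real_affine[of 1 f "- u"] by simp_all
  have int: "integrable (lborel \<Otimes>\<^sub>M lborel) (\<lambda>(u, t). H u * G (t - u))"
  proof (rule lborel_pair.Fubini_integrable)
    show "(\<lambda>(u, t). H u * G (t - u)) \<in> borel_measurable (lborel \<Otimes>\<^sub>M lborel)" by measurable
    have "(LBINT t. norm (H u * G (t - u))) = norm (H u) * (LBINT s. norm (G s))" for u
      using shift(2)[of "\<lambda>s. norm (G s)" u] G by (simp add: norm_mult)
    then show "integrable lborel (\<lambda>u. LBINT t. norm (case (u, t) of (u, t) \<Rightarrow> H u * G (t - u)))"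
      using H by simp
    show "AE u in lborel. integrable lborel (\<lambda>t. case (u, t) of (u, t) \<Rightarrow> H u * G (t - u))"
      using shift(1)[OF G] by simp
  qed
  then have int': "integrable (lborel \<Otimes>\<^sub>M lborel) (\<lambda>(t, u). H u * G (t - u))"
    using lborel_pair.integrable_product_swap_iff[of "\<lambda>(u, t). H u * G (t - u)"] by simp
  show "integrable lborel (\<lambda>t. LBINT u. H u * G (t - u))"
    using lborel_pair.integrable_fst'[OF int'] by simp
  have "(LBINT t. (LBINT u. H u * G (t - u))) = (LBINT u. (LBINT t. H u * G (t - u)))"
    using lborel_pair.Fubini_integral[OF int] by simp
  also have "\<dots> = (LBINT u. H u * (LBINT s. G s))"
    using shift(2)[OF G] by simp
  finally show "(LBINT t. (LBINT u. H u * G (t - u))) = (LBINT u. H u) * (LBINT s. G s)" by simp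
qed

lemma set_integrable_Beta_scaled:
  fixes a b x :: real
  assumes "a > 0" "b > 0" "x > 0"
  shows "set_integrable lborel {0<..<x} (\<lambda>u. u powr (a - 1) * (x - u) powr (b - 1))"
proof -
  define f where "f u = indicat_real {0<..<x} u * (u powr (a - 1) * (x - u) powr (b - 1))" for u
  have "f (0 + x * s) = x powr (a - 1) * x powr (b - 1) * (indicat_real {0<..<1} s * (s powr (a - 1) * (1 - s) powr (b - 1)))" for s
  proof -
    have "x - x * s = x * (1 - s)" by (simp add: algebra_simps)
    moreover have "x * s \<in> {0<..<x} \<longleftrightarrow> s \<in> {0<..<1}" using assms(3) by (simp add: zero_less_mult_iff)
    ultimately show ?thesis using assms(3) by (auto simp: f_def indicator_def powr_mult)
  qed
  then have "integrable lborel (\<lambda>s. f (0 + x * s))"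
    using Beta_lborel(1)[OF assms(1,2)] by (simp add: set_integrable_def)
  then show ?thesis
    using lborel_integrable_real_affine_iff[of x f 0] assms(3) by (simp add: set_integrable_def f_def[abs_def])
qed

text \<open>Euler's integral under \<open>u = x * (1 - s)\<close>. The factor
  \<open>exp (- p * x)\<close> reverses the direction, turning \<open>exp (p * x * s)\<close> into
  the Laplace kernel \<open>exp (- p * u)\<close>.\<close>

lemma kummer_Phi_laplace:
  fixes b x :: real and p :: complex
  assumes b: "0 < b" "b < 1 / 2" and x: "x > 0"
  shows "exp (- p * of_real x) * kummer_Phi (of_real b) (1 / 2) (p * of_real x) = of_real (sqrt x / Beta b (1 / 2 - b)) *
    (LBINT u:{0<..<x}. exp (- p * of_real u) * of_real (u powr (- b - 1 / 2) * (x - u) powr (b - 1)))"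
proof -
  define f where "f u = indicat_real {0<..<x} u *\<^sub>R (exp (- p * of_real u) * complex_of_real (u powr (- b - 1 / 2) * (x - u) powr (b - 1)))" for u
  define k where "k s = exp (p * of_real x * of_real s) * complex_of_real (s powr (b - 1) * (1 - s) powr (1 / 2 - b - 1))" for s
  have "f (x + (- x) * s) = exp (- p * of_real x) * of_real (x powr (- 3 / 2)) * (indicat_real {0<..<1} s *\<^sub>R k s)" for s
  proof (cases "s \<in> {0<..<1}")
    case True
    then have "x + (- x) * s \<in> {0<..<x}" using x by (simp add: algebra_simps)
    moreover have "x + (- x) * s = x * (1 - s)" "x - (x + (- x) * s) = x * s" by (simp_all add: algebra_simps)
    moreover have "(x * (1 - s)) powr (- b - 1 / 2) * (x * s) powr (b - 1)
        = x powr (- 3 / 2) * (s powr (b - 1) * (1 - s) powr (1 / 2 - b - 1))"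
    proof -
      have "x powr (- b - 1 / 2) * x powr (b - 1) = x powr (- 3 / 2)" by (simp flip: powr_add)
      moreover have e: "1 / 2 - b - 1 = - b - 1 / 2" by simp
      moreover have "(x * (1 - s)) powr (- b - 1 / 2) * (x * s) powr (b - 1)
          = (x powr (- b - 1 / 2) * x powr (b - 1)) * (s powr (b - 1) * (1 - s) powr (- b - 1 / 2))"
        using True x by (simp add: powr_mult)
      ultimately show ?thesis by (simp only:)
    qed
    moreover have "- p * of_real (x * (1 - s)) = - p * of_real x + p * of_real x * of_real s" by (simp add: algebra_simps)
    ultimately show ?thesis using True
      unfolding f_def k_def by (simp only: exp_add indicator_simps scaleR_one of_real_mult mult_ac)
  next
    case False
    have "x + (- x) * s \<in> {0<..<x} \<longleftrightarrow> x * s < x * 1 \<and> 0 < x * s" by auto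
    also have "\<dots> \<longleftrightarrow> s \<in> {0<..<1}" using x by (auto simp: zero_less_mult_iff)
    finally have "x + (- x) * s \<notin> {0<..<x}" using False by blast
    then have "indicat_real {0<..<x} (x + (- x) * s) = 0" "indicat_real {0<..<1} s = 0"
      using False by (simp_all only: indicator_eq_0_iff not_False_eq_True)
    then show ?thesis unfolding f_def by (simp only: scaleR_zero_left mult_zero_right)
  qed
  then have "(LBINT u. f u) = \<bar>- x\<bar> *\<^sub>R (LBINT s. exp (- p * of_real x) * of_real (x powr (- 3 / 2)) * (indicat_real {0<..<1} s *\<^sub>R k s))"
    using lborel_integral_real_affine[of "- x" f x] x by simp
  also have "\<dots> = of_real x * (exp (- p * of_real x) * of_real (x powr (- 3 / 2)) * (LBINT s:{0<..<1}. k s))"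
    using x unfolding set_lebesgue_integral_def by (simp only: integral_mult_right_zero) (simp add: scaleR_conv_of_real)
  also have "\<dots> = exp (- p * of_real x) * of_real (x * x powr (- 3 / 2)) * (LBINT s:{0<..<1}. k s)" by simp
  also have "x * x powr (- 3 / 2) = 1 / sqrt x"
  proof -
    have "x * x powr (- 3 / 2) = x powr (1 + (- 3 / 2))" using x by (simp only: powr_add powr_one)
    then show ?thesis using x by (simp add: powr_minus_divide powr_half_sqrt)
  qed
  finally have I: "(LBINT u. f u) = exp (- p * of_real x) * of_real (1 / sqrt x) * (LBINT s:{0<..<1}. k s)" .
  have "kummer_Phi (of_real b) (1 / 2) (p * of_real x) = of_real (1 / Beta b (1 / 2 - b)) * (LBINT s:{0<..<1}. k s)"
    using kummer_Phi_Euler[of b "1 / 2" "p * of_real x"] b by (simp add: k_def)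
  then have K: "exp (- p * of_real x) * kummer_Phi (of_real b) (1 / 2) (p * of_real x)
      = of_real (sqrt x / Beta b (1 / 2 - b)) * (LBINT u. f u)"
    unfolding I using x by simp
  show ?thesis unfolding K f_def set_lebesgue_integral_def ..
qed

lemma of_real_powr_of_real: "0 \<le> s \<Longrightarrow> complex_of_real s powr of_real r = of_real (s powr r)"
  by (simp add: powr_of_real)

text \<open>This factorisation shows that the argument stays off the cut, and it converts growth of
  the hypergeometric factor into powers of \<open>x - t\<close> and \<open>y + t\<close>.\<close>

lemma below_argument:
  fixes x y t :: real
  assumes "0 < t" "t < x" "y > 0"
  shows "1 - t * (x - y - t) / ((x - t) * (y + t)) = x * y / ((x - t) * (y + t))"
proof -
  have "(x - t) * (y + t) \<noteq> 0" using assms by simp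
  then have "1 - t * (x - y - t) / ((x - t) * (y + t)) = ((x - t) * (y + t) - t * (x - y - t)) / ((x - t) * (y + t))"
    by (simp add: diff_divide_distrib)
  also have "(x - t) * (y + t) - t * (x - y - t) = x * y" by (simp add: algebra_simps)
  finally show ?thesis .
qed

lemma above_argument:
  fixes x y t :: real
  assumes "0 \<le> x" "x < t" "y > 0"
  shows "1 - x * y / (t * (y - x + t)) = (t - x) * (t + y) / (t * (y - x + t))"
proof -
  have "t * (y - x + t) \<noteq> 0" using assms by simp
  then have "1 - x * y / (t * (y - x + t)) = (t * (y - x + t) - x * y) / (t * (y - x + t))"
    by (simp add: diff_divide_distrib)
  also have "t * (y - x + t) - x * y = (t - x) * (t + y)" by (simp add: algebra_simps)
  finally show ?thesis .
qed

lemma below_argument_less_1: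
  fixes x y t :: real
  assumes "0 < t" "t < x" "y > 0"
  shows "t * (x - y - t) / ((x - t) * (y + t)) < 1"
proof -
  have "1 - t * (x - y - t) / ((x - t) * (y + t)) > 0"
    using assms by (subst below_argument) auto
  then show ?thesis by simp
qed

lemma above_argument_less_1:
  fixes x y t :: real
  assumes "0 \<le> x" "x < t" "y > 0"
  shows "x * y / (t * (y - x + t)) < 1"
proof -
  have "1 - x * y / (t * (y - x + t)) > 0"
    using assms by (subst above_argument) (auto intro!: divide_pos_pos mult_pos_pos)
  then show ?thesis by simp
qed

text \<open>The right-hand side is the convolution of the two densities at a point
  \<open>t < x\<close>, where the constraint \<open>u < t\<close> is the active one. The Moebius
  substitution makes it Euler's integral.\<close>

lemma integrand_below_real:
  fixes a b x y t :: real
  assumes t: "0 < t" "t < x" and y: "y > 0" and ab: "a > 0" "b < 1 / 2"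
  shows "of_real (Beta (1 / 2 - b) (a + 1 / 2) / sqrt x) * integrand_below (of_real (- 2 * b)) (of_real (- 2 * a)) p x y t
    = exp (- p * of_real t) * of_real (LBINT u:{0<..<t}. u powr (- b - 1 / 2) * (x - u) powr (b - 1) * ((t - u) powr (a - 1 / 2) * (y + (t - u)) powr (- a)))"
proof -
  have B: "Beta (1 / 2 - b) (a + 1 / 2) > 0"
    unfolding Beta_def using ab by (auto intro!: divide_pos_pos mult_pos_pos Gamma_real_pos)
  define z where "z = t * (x - y - t) / ((x - t) * (y + t))"
  have z: "z < 1" unfolding z_def by (rule below_argument_less_1[OF t y])
  have c: "(of_real (- 2 * b) - of_real (- 2 * a)) / 2 = complex_of_real (a - b)" "- (1 + of_real (- 2 * b)) / 2 = complex_of_real (b - 1 / 2)"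
    "of_real (- 2 * a) / 2 = complex_of_real (- a)" "- of_real (- 2 * a) / 2 = complex_of_real a"
    "(1 + of_real (- 2 * b)) / 2 = complex_of_real (1 / 2 - b)" "1 + complex_of_real (a - b) = complex_of_real (1 + a - b)"
    by (simp_all add: field_simps)
  have "1 + a - b - (1 / 2 - b) = a + 1 / 2" by simp
  then have B': "Beta (1 / 2 - b) (a + 1 / 2) = Beta (1 / 2 - b) (1 + a - b - (1 / 2 - b))" by (simp only:)
  have E: "gauss_2F1 (of_real a) (of_real (1 / 2 - b)) (of_real (1 + a - b)) (of_real z) = of_real (1 / Beta (1 / 2 - b) (a + 1 / 2) *
    (LBINT s:{0<..<1}. s powr (1 / 2 - b - 1) * (1 - s) powr (1 + a - b - (1 / 2 - b) - 1) * (1 - z * s) powr (- a)))"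
    unfolding B' by (rule gauss_2F1_Euler) (use ab z in auto)
  have xh: "x powr (- 1 / 2) = 1 / sqrt x" using t by (simp add: powr_minus_divide powr_half_sqrt)
  have q: "complex_of_real t powr of_real (a - b) = of_real (t powr (a - b))"
    "complex_of_real (x - t) powr of_real (b - 1 / 2) = of_real ((x - t) powr (b - 1 / 2))"
    "complex_of_real (y + t) powr of_real (- a) = of_real ((y + t) powr (- a))"
    by (rule of_real_powr_of_real, use t y in simp)+
  show ?thesis
    unfolding integrand_below_def c z_def[symmetric] E q moebius_integral_below[OF t y, folded z_def] xh
    using B by simp
qed

lemma integrand_above_real:
  fixes a b x y t :: real
  assumes t: "0 < x" "x < t" and y: "y > 0" and b: "0 < b" "b < 1 / 2"
  shows "of_real (Beta b (1 / 2 - b) / sqrt x) * integrand_above (of_real (- 2 * b)) (of_real (- 2 * a)) p x y t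
    = exp (- p * of_real t) * of_real (LBINT u:{0<..<x}. u powr (- b - 1 / 2) * (x - u) powr (b - 1) * ((t - u) powr (a - 1 / 2) * (y + (t - u)) powr (- a)))"
proof -
  have B: "Beta b (1 / 2 - b) > 0"
    unfolding Beta_def using b by (auto intro!: divide_pos_pos mult_pos_pos Gamma_real_pos)
  define z where "z = x * y / (t * (y - x + t))"
  have z: "z < 1" unfolding z_def by (rule above_argument_less_1) (use t y in auto)
  have c: "of_real (- 2 * b) / 2 = complex_of_real (- b)" "- (1 + of_real (- 2 * a) + of_real (- 2 * b)) / 2 = complex_of_real (a + b - 1 / 2)"
    "of_real (- 2 * a) / 2 = complex_of_real (- a)" "- of_real (- 2 * a) / 2 = complex_of_real a"
    "- of_real (- 2 * b) / 2 = complex_of_real b"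
    by (simp_all add: field_simps)
  have E: "gauss_2F1 (of_real a) (of_real b) (1 / 2) (of_real z) = of_real (1 / Beta b (1 / 2 - b) *
    (LBINT s:{0<..<1}. s powr (b - 1) * (1 - s) powr (1 / 2 - b - 1) * (1 - z * s) powr (- a)))"
    using gauss_2F1_Euler[of b "1 / 2" z a] b z by simp
  have xh: "x powr (- 1 / 2) = 1 / sqrt x" using t by (simp add: powr_minus_divide powr_half_sqrt)
  have q: "complex_of_real t powr of_real (- b) = of_real (t powr (- b))"
    "complex_of_real (t - x) powr of_real (a + b - 1 / 2) = of_real ((t - x) powr (a + b - 1 / 2))"
    "complex_of_real (y - x + t) powr of_real (- a) = of_real ((y - x + t) powr (- a))"
    by (rule of_real_powr_of_real, use t y in simp)+
  show ?thesis
    unfolding integrand_above_def c z_def[symmetric] E q moebius_integral_above[OF t y b, folded z_def] xh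
    using B by simp
qed

text \<open>The convolution at \<open>t\<close> runs over \<open>0 < u < min x t\<close>. Splitting
  the \<open>t\<close> axis at \<open>x\<close> therefore gives the two integrals.\<close>

lemma laplace_product:
  fixes a b x y :: real and p :: complex
  assumes ab: "a > 0" "0 < b" "b < 1 / 2" and xy: "x > 0" "y > 0" and p: "Re p > 0"
  shows "(LBINT u:{0<..<x}. exp (- p * of_real u) * of_real (u powr (- b - 1 / 2) * (x - u) powr (b - 1)))
      * (LBINT s:{0<..}. exp (- p * of_real s) * of_real (s powr (a - 1 / 2) * (y + s) powr (- a)))
    = of_real (Beta (1 / 2 - b) (a + 1 / 2) / sqrt x) * (LBINT t:{0<..<x}. integrand_below (of_real (- 2 * b)) (of_real (- 2 * a)) p x y t)
      + of_real (Beta b (1 / 2 - b) / sqrt x) * (LBINT t:{x<..}. integrand_above (of_real (- 2 * b)) (of_real (- 2 * a)) p x y t)"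
proof -
  define h where "h u = u powr (- b - 1 / 2) * (x - u) powr (b - 1)" for u
  define g where "g s = s powr (a - 1 / 2) * (y + s) powr (- a)" for s
  define H where "H u = indicat_real {0<..<x} u *\<^sub>R (exp (- p * of_real u) * complex_of_real (h u))" for u
  define G where "G s = indicat_real {0<..} s *\<^sub>R (exp (- p * of_real s) * complex_of_real (g s))" for s
  have Hi: "integrable lborel H"
    unfolding H_def set_integrable_def[symmetric]
  proof (rule set_integrable_bound)
    have e: "- b - 1 / 2 = (1 / 2 - b) - 1" by simp
    show "set_integrable lborel {0<..<x} h"
      unfolding h_def[abs_def] e by (rule set_integrable_Beta_scaled) (use ab xy in auto)
    show "set_borel_measurable lborel {0<..<x} (\<lambda>u. exp (- p * of_real u) * complex_of_real (h u))"
      unfolding set_borel_measurable_def h_def by measurable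
    have "norm (exp (- p * of_real u) * complex_of_real (h u)) \<le> norm (h u)" if "u \<in> {0<..<x}" for u
      unfolding norm_mult norm_exp_times_of_real norm_of_real real_norm_def using that p by (intro mult_left_le_one_le) auto
    then show "AE u in lborel. u \<in> {0<..<x} \<longrightarrow> norm (exp (- p * of_real u) * complex_of_real (h u)) \<le> norm (h u)" by simp
  qed
  have Gi: "integrable lborel G"
    unfolding G_def set_integrable_def[symmetric]
  proof (rule set_integrable_bound)
    show "set_integrable lborel {0<..} (\<lambda>s. y powr (- a) * (s powr (a + 1 / 2 - 1) * exp (- (Re p * s))))"
      using Gamma_scaled_lborel(1)[of "a + 1 / 2" "Re p"] ab p by simp
    show "set_borel_measurable lborel {0<..} (\<lambda>s. exp (- p * of_real s) * complex_of_real (g s))"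
      unfolding set_borel_measurable_def g_def by measurable
    have "norm (exp (- p * of_real s) * complex_of_real (g s)) \<le> y powr (- a) * (s powr (a + 1 / 2 - 1) * exp (- (Re p * s)))" if "s \<in> {0<..}" for s
    proof -
      have "(y + s) powr (- a) \<le> y powr (- a)" using that xy ab by (intro powr_mono2') auto
      then have "exp (- (Re p * s)) * (s powr (a - 1 / 2) * (y + s) powr (- a)) \<le> exp (- (Re p * s)) * (s powr (a - 1 / 2) * y powr (- a))"
        by (intro mult_left_mono) auto
      moreover have "\<bar>g s\<bar> = s powr (a - 1 / 2) * (y + s) powr (- a)" by (simp add: g_def)
      moreover have "a + 1 / 2 - 1 = a - 1 / 2" by simp
      ultimately show ?thesis
        unfolding norm_mult norm_exp_times_of_real norm_of_real unfolding mult_minus_left by (simp only: mult_ac)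
    qed
    then show "AE s in lborel. s \<in> {0<..} \<longrightarrow> norm (exp (- p * of_real s) * complex_of_real (g s))
        \<le> norm (y powr (- a) * (s powr (a + 1 / 2 - 1) * exp (- (Re p * s))))" by (simp add: abs_mult)
  qed
  define T where "T t = (LBINT u. H u * G (t - u))" for t
  have Ti: "integrable lborel T" unfolding T_def by (rule integral_convolution_lborel(1)[OF Hi Gi])
  have T: "T t = exp (- p * of_real t) * of_real (LBINT u:{0<..<min x t}. h u * g (t - u))" for t
  proof -
    have "H u * G (t - u) = exp (- p * of_real t) * complex_of_real (indicat_real {0<..<min x t} u *\<^sub>R (h u * g (t - u)))" for u
    proof -
      have e: "exp (- p * of_real u) * exp (- p * of_real (t - u)) = exp (- p * of_real t)"
        by (simp add: algebra_simps flip: exp_add)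
      have i: "indicat_real {0<..<x} u * indicat_real {0<..} (t - u) = indicat_real {0<..<min x t} u"
        by (auto simp: indicator_def)
      have "H u * G (t - u) = (exp (- p * of_real u) * exp (- p * of_real (t - u)))
          * (of_real (indicat_real {0<..<x} u * indicat_real {0<..} (t - u)) * of_real (h u * g (t - u)))"
        unfolding H_def G_def scaleR_conv_of_real of_real_mult by (simp only: mult_ac)
      then show ?thesis unfolding e i by simp
    qed
    then show ?thesis
      unfolding T_def set_lebesgue_integral_def by (simp only: integral_mult_right_zero integral_complex_of_real)
  qed
  have T1: "T t = of_real (Beta (1 / 2 - b) (a + 1 / 2) / sqrt x) * integrand_below (of_real (- 2 * b)) (of_real (- 2 * a)) p x y t"
    if "t \<in> {0<..<x}" for t
    using that integrand_below_real[of t x y a b p] xy ab unfolding T h_def g_def by (simp add: min_def)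
  have T2: "T t = of_real (Beta b (1 / 2 - b) / sqrt x) * integrand_above (of_real (- 2 * b)) (of_real (- 2 * a)) p x y t"
    if "t \<in> {x<..}" for t
    using that integrand_above_real[of x t y b a p] xy ab unfolding T h_def g_def by (simp add: min_def)
  have T0: "T t = 0" if "t \<le> 0" for t
  proof -
    have "{0<..<min x t} = {}" using that by auto
    then show ?thesis unfolding T by (simp only:) (simp add: set_lebesgue_integral_def)
  qed
  have si: "set_integrable lborel A T" if "A \<in> sets borel" for A
    using Ti that unfolding set_integrable_def by (intro integrable_mult_indicator) auto
  have "(LBINT t. T t) = (LBINT t:{0<..<x} \<union> {x<..}. T t)"
    unfolding set_lebesgue_integral_def
  proof (rule integral_cong_AE)
    show "T \<in> borel_measurable lborel" using Ti by auto
    show "(\<lambda>t. indicat_real ({0<..<x} \<union> {x<..}) t *\<^sub>R T t) \<in> borel_measurable lborel"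
      using si[of "{0<..<x} \<union> {x<..}"] by (simp add: set_integrable_def)
    \<comment> \<open>The convolution vanishes for \<open>t \<le> 0\<close>, and
      \<open>t = x\<close> is a null set.\<close>
    show "AE t in lborel. T t = indicat_real ({0<..<x} \<union> {x<..}) t *\<^sub>R T t"
      using AE_lborel_singleton[of x] by eventually_elim (use T0 in \<open>auto simp: indicator_def not_less\<close>)
  qed
  also have "\<dots> = (LBINT t:{0<..<x}. T t) + (LBINT t:{x<..}. T t)"
    by (rule set_integral_Un) (use si in auto)
  also have "(LBINT t:{0<..<x}. T t) = (LBINT t:{0<..<x}. of_real (Beta (1 / 2 - b) (a + 1 / 2) / sqrt x) * integrand_below (of_real (- 2 * b)) (of_real (- 2 * a)) p x y t)"
    by (rule set_lebesgue_integral_cong) (use T1 in auto)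
  also have "(LBINT t:{x<..}. T t) = (LBINT t:{x<..}. of_real (Beta b (1 / 2 - b) / sqrt x) * integrand_above (of_real (- 2 * b)) (of_real (- 2 * a)) p x y t)"
    by (rule set_lebesgue_integral_cong) (use T2 in auto)
  finally have "(LBINT t. T t) = of_real (Beta (1 / 2 - b) (a + 1 / 2) / sqrt x) * (LBINT t:{0<..<x}. integrand_below (of_real (- 2 * b)) (of_real (- 2 * a)) p x y t)
      + of_real (Beta b (1 / 2 - b) / sqrt x) * (LBINT t:{x<..}. integrand_above (of_real (- 2 * b)) (of_real (- 2 * a)) p x y t)"
    by (simp only: set_integral_mult_right)
  moreover have "(LBINT t. T t) = (LBINT u. H u) * (LBINT s. G s)"
    unfolding T_def by (rule integral_convolution_lborel(2)[OF Hi Gi])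
  ultimately show ?thesis
    unfolding H_def G_def h_def g_def set_lebesgue_integral_def by simp
qed

lemma sqrt_argument_square:
  assumes "x \<ge> 0" and "p \<noteq> 0"
  shows "(2 powr (1 / 2) * of_real x powr (1 / 2) * p powr (1 / 2))\<^sup>2 = 2 * of_real x * (p :: complex)"
proof -
  have sq: "(w powr (1 / 2))\<^sup>2 = w" for w :: complex
    by (cases "w = 0") (simp_all add: power2_eq_square flip: powr_add)
  show ?thesis by (simp only: power_mult_distrib sq)
qed

text \<open>The terms odd in \<open>z\<close> cancel. Only this even part leads to the single Kummer
  function whose Laplace density lives on \<open>(0, x)\<close>, which is why the formula adds the
  values at \<open>z\<close> and \<open>- z\<close>.\<close>

lemma parabolic_cylinder_D_even_part:
  "parabolic_cylinder_D \<nu> (- z) + parabolic_cylinder_D \<nu> z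
    = 2 * 2 powr (\<nu> / 2) * exp (- (z\<^sup>2) / 4) * (Gamma (1 / 2) * rGamma ((1 - \<nu>) / 2) * kummer_Phi (- \<nu> / 2) (1 / 2) (z\<^sup>2 / 2))"
  by (simp add: parabolic_cylinder_D_def algebra_simps)

text \<open>After the convolution only constants remain. The duplication formula at \<open>b\<close>
  turns \<open>Gamma b * Gamma (b + 1 / 2)\<close> into
  \<open>Gamma (2 * b) = Gamma (- \<nu>)\<close>, which gives the factor before the first integral;
  before the second integral the Beta values cancel.\<close>

lemma product_formula_real:
  fixes a b x y :: real and p :: complex
  defines "\<nu> \<equiv> complex_of_real (- 2 * b)" and "\<mu> \<equiv> complex_of_real (- 2 * a)"
  assumes ab: "a > 0" "0 < b" "b < 1 / 2" and xy: "x > 0" "y > 0" and p: "Re p > 0"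
  shows "p powr (- 1 / 2) * exp (p * of_real (y - x) / 2)
         * parabolic_cylinder_D \<mu> (2 powr (1 / 2) * of_real y powr (1 / 2) * p powr (1 / 2))
         * (parabolic_cylinder_D \<nu> (- (2 powr (1 / 2)) * of_real x powr (1 / 2) * p powr (1 / 2))
            + parabolic_cylinder_D \<nu> (2 powr (1 / 2) * of_real x powr (1 / 2) * p powr (1 / 2)))
       = 2 powr ((\<mu> - \<nu>) / 2) * of_real (sqrt pi)
           * rGamma (1 + (\<nu> - \<mu>) / 2) * rGamma (- \<nu>)
           * (LBINT t:{0<..<x}. integrand_below \<nu> \<mu> p x y t)
         + 2 powr (1 + (\<mu> + \<nu>) / 2) * of_real (sqrt pi)
           * rGamma ((1 - \<nu>) / 2) * rGamma ((1 - \<mu>) / 2)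
           * (LBINT t:{x<..}. integrand_above \<nu> \<mu> p x y t)"
proof -
  have p0: "p \<noteq> 0" using p by auto
  define z where "z = 2 powr (1 / 2) * of_real x powr (1 / 2) * p powr (1 / 2)"
  have z2: "z\<^sup>2 = 2 * of_real x * p" unfolding z_def using sqrt_argument_square[of x p] xy p0 by simp
  have two: "(2 :: complex) powr of_real r = of_real (2 powr r)" for r
    using powr_of_real[of 2 r] by simp
  have rG: "rGamma (complex_of_real r) = of_real (1 / Gamma r)" for r
    by (simp add: rGamma_inverse_Gamma Gamma_complex_of_real inverse_eq_divide)
  define LH where "LH = (LBINT u:{0<..<x}. exp (- p * of_real u) * complex_of_real (u powr (- b - 1 / 2) * (x - u) powr (b - 1)))"
  define LG where "LG = (LBINT s:{0<..}. exp (- p * of_real s) * complex_of_real (s powr (a - 1 / 2) * (y + s) powr (- a)))"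
  define I1 where "I1 = (LBINT t:{0<..<x}. integrand_below \<nu> \<mu> p x y t)"
  define I2 where "I2 = (LBINT t:{x<..}. integrand_above \<nu> \<mu> p x y t)"
  have prod: "LH * LG = of_real (Beta (1 / 2 - b) (a + 1 / 2) / sqrt x) * I1 + of_real (Beta b (1 / 2 - b) / sqrt x) * I2"
    unfolding LH_def LG_def I1_def I2_def \<nu>_def \<mu>_def by (rule laplace_product[OF ab xy p])
  have G: "Gamma a > 0" "Gamma b > 0" "Gamma (2 * b) > 0" "Gamma (1 / 2 - b) > 0" "Gamma (a + 1 / 2) > 0"
    "Gamma (b + 1 / 2) > 0" "Gamma (1 + a - b) > 0"
    by (rule Gamma_real_pos, use ab in simp)+
  have Y: "p powr (- 1 / 2) * exp (p * of_real y / 2) * parabolic_cylinder_D \<mu> (2 powr (1 / 2) * of_real y powr (1 / 2) * p powr (1 / 2))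
      = of_real (2 powr (- a) / Gamma (a + 1 / 2)) * LG"
    unfolding \<mu>_def LG_def by (rule parabolic_cylinder_D_laplace_real[OF ab(1) xy(2) p])
  have c: "\<nu> / 2 = of_real (- b)" "(1 - \<nu>) / 2 = of_real (b + 1 / 2)" "- \<nu> / 2 = of_real b"
    "(\<mu> - \<nu>) / 2 = of_real (b - a)" "1 + (\<nu> - \<mu>) / 2 = of_real (1 + a - b)" "- \<nu> = of_real (2 * b)"
    "1 + (\<mu> + \<nu>) / 2 = of_real (1 - a - b)" "(1 - \<mu>) / 2 = of_real (a + 1 / 2)"
    unfolding \<nu>_def \<mu>_def by (simp_all add: field_simps)
  have "exp (- p * of_real x / 2) * exp (- (z\<^sup>2) / 4) = exp (- p * of_real x)"
    unfolding z2 by (simp flip: exp_add)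
  then have "exp (- p * of_real x / 2) * (parabolic_cylinder_D \<nu> (- z) + parabolic_cylinder_D \<nu> z)
      = of_real (2 * 2 powr (- b) * sqrt pi / Gamma (b + 1 / 2)) * (exp (- p * of_real x) * kummer_Phi (of_real b) (1 / 2) (p * of_real x))"
    unfolding parabolic_cylinder_D_even_part c two rG Gamma_one_half_complex
    by (simp add: z2 mult_ac flip: mult.assoc[of "exp _" "exp _"])
  also have "\<dots> = of_real (2 * 2 powr (- b) * sqrt pi / Gamma (b + 1 / 2)) * (of_real (sqrt x / Beta b (1 / 2 - b)) * LH)"
    unfolding kummer_Phi_laplace[OF ab(2,3) xy(1)] LH_def ..
  finally have X: "exp (- p * of_real x / 2) * (parabolic_cylinder_D \<nu> (- z) + parabolic_cylinder_D \<nu> z)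
      = of_real (2 * 2 powr (- b) * sqrt pi / Gamma (b + 1 / 2)) * (of_real (sqrt x / Beta b (1 / 2 - b)) * LH)" .
  \<comment> \<open>The constants of the transform of \<open>D\<^sub>\<mu>\<close>, of the even part
    of \<open>D\<^sub>\<nu>\<close>, and of Euler's integral for Kummer's function.\<close>
  define C where "C = 2 powr (- a) / Gamma (a + 1 / 2) * (2 * 2 powr (- b) * sqrt pi / Gamma (b + 1 / 2)) * (sqrt x / Beta b (1 / 2 - b))"
  have exps: "exp (p * of_real (y - x) / 2) = exp (p * of_real y / 2) * exp (- p * of_real x / 2)"
    by (simp add: algebra_simps diff_divide_distrib flip: exp_add)
  have "p powr (- 1 / 2) * exp (p * of_real (y - x) / 2)
         * parabolic_cylinder_D \<mu> (2 powr (1 / 2) * of_real y powr (1 / 2) * p powr (1 / 2))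
         * (parabolic_cylinder_D \<nu> (- z) + parabolic_cylinder_D \<nu> z)
      = (p powr (- 1 / 2) * exp (p * of_real y / 2) * parabolic_cylinder_D \<mu> (2 powr (1 / 2) * of_real y powr (1 / 2) * p powr (1 / 2)))
        * (exp (- p * of_real x / 2) * (parabolic_cylinder_D \<nu> (- z) + parabolic_cylinder_D \<nu> z))"
    unfolding exps by (simp only: mult_ac)
  also have "\<dots> = of_real C * (LH * LG)"
    unfolding X Y C_def of_real_mult by (simp only: mult_ac)
  also have "\<dots> = of_real (C * (Beta (1 / 2 - b) (a + 1 / 2) / sqrt x)) * I1 + of_real (C * (Beta b (1 / 2 - b) / sqrt x)) * I2"
    unfolding prod by (simp only: distrib_left of_real_mult mult.assoc)
  also have "C * (Beta b (1 / 2 - b) / sqrt x) = 2 powr (1 - a - b) * sqrt pi * (1 / Gamma (b + 1 / 2)) * (1 / Gamma (a + 1 / 2))"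
  proof -
    have "Beta b (1 / 2 - b) > 0"
      unfolding Beta_def using G by (auto intro!: divide_pos_pos mult_pos_pos Gamma_real_pos)
    then have "C * (Beta b (1 / 2 - b) / sqrt x) = (2 powr (- a) * 2 * 2 powr (- b)) * sqrt pi * (1 / Gamma (b + 1 / 2)) * (1 / Gamma (a + 1 / 2))"
      using xy by (simp add: C_def mult_ac)
    also have "2 powr (- a) * 2 * 2 powr (- b) = (2 powr (1 - a - b) :: real)"
      by (simp add: powr_diff powr_minus_divide)
    finally show ?thesis .
  qed
  also have "C * (Beta (1 / 2 - b) (a + 1 / 2) / sqrt x) = 2 powr (b - a) * sqrt pi * (1 / Gamma (1 + a - b)) * (1 / Gamma (2 * b))"
  proof -
    have aux: "A * (q * q) / (g * q / P) / h = A * P * q * (1 / h) * (1 / g)" if "q \<noteq> 0" for A P q g h :: real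
      using that by (simp add: mult_ac)
    have s: "1 / 2 - b + (a + 1 / 2) = 1 + a - b" "b + (1 / 2 - b) = 1 / 2" by simp_all
    have "C * (Beta (1 / 2 - b) (a + 1 / 2) / sqrt x)
        = 2 powr (- a) * (2 * 2 powr (- b)) * (sqrt pi * sqrt pi) / (Gamma b * Gamma (b + 1 / 2)) / Gamma (1 + a - b)"
      unfolding C_def Beta_def s Gamma_one_half_real using G xy by (simp add: mult_ac)
    also have "Gamma b * Gamma (b + 1 / 2) = Gamma (2 * b) * sqrt pi / 2 powr (2 * b - 1)"
      using Gamma_duplication_real[OF ab(2)] by (simp add: field_simps)
    also have "2 powr (- a) * (2 * 2 powr (- b)) * (sqrt pi * sqrt pi) / (Gamma (2 * b) * sqrt pi / 2 powr (2 * b - 1)) / Gamma (1 + a - b)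
        = (2 powr (- a) * 2 * 2 powr (- b) * 2 powr (2 * b - 1)) * sqrt pi * (1 / Gamma (1 + a - b)) * (1 / Gamma (2 * b))"
      by (subst aux) simp_all
    also have "2 powr (- a) * 2 * 2 powr (- b) * 2 powr (2 * b - 1) = (2 powr (b - a) :: real)"
    proof -
      have "2 powr (- a) * 2 powr 1 * 2 powr (- b) * 2 powr (2 * b - 1) = (2 powr (b - a) :: real)"
        by (simp only: powr_add[symmetric]) simp
      then show ?thesis by simp
    qed
    finally show ?thesis .
  qed
  finally show ?thesis
    unfolding c two rG I1_def I2_def z_def by (simp only: mult_minus_left of_real_mult)
qed

subsection \<open>Locally uniform domination in the parameters\<close>

text \<open>For exponents of unknown sign: \<open>M\<close> controls \<open>e \<ge> 0\<close> and
  \<open>m\<close> controls \<open>e < 0\<close>. Both factors are at least 1, so their product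
  serves in either case.\<close>

lemma powr_le_two_sided:
  fixes s :: real
  assumes "0 < m" "m \<le> 1" "m \<le> s" "s \<le> M" "1 \<le> M" "\<bar>e\<bar> \<le> E"
  shows "s powr e \<le> m powr (- E) * M powr E"
proof -
  have m: "1 \<le> m powr (- E)" using assms ge_one_powr_ge_zero[of "1 / m" E] by (simp add: powr_divide powr_minus_divide)
  have M: "1 \<le> M powr E" using assms by (intro ge_one_powr_ge_zero) auto
  show ?thesis
  proof (cases "e \<ge> 0")
    case True
    have "s powr e \<le> M powr e" using assms True by (intro powr_mono2) auto
    also have "\<dots> \<le> M powr E" using assms by (intro powr_mono) auto
    also have "\<dots> \<le> m powr (- E) * M powr E" using mult_right_mono[OF m, of "M powr E"] by simp
    finally show ?thesis .
  next
    case False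
    have "s powr e \<le> m powr e" using assms False by (intro powr_mono2') auto
    also have "\<dots> \<le> m powr (- E)" using assms by (intro powr_mono') auto
    also have "\<dots> \<le> m powr (- E) * M powr E" using mult_left_mono[OF M, of "m powr (- E)"] by simp
    finally show ?thesis .
  qed
qed

text \<open>For bases that may tend to 0, where the smallest exponent has to be kept; only the
  excess over it is estimated by \<open>M\<close>.\<close>

lemma powr_le_lower_exponent:
  fixes s :: real
  assumes "0 < s" "s \<le> M" "1 \<le> M" "e1 \<le> e" "e \<le> e1 + E"
  shows "s powr e \<le> s powr e1 * M powr E"
proof -
  have "s powr e = s powr e1 * s powr (e - e1)" by (simp flip: powr_add)
  also have "\<dots> \<le> s powr e1 * M powr E"
  proof (rule mult_left_mono)
    have "s powr (e - e1) \<le> M powr (e - e1)" using assms by (intro powr_mono2) auto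
    also have "\<dots> \<le> M powr E" using assms by (intro powr_mono) auto
    finally show "s powr (e - e1) \<le> M powr E" .
  qed simp
  finally show ?thesis .
qed

lemma Re_cball_le:
  assumes "z \<in> cball z0 r"
  shows "\<bar>Re z - Re z0\<bar> \<le> r"
  using abs_Re_le_cmod[of "z - z0"] assms by (simp add: dist_norm norm_minus_commute)

text \<open>The hypergeometric factor is critical at \<open>t = x\<close>, where its argument tends
  to minus infinity. There it contributes \<open>(1 - z) powr \<tau>\<close>, hence
  \<open>(x - t) powr (- \<tau>)\<close>, and the total exponent exceeds \<open>-1\<close> because
  \<open>\<tau> < (1 - Re \<nu>0) / 2\<close>.\<close>

lemma integrand_below_dominated:
  fixes \<nu>0 \<mu>0 p :: complex and x y :: real
  assumes par: "Re \<nu>0 < 1" "Re \<mu>0 < 1 - Re \<nu>0" "Re \<mu>0 < 2 + Re \<nu>0"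
    and p: "Re p > 0" and xy: "x > 0" "y > 0"
  obtains r W where "r > 0" "set_integrable lborel {0<..<x} W"
    "\<And>\<nu> \<mu> t. \<nu> \<in> cball \<nu>0 r \<Longrightarrow> \<mu> \<in> cball \<mu>0 r \<Longrightarrow> t \<in> {0<..<x} \<Longrightarrow>
       norm (integrand_below \<nu> \<mu> p x y t) \<le> W t"
proof -
  \<comment> \<open>The growth exponent of the hypergeometric factor at minus infinity;
    \<open>\<tau>\<close> lies halfway between it and the limit of integrability at
    \<open>t = x\<close>.\<close>
  define \<tau>0 where "\<tau>0 = max (Re \<mu>0 / 2) (- (1 + Re \<nu>0) / 2)"
  define \<tau> where "\<tau> = (\<tau>0 + (1 - Re \<nu>0) / 2) / 2"
  have \<tau>: "\<tau> > Re \<mu>0 / 2" "\<tau> > - (1 + Re \<nu>0) / 2" "\<tau> < (1 - Re \<nu>0) / 2"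
    using par by (auto simp: \<tau>_def \<tau>0_def max_def field_simps)
  have c0: "Re (1 + (\<nu>0 - \<mu>0) / 2) > 0" using par(3) by (simp add: field_simps)
  have x0: "x / (x + y) < 1" using xy by simp
  have ta: "\<tau> > - Re (- \<mu>0 / 2)" and tb: "\<tau> > - Re ((1 + \<nu>0) / 2)" using \<tau> by (simp_all add: field_simps)
  obtain K r1 where K: "K > 0" "r1 > 0" and
    bnd: "\<And>a b c z. a \<in> cball (- \<mu>0 / 2) r1 \<Longrightarrow> b \<in> cball ((1 + \<nu>0) / 2) r1 \<Longrightarrow> c \<in> cball (1 + (\<nu>0 - \<mu>0) / 2) r1 \<Longrightarrow>
       z \<le> x / (x + y) \<Longrightarrow> norm (gauss_2F1 a b c (of_real z)) \<le> K * (1 - z) powr \<tau>"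
    using gauss_2F1_bound_at_minus_infinity[OF c0 ta tb x0] by metis
  \<comment> \<open>The margins \<open>d1\<close> and \<open>d2\<close> measure how far the
    exponents at \<open>t = 0\<close> and \<open>t = x\<close> lie above \<open>-1\<close>. Half of
    each may be lost when the parameters move.\<close>
  define d1 where "d1 = Re (\<nu>0 - \<mu>0) / 2 + 1"
  define d2 where "d2 = (1 - Re \<nu>0) / 2 - \<tau>"
  have d: "d1 > 0" "d2 > 0" using par(3) \<tau>(3) by (simp_all add: d1_def d2_def field_simps)
  define r where "r = min r1 (min (d1 / 2) d2)"
  have r: "r > 0" "r \<le> r1" "r \<le> d1 / 2" "r \<le> d2" using K(2) d unfolding r_def by linarith+
  define e1 where "e1 = d1 / 2 - 1"
  define e2 where "e2 = d2 / 2 - 1"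
  define X where "X = max 1 (x + y)"
  define m where "m = min 1 y"
  define E where "E = \<bar>Re \<mu>0 / 2 - \<tau>\<bar> + r"
  define Cst where "Cst = X powr d1 * X powr d2 * (m powr (- E) * X powr E) * (K * (x * y) powr \<tau>)"
  define W where "W t = Cst * (t powr (e1 + 1 - 1) * (x - t) powr (e2 + 1 - 1))" for t
  have X: "1 \<le> X" "x + y \<le> X" and m: "0 < m" "m \<le> 1" "m \<le> y" using xy by (auto simp: X_def m_def)
  show thesis
  proof (rule that[OF r(1)])
    show "set_integrable lborel {0<..<x} W"
      unfolding W_def using set_integrable_Beta_scaled[of "e1 + 1" "e2 + 1" x] d xy by (simp add: e1_def e2_def)
    fix \<nu> \<mu> :: complex and t :: real
    assume \<nu>: "\<nu> \<in> cball \<nu>0 r" and \<mu>: "\<mu> \<in> cball \<mu>0 r" and "t \<in> {0<..<x}"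
    then have t: "0 < t" "t < x" by auto
    have n: "norm (\<nu> - \<nu>0) \<le> r" "norm (\<mu> - \<mu>0) \<le> r" using \<nu> \<mu> by (auto simp: dist_norm norm_minus_commute)
    note re = Re_cball_le[OF \<nu>] Re_cball_le[OF \<mu>]
    define z where "z = t * (x - y - t) / ((x - t) * (y + t))"
    have z1: "1 - z = x * y / ((x - t) * (y + t))" unfolding z_def by (rule below_argument[OF t xy(2)])
    \<comment> \<open>This keeps the argument away from 1, so that only its escape to minus infinity
      matters.\<close>
    have "y / (x + y) = x * y / (x * (x + y))" using xy by simp
    also have "\<dots> \<le> x * y / ((x - t) * (y + t))"
      using t xy by (intro divide_left_mono mult_mono mult_pos_pos) auto
    finally have "z \<le> 1 - y / (x + y)" using z1 by simp
    also have "\<dots> = x / (x + y)" using xy by (simp add: field_simps)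
    finally have zle: "z \<le> x / (x + y)" .
    have "norm ((1 + \<nu>) / 2 - (1 + \<nu>0) / 2) = norm (\<nu> - \<nu>0) / 2"
      by (simp add: norm_divide flip: diff_divide_distrib)
    moreover have "norm (- \<mu> / 2 - (- \<mu>0 / 2)) = norm (\<mu> - \<mu>0) / 2"
      by (simp add: norm_divide norm_minus_commute flip: diff_divide_distrib)
    moreover have "norm ((1 + (\<nu> - \<mu>) / 2) - (1 + (\<nu>0 - \<mu>0) / 2)) \<le> norm (\<nu> - \<nu>0) / 2 + norm (\<mu> - \<mu>0) / 2"
    proof -
      have eq: "(1 + (\<nu> - \<mu>) / 2) - (1 + (\<nu>0 - \<mu>0) / 2) = (\<nu> - \<nu>0) / 2 - (\<mu> - \<mu>0) / 2" by (simp add: field_simps)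
      show ?thesis unfolding eq using norm_triangle_ineq4[of "(\<nu> - \<nu>0) / 2" "(\<mu> - \<mu>0) / 2"] by (simp add: norm_divide)
    qed
    ultimately have F: "norm (gauss_2F1 (- \<mu> / 2) ((1 + \<nu>) / 2) (1 + (\<nu> - \<mu>) / 2) (of_real z)) \<le> K * (1 - z) powr \<tau>"
      using n r zle by (intro bnd) (auto simp: dist_norm norm_minus_commute)
    have "norm (integrand_below \<nu> \<mu> p x y t) = exp (- Re p * t) * t powr (Re (\<nu> - \<mu>) / 2)
        * (x - t) powr (- (1 + Re \<nu>) / 2) * (y + t) powr (Re \<mu> / 2)
        * norm (gauss_2F1 (- \<mu> / 2) ((1 + \<nu>) / 2) (1 + (\<nu> - \<mu>) / 2) (of_real z))"
    proof -
      have q: "norm (complex_of_real t powr ((\<nu> - \<mu>) / 2)) = t powr (Re (\<nu> - \<mu>) / 2)"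
        "norm (complex_of_real (x - t) powr (- (1 + \<nu>) / 2)) = (x - t) powr (- (1 + Re \<nu>) / 2)"
        "norm (complex_of_real (y + t) powr (\<mu> / 2)) = (y + t) powr (Re \<mu> / 2)"
        using t xy by (simp_all only: norm_of_real_powr Re_divide_numeral) auto
      show ?thesis unfolding integrand_below_def norm_mult norm_exp_times_of_real q z_def ..
    qed
    also have "\<dots> \<le> 1 * t powr (Re (\<nu> - \<mu>) / 2) * (x - t) powr (- (1 + Re \<nu>) / 2) * (y + t) powr (Re \<mu> / 2) * (K * (1 - z) powr \<tau>)"
      using p t F by (intro mult_mono) auto
    also have "\<dots> = t powr (Re (\<nu> - \<mu>) / 2) * (x - t) powr (- (1 + Re \<nu>) / 2 - \<tau>) * (y + t) powr (Re \<mu> / 2 - \<tau>) * (K * (x * y) powr \<tau>)"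
      unfolding z1 using t xy by (simp add: powr_divide powr_mult powr_diff)
    also have "\<dots> \<le> (t powr e1 * X powr d1) * ((x - t) powr e2 * X powr d2) * (m powr (- E) * X powr E) * (K * (x * y) powr \<tau>)"
    proof (intro mult_right_mono mult_mono)
      note re' = re[unfolded abs_le_iff]
      have "Re (\<nu> - \<mu>) / 2 = d1 - 1 + (Re \<nu> - Re \<nu>0) / 2 - (Re \<mu> - Re \<mu>0) / 2"
        by (simp add: d1_def field_simps)
      then have "e1 \<le> Re (\<nu> - \<mu>) / 2" "Re (\<nu> - \<mu>) / 2 \<le> e1 + d1"
        using re' r d unfolding e1_def by argo+
      then show "t powr (Re (\<nu> - \<mu>) / 2) \<le> t powr e1 * X powr d1"
        using t X xy by (intro powr_le_lower_exponent) auto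
      have "- (1 + Re \<nu>) / 2 - \<tau> = d2 - 1 - (Re \<nu> - Re \<nu>0) / 2" by (simp add: d2_def field_simps)
      then have "e2 \<le> - (1 + Re \<nu>) / 2 - \<tau>" "- (1 + Re \<nu>) / 2 - \<tau> \<le> e2 + d2"
        using re' r d unfolding e2_def by argo+
      then show "(x - t) powr (- (1 + Re \<nu>) / 2 - \<tau>) \<le> (x - t) powr e2 * X powr d2"
        using t X xy by (intro powr_le_lower_exponent) auto
      show "(y + t) powr (Re \<mu> / 2 - \<tau>) \<le> m powr (- E) * X powr E"
        using t X xy m re r by (intro powr_le_two_sided) (auto simp: E_def)
    qed (use K in \<open>auto intro!: mult_nonneg_nonneg\<close>)
    also have "\<dots> = W t" by (simp add: W_def Cst_def)
    finally show "norm (integrand_below \<nu> \<mu> p x y t) \<le> W t" .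
  qed
qed

text \<open>Half of the exponential decay absorbs the power of \<open>t + c\<close>; the other half
  together with \<open>(t - x) powr e\<close> is a shifted Gamma integrand.\<close>

lemma set_integrable_power_exp:
  fixes x c k e q :: real
  assumes e: "e > -1" and q: "q > 0" and x: "x \<ge> 0" and c: "c \<ge> 1" and k: "k \<ge> 0"
  shows "set_integrable lborel {x<..} (\<lambda>t. (t - x) powr e * (t + c) powr k * exp (- q * t))"
proof -
  \<comment> \<open>From \<open>s \<le> exp s\<close> at \<open>s = \<eta> * (t + c)\<close>, the
    power is at most a constant times \<open>exp (\<eta> * k * (t + c))\<close>, and
    \<open>\<eta> * k \<le> q / 2\<close>. The summand 1 covers \<open>k = 0\<close>.\<close>
  define \<eta> where "\<eta> = q / (2 * (k + 1))"
  have \<eta>: "\<eta> > 0" "\<eta> * k \<le> q / 2" using q k by (simp_all add: \<eta>_def field_simps)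
  define f where "f s = indicat_real {0<..} s * (s powr (e + 1 - 1) * exp (- (q / 2 * s)))" for s
  have "integrable lborel f"
    using Gamma_scaled_lborel(1)[of "e + 1" "q / 2"] e q by (simp add: f_def[abs_def] set_integrable_def)
  then have "integrable lborel (\<lambda>t. f (- x + 1 * t))"
    using lborel_integrable_real_affine_iff[of 1 f "- x"] by simp
  moreover have "f (- x + 1 * t) = indicat_real {x<..} t *\<^sub>R ((t - x) powr e * exp (- (q / 2 * (t - x))))" for t
    by (simp add: f_def indicator_def)
  ultimately have base: "set_integrable lborel {x<..} (\<lambda>t. (t - x) powr e * exp (- (q / 2 * (t - x))))"
    by (simp add: set_integrable_def)
  define C where "C = \<eta> powr (- k) * exp (q / 2 * c)"
  show ?thesis
  proof (rule set_integrable_bound)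
    show "set_integrable lborel {x<..} (\<lambda>t. C * ((t - x) powr e * exp (- (q / 2 * (t - x)))))"
      using base by simp
    show "set_borel_measurable lborel {x<..} (\<lambda>t. (t - x) powr e * (t + c) powr k * exp (- q * t))"
      unfolding set_borel_measurable_def by measurable
    have "(t - x) powr e * (t + c) powr k * exp (- q * t) \<le> C * ((t - x) powr e * exp (- (q / 2 * (t - x))))"
      if t: "t \<in> {x<..}" for t
    proof -
      have tc: "t + c > 0" using t x c by simp
      have "\<eta> * (t + c) \<le> exp (\<eta> * (t + c))" using exp_ge_add_one_self[of "\<eta> * (t + c)"] by linarith
      then have "(\<eta> * (t + c)) powr k \<le> exp (\<eta> * (t + c)) powr k"
        using \<eta> tc k by (intro powr_mono2) auto
      then have "\<eta> powr k * (t + c) powr k \<le> exp (\<eta> * k * (t + c))"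
        using \<eta> tc by (simp add: powr_mult exp_powr_real mult_ac)
      also have "\<dots> \<le> exp (q / 2 * (t + c))" using \<eta> tc by simp
      finally have "(t + c) powr k \<le> \<eta> powr (- k) * exp (q / 2 * (t + c))"
        using \<eta> by (simp add: powr_minus_divide field_simps)
      then have "(t - x) powr e * (t + c) powr k * exp (- q * t)
          \<le> (t - x) powr e * (\<eta> powr (- k) * exp (q / 2 * (t + c))) * exp (- q * t)"
        by (intro mult_mono) auto
      also have "\<dots> = (t - x) powr e * \<eta> powr (- k) * (exp (q / 2 * (t + c)) * exp (- q * t))"
        by (simp only: mult_ac)
      also have "exp (q / 2 * (t + c)) * exp (- q * t) = exp (q / 2 * c) * exp (- (q / 2 * t))"
      proof -
        have "q / 2 * (t + c) + - q * t = q / 2 * c + - (q / 2 * t)" by (simp add: field_simps)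
        then show ?thesis by (simp only: exp_add[symmetric])
      qed
      also have "(t - x) powr e * \<eta> powr (- k) * (exp (q / 2 * c) * exp (- (q / 2 * t)))
          \<le> (t - x) powr e * \<eta> powr (- k) * (exp (q / 2 * c) * exp (- (q / 2 * (t - x))))"
        using q x by (intro mult_left_mono) auto
      finally show ?thesis by (simp only: C_def mult_ac)
    qed
    then show "AE t in lborel. t \<in> {x<..} \<longrightarrow> norm ((t - x) powr e * (t + c) powr k * exp (- q * t))
        \<le> norm (C * ((t - x) powr e * exp (- (q / 2 * (t - x)))))" by (auto simp: abs_mult C_def)
  qed
qed

text \<open>Here the argument tends to 1 as \<open>t\<close> tends to \<open>x\<close>, and the
  hypergeometric factor contributes \<open>(t - x) powr (- \<sigma>)\<close>. A positive
  \<open>\<sigma>\<close> below \<open>(1 - Re \<mu>0 - Re \<nu>0) / 2\<close> exists by the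
  hypothesis on the parameters. At infinity all powers are absorbed by the exponential.\<close>

lemma integrand_above_dominated:
  fixes \<nu>0 \<mu>0 p :: complex and x y :: real
  assumes par: "Re \<mu>0 < 1 - Re \<nu>0"
    and p: "Re p > 0" and xy: "x > 0" "y > 0"
  obtains r W where "r > 0" "set_integrable lborel {x<..} W"
    "\<And>\<nu> \<mu> t. \<nu> \<in> cball \<nu>0 r \<Longrightarrow> \<mu> \<in> cball \<mu>0 r \<Longrightarrow> t \<in> {x<..} \<Longrightarrow>
       norm (integrand_above \<nu> \<mu> p x y t) \<le> W t"
proof -
  \<comment> \<open>The second entry is the critical exponent \<open>Re (a + b - c)\<close> of this
    hypergeometric function at 1.\<close>
  define \<sigma>0 where "\<sigma>0 = max 0 (- (1 + Re \<mu>0 + Re \<nu>0) / 2)"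
  define \<sigma> where "\<sigma> = (\<sigma>0 + (1 - Re \<mu>0 - Re \<nu>0) / 2) / 2"
  have \<sigma>: "\<sigma> > 0" "\<sigma> > - (1 + Re \<mu>0 + Re \<nu>0) / 2" "\<sigma> < (1 - Re \<mu>0 - Re \<nu>0) / 2"
    using par by (auto simp: \<sigma>_def \<sigma>0_def max_def field_simps)
  have c0: "Re (1 / 2 :: complex) > 0" and s: "\<sigma> > Re (- \<mu>0 / 2 + - \<nu>0 / 2 - 1 / 2)"
    using \<sigma> by (simp_all add: field_simps)
  obtain K r1 where K: "K > 0" "r1 > 0" and
    bnd: "\<And>a b c v. a \<in> cball (- \<mu>0 / 2) r1 \<Longrightarrow> b \<in> cball (- \<nu>0 / 2) r1 \<Longrightarrow> c \<in> cball (1 / 2) r1 \<Longrightarrow>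
       0 \<le> v \<Longrightarrow> v < 1 \<Longrightarrow> norm (gauss_2F1 a b c (of_real v)) \<le> K * (1 - v) powr (- \<sigma>)"
    using gauss_2F1_bound_near_1[OF c0 \<sigma>(1) s] by metis
  define d where "d = (1 - Re \<mu>0 - Re \<nu>0) / 2 - \<sigma>"
  have d: "d > 0" using \<sigma> by (auto simp: d_def)
  define r where "r = min r1 (d / 2)"
  have r: "r > 0" "r \<le> r1" "r \<le> d / 2" using K(2) d unfolding r_def by linarith+
  define e where "e = d / 2 - 1"
  define m where "m = min 1 (min x y)"
  \<comment> \<open>A common bound for the exponents of three factors and for the excess over
    \<open>e\<close> in the fourth. Each costs at most \<open>(t + c) powr E\<close>, whence
    \<open>4 * E\<close> in \<open>W\<close>.\<close>
  define E where "E = \<bar>Re \<nu>0 / 2 + \<sigma>\<bar> + \<bar>Re \<mu>0 / 2 + \<sigma>\<bar> + \<sigma> + r + d"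
  define c where "c = y + 1"
  define W where "W t = K * m powr (- E) * m powr (- E) * m powr (- E) * ((t - x) powr e * (t + c) powr (4 * E) * exp (- Re p * t))" for t
  have m: "0 < m" "m \<le> 1" "m \<le> y" "m \<le> x" using xy by (auto simp: m_def)
  have E: "E \<ge> 0" using \<sigma> r d by (simp add: E_def)
  show thesis
  proof (rule that[OF r(1)])
    show "set_integrable lborel {x<..} W"
      unfolding W_def using set_integrable_power_exp[of e "Re p" x c "4 * E"] d xy p E by (simp add: e_def c_def)
    fix \<nu> \<mu> :: complex and t :: real
    assume \<nu>: "\<nu> \<in> cball \<nu>0 r" and \<mu>: "\<mu> \<in> cball \<mu>0 r" and "t \<in> {x<..}"
    then have t: "x < t" by auto
    have n: "norm (\<nu> - \<nu>0) \<le> r" "norm (\<mu> - \<mu>0) \<le> r" using \<nu> \<mu> by (auto simp: dist_norm norm_minus_commute)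
    note re = Re_cball_le[OF \<nu>] Re_cball_le[OF \<mu>]
    define v where "v = x * y / (t * (y - x + t))"
    have v1: "1 - v = (t - x) * (t + y) / (t * (y - x + t))" unfolding v_def by (rule above_argument) (use t xy in auto)
    have v: "v < 1" unfolding v_def by (rule above_argument_less_1) (use t xy in auto)
    have v0: "0 \<le> v" using t xy by (simp add: v_def)
    have "norm (- \<mu> / 2 - (- \<mu>0 / 2)) = norm (\<mu> - \<mu>0) / 2" "norm (- \<nu> / 2 - (- \<nu>0 / 2)) = norm (\<nu> - \<nu>0) / 2"
      by (simp_all add: norm_divide norm_minus_commute flip: diff_divide_distrib)
    then have F: "norm (gauss_2F1 (- \<mu> / 2) (- \<nu> / 2) (1 / 2) (of_real v)) \<le> K * (1 - v) powr (- \<sigma>)"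
      using n r v v0 K by (intro bnd) (auto simp: dist_norm norm_minus_commute)
    have "norm (integrand_above \<nu> \<mu> p x y t) = exp (- Re p * t) * t powr (Re \<nu> / 2)
        * (t - x) powr (- (1 + Re \<mu> + Re \<nu>) / 2) * (y - x + t) powr (Re \<mu> / 2)
        * norm (gauss_2F1 (- \<mu> / 2) (- \<nu> / 2) (1 / 2) (of_real v))"
    proof -
      have q: "norm (complex_of_real t powr (\<nu> / 2)) = t powr (Re \<nu> / 2)"
        "norm (complex_of_real (t - x) powr (- (1 + \<mu> + \<nu>) / 2)) = (t - x) powr (- (1 + Re \<mu> + Re \<nu>) / 2)"
        "norm (complex_of_real (y - x + t) powr (\<mu> / 2)) = (y - x + t) powr (Re \<mu> / 2)"
        using t xy by (simp_all only: norm_of_real_powr Re_divide_numeral) auto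
      show ?thesis unfolding integrand_above_def norm_mult norm_exp_times_of_real q v_def ..
    qed
    also have "\<dots> \<le> exp (- Re p * t) * t powr (Re \<nu> / 2) * (t - x) powr (- (1 + Re \<mu> + Re \<nu>) / 2) * (y - x + t) powr (Re \<mu> / 2) * (K * (1 - v) powr (- \<sigma>))"
      using F by (intro mult_left_mono) auto
    also have "\<dots> = exp (- Re p * t) * K * t powr (Re \<nu> / 2 + \<sigma>) * (t - x) powr (- (1 + Re \<mu> + Re \<nu>) / 2 - \<sigma>)
        * (y - x + t) powr (Re \<mu> / 2 + \<sigma>) * (t + y) powr (- \<sigma>)"
      unfolding v1 using t xy by (simp add: powr_divide powr_mult powr_diff powr_add powr_minus_divide)
    also have "\<dots> \<le> exp (- Re p * t) * K * (m powr (- E) * (t + c) powr E) * ((t - x) powr e * (t + c) powr E)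
        * (m powr (- E) * (t + c) powr E) * (m powr (- E) * (t + c) powr E)"
    proof (intro mult_mono order_refl)
      show "t powr (Re \<nu> / 2 + \<sigma>) \<le> m powr (- E) * (t + c) powr E"
        using t xy m re r d \<sigma> by (intro powr_le_two_sided) (auto simp: E_def c_def)
      show "(y - x + t) powr (Re \<mu> / 2 + \<sigma>) \<le> m powr (- E) * (t + c) powr E"
        using t xy m re r d \<sigma> by (intro powr_le_two_sided) (auto simp: E_def c_def)
      show "(t + y) powr (- \<sigma>) \<le> m powr (- E) * (t + c) powr E"
        using t xy m r d \<sigma> by (intro powr_le_two_sided) (auto simp: E_def c_def)
      have "- (1 + Re \<mu> + Re \<nu>) / 2 - \<sigma> = d - 1 - (Re \<mu> - Re \<mu>0) / 2 - (Re \<nu> - Re \<nu>0) / 2"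
        by (simp add: d_def field_simps)
      then have "e \<le> - (1 + Re \<mu> + Re \<nu>) / 2 - \<sigma>" "- (1 + Re \<mu> + Re \<nu>) / 2 - \<sigma> \<le> e + E"
        using re[unfolded abs_le_iff] r d \<sigma>(1) abs_ge_zero[of "Re \<nu>0 / 2 + \<sigma>"] abs_ge_zero[of "Re \<mu>0 / 2 + \<sigma>"]
        unfolding e_def E_def by argo+
      then show "(t - x) powr (- (1 + Re \<mu> + Re \<nu>) / 2 - \<sigma>) \<le> (t - x) powr e * (t + c) powr E"
        using t xy by (intro powr_le_lower_exponent) (auto simp: c_def)
    qed (use K in \<open>auto intro!: mult_nonneg_nonneg\<close>)
    also have "\<dots> = W t"
    proof -
      have "(t + c) powr (4 * E) = (t + c) powr E * (t + c) powr E * (t + c) powr E * (t + c) powr E"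
        by (simp flip: powr_add)
      then show ?thesis unfolding W_def by (simp only: mult_ac)
    qed
    finally show "norm (integrand_above \<nu> \<mu> p x y t) \<le> W t" .
  qed
qed

subsection \<open>Analytic continuation in the parameters\<close>

lemma continuous_on_of_real_powr:
  fixes f :: "real \<Rightarrow> real"
  assumes "continuous_on A f" and "\<And>t. t \<in> A \<Longrightarrow> f t > 0"
  shows "continuous_on A (\<lambda>t. complex_of_real (f t) powr c)"
proof -
  have nz: "f t \<noteq> 0" if "t \<in> A" for t using assms(2)[OF that] by simp
  have "continuous_on A (\<lambda>t. exp (c * complex_of_real (ln (f t))))"
    using assms(1) nz by (intro continuous_intros) auto
  then show ?thesis
    by (rule continuous_on_eq) (use assms(2) in \<open>force simp: powr_def Ln_of_real\<close>)
qed

lemma set_borel_measurable_lborel_continuous: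
  fixes f :: "real \<Rightarrow> complex"
  assumes "A \<in> sets borel" "continuous_on A f"
  shows "set_borel_measurable lborel A f"
  using borel_measurable_continuous_on_indicator[OF assms] by (simp add: set_borel_measurable_def)

lemma set_borel_measurable_integrand_below:
  assumes c: "Re (1 + (\<nu> - \<mu>) / 2) > 0" and y: "y > 0"
  shows "set_borel_measurable lborel {0<..<x} (integrand_below \<nu> \<mu> p x y)"
proof (rule set_borel_measurable_lborel_continuous)
  have z: "t * (x - y - t) / ((x - t) * (y + t)) < 1" if "t \<in> {0<..<x}" for t
    by (rule below_argument_less_1) (use that y in auto)
  have "continuous_on {0<..<x} (\<lambda>t. gauss_2F1 (- \<mu> / 2) ((1 + \<nu>) / 2) (1 + (\<nu> - \<mu>) / 2) (of_real (t * (x - y - t) / ((x - t) * (y + t)))))"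
    by (rule continuous_on_compose2[OF continuous_on_gauss_2F1_real[OF c]])
      (use y z in \<open>auto intro!: continuous_intros\<close>)
  then show "continuous_on {0<..<x} (integrand_below \<nu> \<mu> p x y)"
    unfolding integrand_below_def[abs_def]
    by (intro continuous_on_mult continuous_on_of_real_powr continuous_intros) (use y in auto)
qed simp

lemma set_borel_measurable_integrand_above:
  assumes x: "x \<ge> 0" and y: "y > 0"
  shows "set_borel_measurable lborel {x<..} (integrand_above \<nu> \<mu> p x y)"
proof (rule set_borel_measurable_lborel_continuous)
  have z: "x * y / (t * (y - x + t)) < 1" if "t \<in> {x<..}" for t
    by (rule above_argument_less_1) (use that x y in auto)
  have "Re (1 / 2 :: complex) > 0" by simp
  from continuous_on_gauss_2F1_real[OF this]
  have "continuous_on {x<..} (\<lambda>t. gauss_2F1 (- \<mu> / 2) (- \<nu> / 2) (1 / 2) (of_real (x * y / (t * (y - x + t)))))"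
    by (rule continuous_on_compose2) (use x y z in \<open>auto intro!: continuous_intros\<close>)
  then show "continuous_on {x<..} (integrand_above \<nu> \<mu> p x y)"
    unfolding integrand_above_def[abs_def]
    by (intro continuous_on_mult continuous_on_of_real_powr continuous_intros) (use x y in auto)
qed simp

lemma holomorphic_on_imp_local_cball:
  assumes "open S" "N holomorphic_on S" "s0 \<in> S" "r > 0"
  obtains d where "d > 0" "\<And>s. s \<in> ball s0 d \<Longrightarrow> N s \<in> cball (N s0) r"
proof -
  have "isCont N s0"
    using assms by (meson continuous_on_eq_continuous_at holomorphic_on_imp_continuous_on)
  then obtain d where d: "d > 0" "\<And>s. dist s s0 < d \<Longrightarrow> dist (N s) (N s0) < r"
    using assms(4) unfolding continuous_at_eps_delta by meson
  show thesis
    by (rule that[OF d(1)]) (use d(2) in \<open>force simp: dist_commute less_imp_le\<close>)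
qed

text \<open>Letting both parameters be functions of one variable gives holomorphy in
  \<open>\<nu>\<close> and in \<open>\<mu>\<close> from a single argument: one of \<open>N\<close>
  and \<open>M\<close> is taken constant, the other the identity.\<close>

lemma holomorphic_on_integral_of_parameters:
  fixes h :: "complex \<Rightarrow> complex \<Rightarrow> real \<Rightarrow> complex"
  assumes S: "open S" "N holomorphic_on S" "M holomorphic_on S"
    and meas: "\<And>s. s \<in> S \<Longrightarrow> set_borel_measurable lborel A (h (N s) (M s))"
    and hol: "\<And>t. t \<in> A \<Longrightarrow> (\<lambda>s. h (N s) (M s) t) holomorphic_on S"
    and dom: "\<And>s. s \<in> S \<Longrightarrow> \<exists>r>0. \<exists>W. set_integrable lborel A W \<and>
       (\<forall>\<nu>\<in>cball (N s) r. \<forall>\<mu>\<in>cball (M s) r. \<forall>t\<in>A. norm (h \<nu> \<mu> t) \<le> W t)"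
  shows "(\<lambda>s. LBINT t:A. h (N s) (M s) t) holomorphic_on S"
proof (rule holomorphic_on_set_integral_dominated[OF S(1) meas hol])
  fix s0 assume s0: "s0 \<in> S"
  from dom[OF this] obtain r W where r: "r > 0" "set_integrable lborel A W"
    and W: "\<And>\<nu> \<mu> t. \<nu> \<in> cball (N s0) r \<Longrightarrow> \<mu> \<in> cball (M s0) r \<Longrightarrow> t \<in> A \<Longrightarrow> norm (h \<nu> \<mu> t) \<le> W t"
    by blast
  obtain d1 where d1: "d1 > 0" "\<And>s. s \<in> ball s0 d1 \<Longrightarrow> N s \<in> cball (N s0) r"
    using holomorphic_on_imp_local_cball[OF S(1,2) s0 r(1)] by blast
  obtain d2 where d2: "d2 > 0" "\<And>s. s \<in> ball s0 d2 \<Longrightarrow> M s \<in> cball (M s0) r"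
    using holomorphic_on_imp_local_cball[OF S(1,3) s0 r(1)] by blast
  have "norm (h (N s) (M s) t) \<le> W t" if "s \<in> ball s0 (min d1 d2) \<inter> S" "t \<in> A" for s t
    using that by (intro W d1(2) d2(2)) auto
  then show "\<exists>r>0. \<exists>W. set_integrable lborel A W \<and> (\<forall>z\<in>ball s0 r \<inter> S. \<forall>t\<in>A. norm (h (N z) (M z) t) \<le> W t)"
    using d1(1) d2(1) r(2) by (intro exI[of _ "min d1 d2"] conjI exI[of _ W]) auto
qed

lemma Re_parameter_pos:
  assumes "Re \<mu> < 2 + Re \<nu>"
  shows "Re (1 + (\<nu> - \<mu>) / 2) > 0"
  using assms by (simp add: field_simps)

lemma holomorphic_on_of_real_powr:
  assumes "f holomorphic_on S" "t > 0"
  shows "(\<lambda>s. complex_of_real t powr f s) holomorphic_on S"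
  using assms by (intro holomorphic_intros) auto

lemma holomorphic_on_integral_below:
  assumes S: "open S" "N holomorphic_on S" "M holomorphic_on S"
    and par: "\<And>s. s \<in> S \<Longrightarrow> Re (N s) < 1 \<and> Re (M s) < 1 - Re (N s) \<and> Re (M s) < 2 + Re (N s)"
    and p: "Re p > 0" and xy: "x > 0" "y > 0"
  shows "(\<lambda>s. LBINT t:{0<..<x}. integrand_below (N s) (M s) p x y t) holomorphic_on S"
proof (rule holomorphic_on_integral_of_parameters[OF S])
  show "set_borel_measurable lborel {0<..<x} (integrand_below (N s) (M s) p x y)" if "s \<in> S" for s
    using par[OF that] xy by (intro set_borel_measurable_integrand_below Re_parameter_pos) auto
  fix t assume t: "t \<in> {0<..<x}"
  have z: "t * (x - y - t) / ((x - t) * (y + t)) < 1"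
    by (rule below_argument_less_1) (use t xy in auto)
  have "(\<lambda>s. gauss_2F1 (- M s / 2) ((1 + N s) / 2) (1 + (N s - M s) / 2) (of_real (t * (x - y - t) / ((x - t) * (y + t))))) holomorphic_on S"
  proof (rule holomorphic_on_gauss_2F1_param[OF S(1) _ _ _ _ z])
    show "Re (1 + (N s - M s) / 2) > 0" if "s \<in> S" for s using par[OF that] by (intro Re_parameter_pos) auto
  qed (intro holomorphic_intros S; simp)+
  then show "(\<lambda>s. integrand_below (N s) (M s) p x y t) holomorphic_on S"
    unfolding integrand_below_def
    by (intro holomorphic_on_mult holomorphic_on_of_real_powr holomorphic_intros S) (use t xy in auto)
next
  fix s assume "s \<in> S"
  then show "\<exists>r>0. \<exists>W. set_integrable lborel {0<..<x} W \<and>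
       (\<forall>\<nu>\<in>cball (N s) r. \<forall>\<mu>\<in>cball (M s) r. \<forall>t\<in>{0<..<x}. norm (integrand_below \<nu> \<mu> p x y t) \<le> W t)"
    using integrand_below_dominated[of "N s" "M s" p x y] par[of s] p xy by metis
qed

lemma holomorphic_on_integral_above:
  assumes S: "open S" "N holomorphic_on S" "M holomorphic_on S"
    and par: "\<And>s. s \<in> S \<Longrightarrow> Re (M s) < 1 - Re (N s)"
    and p: "Re p > 0" and xy: "x > 0" "y > 0"
  shows "(\<lambda>s. LBINT t:{x<..}. integrand_above (N s) (M s) p x y t) holomorphic_on S"
proof (rule holomorphic_on_integral_of_parameters[OF S])
  show "set_borel_measurable lborel {x<..} (integrand_above (N s) (M s) p x y)" for s
    using xy by (intro set_borel_measurable_integrand_above) auto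
  fix t assume t: "t \<in> {x<..}"
  have z: "x * y / (t * (y - x + t)) < 1"
    by (rule above_argument_less_1) (use t xy in auto)
  have "(\<lambda>s. gauss_2F1 (- M s / 2) (- N s / 2) (1 / 2) (of_real (x * y / (t * (y - x + t))))) holomorphic_on S"
    by (rule holomorphic_on_gauss_2F1_param[OF S(1) _ _ _ _ z]) (auto intro!: holomorphic_intros S)
  then show "(\<lambda>s. integrand_above (N s) (M s) p x y t) holomorphic_on S"
    unfolding integrand_above_def
    by (intro holomorphic_on_mult holomorphic_on_of_real_powr holomorphic_intros S) (use t xy in auto)
next
  fix s assume "s \<in> S"
  then show "\<exists>r>0. \<exists>W. set_integrable lborel {x<..} W \<and>
       (\<forall>\<nu>\<in>cball (N s) r. \<forall>\<mu>\<in>cball (M s) r. \<forall>t\<in>{x<..}. norm (integrand_above \<nu> \<mu> p x y t) \<le> W t)"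
    using integrand_above_dominated[of "M s" "N s" p x y] par[of s] p xy by metis
qed

lemma holomorphic_on_parabolic_cylinder_D:
  assumes "open S" "M holomorphic_on S"
  shows "(\<lambda>s. parabolic_cylinder_D (M s) z) holomorphic_on S"
  unfolding parabolic_cylinder_D_def
  by (intro holomorphic_intros holomorphic_on_kummer_Phi_param assms) auto

lemma set_integrable_integrands:
  assumes par: "Re \<nu> < 1" "Re \<mu> < 1 - Re \<nu>" "Re \<mu> < 2 + Re \<nu>"
    and p: "Re p > 0" and xy: "x > 0" "y > 0"
  shows "set_integrable lborel {0<..<x} (integrand_below \<nu> \<mu> p x y)"
    and "set_integrable lborel {x<..} (integrand_above \<nu> \<mu> p x y)"
proof -
  obtain r W where "r > 0" and W: "set_integrable lborel {0<..<x} W"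
    "\<And>\<nu>1 \<mu>1 t. \<nu>1 \<in> cball \<nu> r \<Longrightarrow> \<mu>1 \<in> cball \<mu> r \<Longrightarrow> t \<in> {0<..<x} \<Longrightarrow> norm (integrand_below \<nu>1 \<mu>1 p x y t) \<le> W t"
    using integrand_below_dominated[OF par p xy] by metis
  show "set_integrable lborel {0<..<x} (integrand_below \<nu> \<mu> p x y)"
  proof (rule set_integrable_bound[OF W(1)])
    show "set_borel_measurable lborel {0<..<x} (integrand_below \<nu> \<mu> p x y)"
      using par xy by (intro set_borel_measurable_integrand_below Re_parameter_pos)
    have "norm (integrand_below \<nu> \<mu> p x y t) \<le> norm (W t)" if "t \<in> {0<..<x}" for t
      using W(2)[of \<nu> \<mu> t] that \<open>r > 0\<close> by simp
    then show "AE t in lborel. t \<in> {0<..<x} \<longrightarrow> norm (integrand_below \<nu> \<mu> p x y t) \<le> norm (W t)" by simp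
  qed
  obtain r' W' where "r' > 0" and W': "set_integrable lborel {x<..} W'"
    "\<And>\<nu>1 \<mu>1 t. \<nu>1 \<in> cball \<nu> r' \<Longrightarrow> \<mu>1 \<in> cball \<mu> r' \<Longrightarrow> t \<in> {x<..} \<Longrightarrow> norm (integrand_above \<nu>1 \<mu>1 p x y t) \<le> W' t"
    using integrand_above_dominated[OF par(2) p xy] by metis
  show "set_integrable lborel {x<..} (integrand_above \<nu> \<mu> p x y)"
  proof (rule set_integrable_bound[OF W'(1)])
    show "set_borel_measurable lborel {x<..} (integrand_above \<nu> \<mu> p x y)"
      using xy by (intro set_borel_measurable_integrand_above) auto
    have "norm (integrand_above \<nu> \<mu> p x y t) \<le> norm (W' t)" if "t \<in> {x<..}" for t
      using W'(2)[of \<nu> \<mu> t] that \<open>r' > 0\<close> by simp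
    then show "AE t in lborel. t \<in> {x<..} \<longrightarrow> norm (integrand_above \<nu> \<mu> p x y t) \<le> norm (W' t)" by simp
  qed
qed

text \<open>For real \<open>\<mu> = m < 0\<close> the admissible \<open>\<nu>\<close> form the strip
  \<open>m - 2 < Re \<nu> < min 1 (1 - m)\<close>, which contains the interval
  \<open>(-1, 0)\<close> of \<open>product_formula_real\<close>; this gives all \<open>\<nu>\<close>
  for such \<open>m\<close>. For fixed \<open>\<nu>\<close> the admissible \<open>\<mu>\<close> then
  form a half-plane, whose real points below \<open>m0\<close> are already covered.\<close>

lemma product_formula_pos:
  fixes \<nu> \<mu> p :: complex and x y :: real
  assumes par: "Re \<nu> < 1" "Re \<mu> < 1 - Re \<nu>" "Re \<mu> < 2 + Re \<nu>"
    and p: "Re p > 0" and xy: "x > 0" "y > 0"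
  shows "p powr (- 1 / 2) * exp (p * of_real (y - x) / 2)
         * parabolic_cylinder_D \<mu> (2 powr (1 / 2) * of_real y powr (1 / 2) * p powr (1 / 2))
         * (parabolic_cylinder_D \<nu> (- (2 powr (1 / 2)) * of_real x powr (1 / 2) * p powr (1 / 2))
            + parabolic_cylinder_D \<nu> (2 powr (1 / 2) * of_real x powr (1 / 2) * p powr (1 / 2)))
       = 2 powr ((\<mu> - \<nu>) / 2) * of_real (sqrt pi)
           * rGamma (1 + (\<nu> - \<mu>) / 2) * rGamma (- \<nu>)
           * (LBINT t:{0<..<x}. integrand_below \<nu> \<mu> p x y t)
         + 2 powr (1 + (\<mu> + \<nu>) / 2) * of_real (sqrt pi)
           * rGamma ((1 - \<nu>) / 2) * rGamma ((1 - \<mu>) / 2)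
           * (LBINT t:{x<..}. integrand_above \<nu> \<mu> p x y t)"
    (is "?lhs \<nu> \<mu> = ?rhs \<nu> \<mu>")
proof -
  have hol: "(\<lambda>s. ?lhs (N s) (M s)) holomorphic_on S" "(\<lambda>s. ?rhs (N s) (M s)) holomorphic_on S"
    if S: "open S" "N holomorphic_on S" "M holomorphic_on S"
      and par: "\<And>s. s \<in> S \<Longrightarrow> Re (N s) < 1 \<and> Re (M s) < 1 - Re (N s) \<and> Re (M s) < 2 + Re (N s)"
    for S N M
  proof -
    show "(\<lambda>s. ?lhs (N s) (M s)) holomorphic_on S"
      by (intro holomorphic_on_mult holomorphic_on_add holomorphic_on_const holomorphic_on_parabolic_cylinder_D S)
    have "(\<lambda>s. LBINT t:{0<..<x}. integrand_below (N s) (M s) p x y t) holomorphic_on S"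
      by (rule holomorphic_on_integral_below[OF S par p xy])
    moreover have "(\<lambda>s. LBINT t:{x<..}. integrand_above (N s) (M s) p x y t) holomorphic_on S"
      by (rule holomorphic_on_integral_above[OF S _ p xy]) (use par in blast)
    ultimately show "(\<lambda>s. ?rhs (N s) (M s)) holomorphic_on S"
      using S(2,3) by (intro holomorphic_intros) auto
  qed
  have real_\<mu>: "?lhs \<nu> (of_real m) = ?rhs \<nu> (of_real m)"
    if m: "m < 0" "m < 1 - Re \<nu>" "m < 2 + Re \<nu>" for m :: real
  proof -
    define S where "S = {n. Re n < min 1 (1 - m)} \<inter> {n. Re n > m - 2}"
    have S: "open S" "connected S"
      unfolding S_def by (intro open_Int open_halfspace_Re_lt open_halfspace_Re_gt convex_connected
          convex_Int convex_halfspace_Re_lt convex_halfspace_Re_gt)+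
    have par': "Re s < 1 \<and> Re (complex_of_real m) < 1 - Re s \<and> Re (complex_of_real m) < 2 + Re s" if "s \<in> S" for s
      using that by (auto simp: S_def)
    show ?thesis
    proof (rule identity_theorem_real[of "\<lambda>n. ?lhs n (of_real m)" S "\<lambda>n. ?rhs n (of_real m)" "{-1<..<0}" "- 1 / 2"])
      show "(\<lambda>n. ?lhs n (of_real m)) holomorphic_on S"
        by (rule hol(1)[OF S(1) holomorphic_on_ident holomorphic_on_const par'])
      show "(\<lambda>n. ?rhs n (of_real m)) holomorphic_on S"
        by (rule hol(2)[OF S(1) holomorphic_on_ident holomorphic_on_const par'])
      fix r :: real assume r: "r \<in> {-1<..<0}"
      show "?lhs (of_real r) (of_real m) = ?rhs (of_real r) (of_real m)"
        using product_formula_real[of "- m / 2" "- r / 2" x y p] m r xy p by simp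
    qed (use S m par in \<open>auto simp: S_def\<close>)
  qed
  define m0 where "m0 = min 0 (min (1 - Re \<nu>) (2 + Re \<nu>))"
  define S where "S = {m. Re m < min (1 - Re \<nu>) (2 + Re \<nu>)}"
  have S: "open S" "connected S"
    unfolding S_def by (intro open_halfspace_Re_lt convex_connected convex_halfspace_Re_lt)+
  have par': "Re \<nu> < 1 \<and> Re s < 1 - Re \<nu> \<and> Re s < 2 + Re \<nu>" if "s \<in> S" for s
    using that par by (auto simp: S_def)
  show ?thesis
  proof (rule identity_theorem_real[of "\<lambda>m. ?lhs \<nu> m" S "\<lambda>m. ?rhs \<nu> m" "{..<m0}" "m0 - 1"])
    show "(\<lambda>m. ?lhs \<nu> m) holomorphic_on S"
      by (rule hol(1)[OF S(1) holomorphic_on_const holomorphic_on_ident par'])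
    show "(\<lambda>m. ?rhs \<nu> m) holomorphic_on S"
      by (rule hol(2)[OF S(1) holomorphic_on_const holomorphic_on_ident par'])
    fix r :: real assume "r \<in> {..<m0}"
    then show "?lhs \<nu> (of_real r) = ?rhs \<nu> (of_real r)"
      by (intro real_\<mu>) (auto simp: m0_def)
  qed (use S par in \<open>auto simp: S_def m0_def\<close>)
qed

section \<open>The boundary case \<open>x = 0\<close>\<close>

text \<open>What \<open>integrand_above\<close> becomes at \<open>x = 0\<close>: the hypergeometric
  argument vanishes and the two powers of \<open>t\<close> combine, so that \<open>\<nu>\<close>
  drops out. It is also the complex form of the density of \<open>D\<^sub>\<mu>\<close>.\<close>

definition integrand_boundary :: "complex \<Rightarrow> complex \<Rightarrow> real \<Rightarrow> real \<Rightarrow> complex" where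
  "integrand_boundary \<mu> p y t =
     exp (- p * of_real t) * of_real t powr (- (1 + \<mu>) / 2) * of_real (y + t) powr (\<mu> / 2)"

lemma integrand_above_boundary:
  assumes "t > 0"
  shows "integrand_above \<nu> \<mu> p 0 y t = integrand_boundary \<mu> p y t"
proof -
  have "\<nu> / 2 + - (1 + \<mu> + \<nu>) / 2 = - (1 + \<mu>) / 2" by (simp add: field_simps)
  then have "complex_of_real t powr (\<nu> / 2) * of_real t powr (- (1 + \<mu> + \<nu>) / 2) = of_real t powr (- (1 + \<mu>) / 2)"
    by (simp only: powr_add[symmetric])
  then show ?thesis
    unfolding integrand_above_def integrand_boundary_def by (simp add: mult.assoc)
qed

lemma integrand_boundary_dominated:
  fixes \<mu>0 p :: complex and y :: real
  assumes \<mu>0: "Re \<mu>0 < 1" and p: "Re p > 0" and y: "y > 0"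
  obtains r W where "r > 0" "set_integrable lborel {0<..} W"
    "\<And>\<mu> t. \<mu> \<in> cball \<mu>0 r \<Longrightarrow> t \<in> {0<..} \<Longrightarrow> norm (integrand_boundary \<mu> p y t) \<le> W t"
proof -
  \<comment> \<open>The margin of the exponent at \<open>t = 0\<close> above \<open>-1\<close>. With
    radius \<open>d\<close> the exponent changes by at most half of it.\<close>
  define d where "d = (1 - Re \<mu>0) / 2"
  have d: "d > 0" using \<mu>0 by (simp add: d_def)
  define e where "e = d / 2 - 1"
  define m where "m = min 1 y"
  define E where "E = \<bar>Re \<mu>0\<bar> + 2 * d"
  define W where "W t = m powr (- E) * ((t - 0) powr e * (t + (y + 1)) powr (2 * E) * exp (- Re p * t))" for t
  have m: "0 < m" "m \<le> 1" "m \<le> y" using y by (auto simp: m_def)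
  show thesis
  proof (rule that[OF d])
    show "set_integrable lborel {0<..} W"
      unfolding W_def using set_integrable_power_exp[of e "Re p" 0 "y + 1" "2 * E"] d p y by (simp add: e_def E_def)
    fix \<mu> :: complex and t :: real
    assume \<mu>: "\<mu> \<in> cball \<mu>0 d" and "t \<in> {0<..}"
    then have t: "t > 0" by simp
    note re = Re_cball_le[OF \<mu>, unfolded abs_le_iff]
    have "norm (integrand_boundary \<mu> p y t) = exp (- Re p * t) * t powr (- (1 + Re \<mu>) / 2) * (y + t) powr (Re \<mu> / 2)"
    proof -
      have q: "norm (complex_of_real t powr (- (1 + \<mu>) / 2)) = t powr (- (1 + Re \<mu>) / 2)"
        "norm (complex_of_real (y + t) powr (\<mu> / 2)) = (y + t) powr (Re \<mu> / 2)"
        using t y by (simp_all only: norm_of_real_powr Re_divide_numeral) auto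
      show ?thesis unfolding integrand_boundary_def norm_mult norm_exp_times_of_real q ..
    qed
    also have "\<dots> \<le> exp (- Re p * t) * (t powr e * (t + (y + 1)) powr E) * (m powr (- E) * (t + (y + 1)) powr E)"
    proof (intro mult_mono order_refl)
      have "- (1 + Re \<mu>) / 2 = d - 1 - (Re \<mu> - Re \<mu>0) / 2" by (simp add: d_def field_simps)
      then have "e \<le> - (1 + Re \<mu>) / 2" "- (1 + Re \<mu>) / 2 \<le> e + E"
        using re d abs_ge_zero[of "Re \<mu>0"] unfolding e_def E_def by argo+
      then show "t powr (- (1 + Re \<mu>) / 2) \<le> t powr e * (t + (y + 1)) powr E"
        using t y by (intro powr_le_lower_exponent) auto
      have "\<bar>Re \<mu> / 2\<bar> \<le> E" using Re_cball_le[OF \<mu>] d unfolding E_def by linarith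
      then show "(y + t) powr (Re \<mu> / 2) \<le> m powr (- E) * (t + (y + 1)) powr E"
        using t y m by (intro powr_le_two_sided) auto
    qed auto
    also have "\<dots> = W t"
    proof -
      have "(t + (y + 1)) powr (2 * E) = (t + (y + 1)) powr E * (t + (y + 1)) powr E" by (simp flip: powr_add)
      then show ?thesis unfolding W_def diff_zero by (simp only: mult_ac)
    qed
    finally show "norm (integrand_boundary \<mu> p y t) \<le> W t" .
  qed
qed

lemma set_borel_measurable_integrand_boundary:
  assumes "y > 0"
  shows "set_borel_measurable lborel {0<..} (integrand_boundary \<mu> p y)"
  unfolding integrand_boundary_def[abs_def]
  by (intro set_borel_measurable_lborel_continuous continuous_on_mult continuous_on_of_real_powr continuous_intros)
    (use assms in auto)

lemma set_integrable_integrand_boundary: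
  assumes "Re \<mu> < 1" "Re p > 0" "y > 0"
  shows "set_integrable lborel {0<..} (integrand_boundary \<mu> p y)"
proof -
  obtain r W where "r > 0" and W: "set_integrable lborel {0<..} W"
    "\<And>\<mu>1 t. \<mu>1 \<in> cball \<mu> r \<Longrightarrow> t \<in> {0<..} \<Longrightarrow> norm (integrand_boundary \<mu>1 p y t) \<le> W t"
    using integrand_boundary_dominated[OF assms] by metis
  show ?thesis
  proof (rule set_integrable_bound[OF W(1) set_borel_measurable_integrand_boundary[OF assms(3)]])
    have "norm (integrand_boundary \<mu> p y t) \<le> norm (W t)" if "t \<in> {0<..}" for t
      using W(2)[of \<mu> t] that \<open>r > 0\<close> by simp
    then show "AE t in lborel. t \<in> {0<..} \<longrightarrow> norm (integrand_boundary \<mu> p y t) \<le> norm (W t)" by simp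
  qed
qed

text \<open>Continues the transform from real \<open>\<mu> < 0\<close> to all \<open>\<mu>\<close>
  for which the density is integrable at \<open>t = 0\<close>.\<close>

lemma parabolic_cylinder_D_laplace:
  fixes \<mu> p :: complex and y :: real
  assumes \<mu>: "Re \<mu> < 1" and p: "Re p > 0" and y: "y > 0"
  shows "p powr (- 1 / 2) * exp (p * of_real y / 2) *
      parabolic_cylinder_D \<mu> (2 powr (1 / 2) * of_real y powr (1 / 2) * p powr (1 / 2))
    = 2 powr (\<mu> / 2) * rGamma ((1 - \<mu>) / 2) * (LBINT t:{0<..}. integrand_boundary \<mu> p y t)"
    (is "?lhs \<mu> = ?rhs \<mu>")
proof -
  define S where "S = {m. Re m < 1}"
  have S: "open S" "connected S"
    unfolding S_def by (intro open_halfspace_Re_lt convex_connected convex_halfspace_Re_lt)+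
  show ?thesis
  proof (rule identity_theorem_real[of ?lhs S ?rhs "{..<0}" "- 1"])
    show "?lhs holomorphic_on S"
      by (intro holomorphic_on_mult holomorphic_on_const holomorphic_on_parabolic_cylinder_D S holomorphic_on_ident)
    have "(\<lambda>s. LBINT t:{0<..}. integrand_boundary s p y t) holomorphic_on S"
    proof (rule holomorphic_on_integral_of_parameters[OF S(1) holomorphic_on_ident holomorphic_on_ident])
      show "set_borel_measurable lborel {0<..} (integrand_boundary s p y)" for s
        by (rule set_borel_measurable_integrand_boundary[OF y])
      show "(\<lambda>s. integrand_boundary s p y t) holomorphic_on S" if "t \<in> {0<..}" for t
        unfolding integrand_boundary_def
        by (intro holomorphic_on_mult holomorphic_on_of_real_powr holomorphic_intros) (use that y in auto)
      fix s assume "s \<in> S"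
      then have "Re s < 1" by (simp add: S_def)
      from integrand_boundary_dominated[OF this p y] obtain r W where "r > 0" "set_integrable lborel {0<..} W"
        "\<And>\<mu> t. \<mu> \<in> cball s r \<Longrightarrow> t \<in> {0<..} \<Longrightarrow> norm (integrand_boundary \<mu> p y t) \<le> W t" by metis
      then show "\<exists>r>0. \<exists>W. set_integrable lborel {0<..} W \<and>
          (\<forall>\<nu>\<in>cball s r. \<forall>\<mu>\<in>cball s r. \<forall>t\<in>{0<..}. norm (integrand_boundary \<mu> p y t) \<le> W t)" by blast
    qed
    then show "?rhs holomorphic_on S" by (intro holomorphic_intros) auto
    fix r :: real assume "r \<in> {..<0}"
    then have a: "- r / 2 > 0" by simp
    have c: "complex_of_real r / 2 = of_real (r / 2)" "(1 - complex_of_real r) / 2 = of_real ((1 - r) / 2)" by simp_all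
    have "- r / 2 + 1 / 2 = (1 - r) / 2" by (simp add: field_simps)
    then have G: "rGamma ((1 - complex_of_real r) / 2) = of_real (1 / Gamma (- r / 2 + 1 / 2))"
      unfolding c rGamma_inverse_Gamma Gamma_complex_of_real by (simp only: of_real_divide of_real_1 inverse_eq_divide)
    have two: "2 powr (complex_of_real r / 2) = of_real (2 powr (- (- r / 2)))"
      using powr_of_real[of 2 "r / 2"] by simp
    have I: "(LBINT t:{0<..}. integrand_boundary (of_real r) p y t)
        = (LBINT t:{0<..}. exp (- p * of_real t) * of_real (t powr (- r / 2 - 1 / 2) * (y + t) powr (- (- r / 2))))"
    proof (rule set_lebesgue_integral_cong, simp, intro allI impI)
      fix t :: real assume "t \<in> {0<..}"
      then have t: "t > 0" by simp
      have "- (1 + complex_of_real r) / 2 = of_real (- r / 2 - 1 / 2)" by (simp add: field_simps)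
      moreover have "complex_of_real t powr of_real (- r / 2 - 1 / 2) = of_real (t powr (- r / 2 - 1 / 2))"
        "complex_of_real (y + t) powr of_real (r / 2) = of_real ((y + t) powr (- (- r / 2)))"
        using of_real_powr_of_real[of t "- r / 2 - 1 / 2"] of_real_powr_of_real[of "y + t" "r / 2"] t y by simp_all
      ultimately show "integrand_boundary (of_real r) p y t
          = exp (- p * of_real t) * of_real (t powr (- r / 2 - 1 / 2) * (y + t) powr (- (- r / 2)))"
        unfolding integrand_boundary_def c by (simp only: of_real_mult mult.assoc)
    qed
    show "?lhs (of_real r) = ?rhs (of_real r)"
      using parabolic_cylinder_D_laplace_real[OF a y p] unfolding G two I by simp
  qed (use S \<mu> in \<open>auto simp: S_def\<close>)
qed

text \<open>At \<open>x = 0\<close> Kummer's function is 1 and the even part of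
  \<open>D\<^sub>\<nu>\<close> is a constant, so the formula is a multiple of the Laplace transform
  of \<open>D\<^sub>\<mu>\<close>.\<close>

lemma product_formula_boundary:
  fixes \<nu> \<mu> p :: complex and y :: real
  assumes "Re \<mu> < 1" "Re p > 0" "y > 0"
  shows "p powr (- 1 / 2) * exp (p * of_real (y - 0) / 2)
         * parabolic_cylinder_D \<mu> (2 powr (1 / 2) * of_real y powr (1 / 2) * p powr (1 / 2))
         * (parabolic_cylinder_D \<nu> (- (2 powr (1 / 2)) * of_real 0 powr (1 / 2) * p powr (1 / 2))
            + parabolic_cylinder_D \<nu> (2 powr (1 / 2) * of_real 0 powr (1 / 2) * p powr (1 / 2)))
       = 2 powr (1 + (\<mu> + \<nu>) / 2) * of_real (sqrt pi)
           * rGamma ((1 - \<nu>) / 2) * rGamma ((1 - \<mu>) / 2)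
           * (LBINT t:{0<..}. integrand_above \<nu> \<mu> p 0 y t)"
proof -
  have I: "(LBINT t:{0<..}. integrand_above \<nu> \<mu> p 0 y t) = (LBINT t:{0<..}. integrand_boundary \<mu> p y t)"
    by (rule set_lebesgue_integral_cong) (auto simp: integrand_above_boundary)
  have "(\<lambda>n. pochhammer (- \<nu> / 2) n / pochhammer (1 / 2) n * 0 ^ n / fact n) = (\<lambda>n. if n = 0 then 1 else 0)"
    by (rule ext) simp
  then have "(\<lambda>n. if n = 0 then 1 else 0) sums kummer_Phi (- \<nu> / 2) (1 / 2) 0"
    using kummer_Phi_sums[of "1 / 2" "- \<nu> / 2" 0] by simp
  then have "kummer_Phi (- \<nu> / 2) (1 / 2) 0 = 1"
    using sums_single[of 0 "\<lambda>_. 1 :: complex"] by (rule sums_unique2)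
  then have D: "parabolic_cylinder_D \<nu> 0 + parabolic_cylinder_D \<nu> 0
      = 2 * 2 powr (\<nu> / 2) * of_real (sqrt pi) * rGamma ((1 - \<nu>) / 2)"
    using parabolic_cylinder_D_even_part[of \<nu> 0] by (simp add: Gamma_one_half_complex)
  have "2 powr (1 + (\<mu> + \<nu>) / 2) = (2 powr 1 * 2 powr (\<mu> / 2) * 2 powr (\<nu> / 2) :: complex)"
    by (simp only: powr_add[symmetric] add_divide_distrib add.assoc)
  then have two: "2 powr (1 + (\<mu> + \<nu>) / 2) = (2 * 2 powr (\<mu> / 2) * 2 powr (\<nu> / 2) :: complex)"
    by simp
  show ?thesis
    using parabolic_cylinder_D_laplace[OF assms] D unfolding I two by (simp add: mult_ac)
qed

theorem theorem3p3:
  fixes \<nu> \<mu> p :: complex and x y :: real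
  assumes "Re \<nu> < 1"
    and "Re \<mu> < min (1 - Re \<nu>) (2 + Re \<nu>)"
    and "Re p > 0"
    and "x \<ge> 0" and "\<bar>Arg (of_real x)\<bar> < pi"
    and "y > 0" and "\<bar>Arg (of_real y)\<bar> < pi"
    and "x = 0 \<longrightarrow> Re \<mu> < 1"
  shows "set_integrable lborel {0<..<x} (integrand_below \<nu> \<mu> p x y)
    \<and> set_integrable lborel {x<..} (integrand_above \<nu> \<mu> p x y)
    \<and> p powr (- 1 / 2) * exp (p * of_real (y - x) / 2)
         * parabolic_cylinder_D \<mu> (2 powr (1 / 2) * of_real y powr (1 / 2) * p powr (1 / 2))
         * (parabolic_cylinder_D \<nu> (- (2 powr (1 / 2)) * of_real x powr (1 / 2) * p powr (1 / 2))
            + parabolic_cylinder_D \<nu> (2 powr (1 / 2) * of_real x powr (1 / 2) * p powr (1 / 2)))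
       = 2 powr ((\<mu> - \<nu>) / 2) * of_real (sqrt pi)
           * rGamma (1 + (\<nu> - \<mu>) / 2) * rGamma (- \<nu>)
           * (LBINT t:{0<..<x}. integrand_below \<nu> \<mu> p x y t)
         + 2 powr (1 + (\<mu> + \<nu>) / 2) * of_real (sqrt pi)
           * rGamma ((1 - \<nu>) / 2) * rGamma ((1 - \<mu>) / 2)
           * (LBINT t:{x<..}. integrand_above \<nu> \<mu> p x y t)"
proof (cases "x = 0")
  \<comment> \<open>For \<open>-1 < Re \<nu> < 0\<close> the general bounds on \<open>\<mu>\<close>
    admit \<open>Re \<mu> \<ge> 1\<close>, where the integrand is not absolutely integrable at
    \<open>t = 0\<close>; the extra condition for \<open>x = 0\<close> excludes this. The first
    integral is over an empty interval and vanishes.\<close>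
  case True
  have "set_integrable lborel {0<..} (integrand_above \<nu> \<mu> p 0 y)"
  proof (subst set_integrable_cong[OF refl refl])
    show "set_integrable lborel {0<..} (integrand_boundary \<mu> p y)"
      by (rule set_integrable_integrand_boundary) (use assms True in auto)
  qed (simp add: integrand_above_boundary)
  then show ?thesis
    unfolding True using product_formula_boundary[of \<mu> p y \<nu>] assms True
    by (simp add: set_integrable_def set_lebesgue_integral_def)
next
  case False
  then have "x > 0" using assms by simp
  have "Re \<mu> < 1 - Re \<nu>" "Re \<mu> < 2 + Re \<nu>" using assms by simp_all
  note par = assms(1) this assms(3) \<open>x > 0\<close> assms(6)
  show ?thesis
    by (intro conjI set_integrable_integrands[OF par] product_formula_pos[OF par])
qed

end
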